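(* Let $K$ be a field of characteristic different from $2$ and $3$ (characteristic $0$ allowed). For $A,B,a_0,\ldots,a_5\in K$ let $C=V(P,Q)\subset\mathbb{P}^3=\mathrm{Proj}\,K[x,y,z,w]$, where $$P=y^2z-(x^3+Axz^2+Bz^3),\qquad Q=w^2-q(x,y,z),$$ $$q(x,y,z)=a_0x^2+a_1xy+a_2xz+a_3y^2+a_4yz+a_5z^2.$$ Let $f_1$ and $f_2$ be the polynomials in $A,B,a_0,\ldots,a_5$ defined in the context. Then $C$ is nonsingular if and only if (i) $f_1=4A^3+27B^2\neq 0$, and (ii) $f_2=\Delta/(f_3)^2\neq 0$ (where $f_1,f_2$ are evaluated at the given values of $A,B,a_0,\ldots,a_5$). Moreover, over an arbitrary field $K$ of characteristic $0$ or $p\ge 5$, $f_2$ is an irreducible polynomial in $K[A,B,a_0,\ldots,a_5]$ (here $A,B,a_0,\ldots,a_5$ are indeterminates).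
   Context: Regard $A,B,a_0,\ldots,a_5$ as indeterminates over $K$. Let $G(x)\in K[A,B,a_0,\ldots,a_5][x]$ be the resultant of $P|_{z=1}=y^2-(x^3+Ax+B)$ and $q|_{z=1}=a_0x^2+a_1xy+a_2x+a_3y^2+a_4y+a_5$ considered as polynomials in $y$; it has degree $6$ in $x$. Let $\Delta\in K[A,B,a_0,\ldots,a_5]$ be the discriminant of $G(x)$ (as a polynomial of degree $6$ in $x$). Put $$f_3:=Aa_1^2a_3a_4-Ba_1^3a_3-a_0a_1a_4^2-a_1^3a_5+a_1^2a_2a_4+a_3a_4^3.$$ The polynomial $\Delta$ is divisible by $f_3^2$ in $K[A,B,a_0,\ldots,a_5]$, and $f_2:=\Delta/(f_3)^2$ denotes the quotient polynomial, which can then be evaluated at elements of $K$. Also $f_1:=4A^3+27B^2$. "Nonsingular" means that the Jacobian matrix of $(P,Q)$ with respect to $x,y,z,w$ has rank $2$ at every point of $C$ over the algebraic closure $\overline K$. *)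

theory Defs
  imports
    "Subresultants.Resultant_Prelim"
    "Jordan_Normal_Form.DL_Rank"
    "HOL-Algebra.Algebraic_Closure_Type"
begin

text \<open>
  The two forms are written over an arbitrary commutative ring. Inserting
  indeterminates for the arguments gives the corresponding polynomials.
\<close>

definition cubic_form :: "'r::comm_ring_1 \<Rightarrow> 'r \<Rightarrow> 'r \<Rightarrow> 'r \<Rightarrow> 'r \<Rightarrow> 'r" where
  "cubic_form A B x y z = y^2 * z - (x^3 + A * x * z^2 + B * z^3)"

definition quadratic_form ::
  "'r::comm_ring_1 \<Rightarrow> 'r \<Rightarrow> 'r \<Rightarrow> 'r \<Rightarrow> 'r \<Rightarrow> 'r \<Rightarrow> 'r \<Rightarrow> 'r \<Rightarrow> 'r \<Rightarrow> 'r" where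
  "quadratic_form a0 a1 a2 a3 a4 a5 x y z =
     a0 * x^2 + a1 * x * y + a2 * x * z + a3 * y^2 + a4 * y * z + a5 * z^2"


text \<open>
  The ring $F[x,y,z,w]$ is the iterated polynomial ring $F[x][y][z][w]$
  (\<open>x\<close> is the innermost variable, \<open>w\<close> the outermost one).
\<close>

type_synonym 'f poly4 = "'f poly poly poly poly"

definition const4 :: "'f::comm_ring_1 \<Rightarrow> 'f poly4" where "const4 c = [:[:[:[:c:]:]:]:]"

definition X4 :: "'f::comm_ring_1 poly4" where "X4 = [:[:[:[:0, 1:]:]:]:]"
definition Y4 :: "'f::comm_ring_1 poly4" where "Y4 = [:[:[:0, 1:]:]:]"
definition Z4 :: "'f::comm_ring_1 poly4" where "Z4 = [:[:0, 1:]:]"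
definition W4 :: "'f::comm_ring_1 poly4" where "W4 = [:0, 1:]"

definition eval4 :: "'f::comm_ring_1 poly4 \<Rightarrow> 'f \<Rightarrow> 'f \<Rightarrow> 'f \<Rightarrow> 'f \<Rightarrow> 'f" where
  "eval4 p x y z w = poly (poly (poly (poly p [:[:[:w:]:]:]) [:[:z:]:]) [:y:]) x"

definition pderiv_x :: "'f::field poly4 \<Rightarrow> 'f poly4" where
  "pderiv_x = map_poly (map_poly (map_poly pderiv))"
definition pderiv_y :: "'f::field poly4 \<Rightarrow> 'f poly4" where
  "pderiv_y = map_poly (map_poly pderiv)"
definition pderiv_z :: "'f::field poly4 \<Rightarrow> 'f poly4" where
  "pderiv_z = map_poly pderiv"
definition pderiv_w :: "'f::field poly4 \<Rightarrow> 'f poly4" where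
  "pderiv_w = pderiv"

definition base_change :: "'k::field poly4 \<Rightarrow> 'k alg_closure poly4" where
  "base_change = map_poly (map_poly (map_poly (map_poly to_ac)))"

definition jacobian :: "'f::field poly4 \<Rightarrow> 'f poly4 \<Rightarrow> 'f \<Rightarrow> 'f \<Rightarrow> 'f \<Rightarrow> 'f \<Rightarrow> 'f mat" where
  "jacobian P Q x y z w = mat_of_rows_list 4
     (map (\<lambda>F. map (\<lambda>D. eval4 (D F) x y z w) [pderiv_x, pderiv_y, pderiv_z, pderiv_w]) [P, Q])"

text \<open>
  Points of $\mathbb{P}^3$ over the algebraic closure are represented by their nonzero
  homogeneous coordinate vectors; for homogeneous \<open>P\<close> and \<open>Q\<close> both the vanishing and the
  rank are independent of the choice of coordinates.
\<close>

definition nonsingular :: "'k::field poly4 \<Rightarrow> 'k poly4 \<Rightarrow> bool" where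
  "nonsingular P Q \<longleftrightarrow>
     (\<forall>x y z w :: 'k alg_closure.
        (x, y, z, w) \<noteq> (0, 0, 0, 0) \<and>
        eval4 (base_change P) x y z w = 0 \<and> eval4 (base_change Q) x y z w = 0 \<longrightarrow>
        vec_space.rank 2 (jacobian (base_change P) (base_change Q) x y z w) = 2)"

definition P_poly :: "'k::field \<Rightarrow> 'k \<Rightarrow> 'k poly4" where
  "P_poly A B = cubic_form (const4 A) (const4 B) X4 Y4 Z4"

definition Q_poly :: "'k::field \<Rightarrow> 'k \<Rightarrow> 'k \<Rightarrow> 'k \<Rightarrow> 'k \<Rightarrow> 'k \<Rightarrow> 'k poly4" where
  "Q_poly a0 a1 a2 a3 a4 a5 =
     W4^2 - quadratic_form (const4 a0) (const4 a1) (const4 a2) (const4 a3) (const4 a4) (const4 a5)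
              X4 Y4 Z4"


text \<open>
  The ring $K[A,B,a_0,\ldots,a_5]$ is the iterated polynomial ring
  $K[A][B][a_0]\cdots[a_5]$ (\<open>A\<close> innermost, \<open>a5\<close> outermost).
\<close>

type_synonym 'k poly8 = "'k poly poly poly poly poly poly poly poly"

definition var_A :: "'k::field poly8" where "var_A = [:[:[:[:[:[:[:[:0, 1:]:]:]:]:]:]:]:]"
definition var_B :: "'k::field poly8" where "var_B = [:[:[:[:[:[:[:0, 1:]:]:]:]:]:]:]"
definition var_a0 :: "'k::field poly8" where "var_a0 = [:[:[:[:[:[:0, 1:]:]:]:]:]:]"
definition var_a1 :: "'k::field poly8" where "var_a1 = [:[:[:[:[:0, 1:]:]:]:]:]"
definition var_a2 :: "'k::field poly8" where "var_a2 = [:[:[:[:0, 1:]:]:]:]"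
definition var_a3 :: "'k::field poly8" where "var_a3 = [:[:[:0, 1:]:]:]"
definition var_a4 :: "'k::field poly8" where "var_a4 = [:[:0, 1:]:]"
definition var_a5 :: "'k::field poly8" where "var_a5 = [:0, 1:]"

definition eval8 ::
  "'k::field poly8 \<Rightarrow> 'k \<Rightarrow> 'k \<Rightarrow> 'k \<Rightarrow> 'k \<Rightarrow> 'k \<Rightarrow> 'k \<Rightarrow> 'k \<Rightarrow> 'k \<Rightarrow> 'k" where
  "eval8 p A B a0 a1 a2 a3 a4 a5 =
     poly (poly (poly (poly (poly (poly (poly (poly p
       [:[:[:[:[:[:[:a5:]:]:]:]:]:]:]) [:[:[:[:[:[:a4:]:]:]:]:]:]) [:[:[:[:[:a3:]:]:]:]:])
       [:[:[:[:a2:]:]:]:]) [:[:[:a1:]:]:]) [:[:a0:]:]) [:B:]) A"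

text \<open>
  $P|_{z=1}$ and $q|_{z=1}$ over a coefficient ring \<open>'r\<close>, as elements of $R[x][y]$
  (so \<open>y\<close> is the main variable, with respect to which the resultant is taken).
\<close>

definition P_affine :: "'r::comm_ring_1 \<Rightarrow> 'r \<Rightarrow> 'r poly poly" where
  "P_affine A B = cubic_form [:[:A:]:] [:[:B:]:] [:[:0, 1:]:] [:0, 1:] 1"

definition q_affine ::
  "'r::comm_ring_1 \<Rightarrow> 'r \<Rightarrow> 'r \<Rightarrow> 'r \<Rightarrow> 'r \<Rightarrow> 'r \<Rightarrow> 'r poly poly" where
  "q_affine a0 a1 a2 a3 a4 a5 =
     quadratic_form [:[:a0:]:] [:[:a1:]:] [:[:a2:]:] [:[:a3:]:] [:[:a4:]:] [:[:a5:]:]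
       [:[:0, 1:]:] [:0, 1:] 1"

definition G_poly :: "'k::field poly8 poly" where
  "G_poly = resultant (P_affine var_A var_B)
                      (q_affine var_a0 var_a1 var_a2 var_a3 var_a4 var_a5)"

text \<open>
  The discriminant $(-1)^{n(n-1)/2}\,\mathrm{Res}_{n,n-1}(f,f')/\mathrm{lc}(f)$ of a polynomial
  of exact degree \<open>n > 0\<close>. The resultant is formed with the formal degree \<open>n - 1\<close> of $f'$, so that
  the formula is right even if \<open>n\<close> is zero in the coefficient ring. The division is exact, since
  the only nonzero entries of the first column of the Sylvester matrix are \<open>coeff f n\<close>
  and \<open>n * coeff f n\<close>.
\<close>

definition discriminant :: "nat \<Rightarrow> 'r::idom_divide poly \<Rightarrow> 'r" where
  "discriminant n f =
     (-1) ^ (n * (n - 1) div 2) * (resultant_sub n (n - 1) f (pderiv f) div Polynomial.coeff f n)"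

definition Delta_poly :: "'k::field poly8" where
  "Delta_poly = discriminant 6 G_poly"

definition f3_poly :: "'k::field poly8" where
  "f3_poly =
     var_A * var_a1^2 * var_a3 * var_a4 - var_B * var_a1^3 * var_a3 - var_a0 * var_a1 * var_a4^2
     - var_a1^3 * var_a5 + var_a1^2 * var_a2 * var_a4 + var_a3 * var_a4^3"

definition f2_poly :: "'k::field poly8" where
  "f2_poly = Delta_poly div f3_poly^2"

definition f1_poly :: "'k::field poly8" where
  "f1_poly = 4 * var_A^3 + 27 * var_B^2"

end

theory Submission
  imports Defs "Subresultants.Subresultant_Gcd"
begin

text \<open>
  Write \<open>c = x^3 + A x + B\<close>. On the cubic \<open>y^2 = c\<close> the quadric \<open>q\<close> becomes \<open>u + l y\<close> with
  \<open>u = a3 c + a0 x^2 + a2 x + a5\<close> and \<open>l = a1 x + a4\<close>, and \<open>G = u^2 - l^2 c\<close> is the norm of this function.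

  The curve \<open>C\<close> is the double cover \<open>w^2 = q\<close> of the cubic. The Jacobian criterion
  (\<open>singular_point_iff\<close>) therefore says that \<open>C\<close> is singular iff the cubic is singular, that is \<open>f1 = 0\<close>, or
  the quadric meets the cubic somewhere with multiplicity at least two: in an affine point (\<open>tangent\<close>) or
  in the point at infinity, where it means \<open>a1 = a3 = 0\<close>. What has to be shown is that, for \<open>f1 \<noteq> 0\<close>,
  \<open>f2\<close> is the equation of this tangency condition (\<open>f2_zero_iff_tangent\<close>), and that it is irreducible.

  A multiple root \<open>x\<close> of \<open>G\<close> has one of two causes. Either the quadric is tangent to the cubic at \<open>(x, - u / l)\<close>,
  or \<open>u\<close> and \<open>l\<close> both vanish at \<open>x\<close> and the quadric passes through the two points \<open>(x, y)\<close> and \<open>(x, - y)\<close>.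
  In the second case \<open>f3\<close> vanishes, which for \<open>a1 \<noteq> 0\<close> is \<open>- a1^3 u(- a4 / a1)\<close>. In the coordinate \<open>l\<close> instead of \<open>x\<close>, the constant
  coefficient of a multiple of \<open>G\<close> is \<open>f3^2\<close> and the linear one is a multiple of \<open>f3\<close>, which makes \<open>f3^2\<close>
  divide the discriminant (\<open>f3_form_sq_dvd_disc6\<close>); the power of \<open>a1\<close> introduced by the substitution is
  prime to \<open>f3\<close>. Up to the unit 1296 the discriminant is the resultant \<open>disc6\<close> of the two partial derivatives of the
  sextic form, which also makes sense when the leading coefficient \<open>a3^2\<close> vanishes.

  Tangency at \<open>(s, t)\<close> can be solved for \<open>B\<close>, \<open>a2\<close>, \<open>a4\<close> and \<open>a5\<close> with the help of a Lagrange
  multiplier, so the tangency locus is the image of an affine space (\<open>on_tangency\<close>). Since the discriminant vanishes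
  identically on this image and \<open>f3\<close> does not, \<open>f2\<close> does (\<open>restrict_tangency_f2\<close>). Hence tangency implies \<open>f2 = 0\<close>.

  The same parametrisation gives irreducibility over an algebraically closed field. Since a product that vanishes on
  the image of an affine space has a factor that does, some prime factor \<open>g\<close> of \<open>f2\<close> vanishes on the tangency locus. Every
  prime factor \<open>h\<close> of \<open>f2\<close> involves \<open>a5\<close>, because the coefficient of \<open>a5^7\<close> in \<open>f2\<close> is \<open>- 46656 a3^5\<close>
  (\<open>f2_coeff7\<close>) and \<open>a3\<close> does not divide \<open>f2\<close>; where \<open>h = 0\<close> and \<open>f1 f3 \<noteq> 0\<close> there is a tangency, so
  \<open>g = 0\<close>. By the Nullstellensatz for hypersurfaces \<open>h\<close> divides \<open>g\<close>. So \<open>f2\<close> is a power of \<open>g\<close>, up to a unit, and on the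
  line \<open>A = B = a0 = a1 = a2 = 0\<close>, \<open>a3 = a4 = 1\<close> it equals \<open>- 729 a5^4 (4 a5 - 1)^3\<close>; the exponents 4 and 3
  being coprime, the power is the first one. Irreducibility descends to \<open>K\<close>.

  It remains to see that \<open>f2 = 0\<close> forces a tangency even where \<open>f3 = 0\<close>. A second elimination, the resultant of
  \<open>G\<close> with the norm of a combination of the tangency equations (\<open>eliminant\<close>), vanishes at every
  tangency. As \<open>f2\<close> is irreducible and not \<open>f3\<close>, it divides this resultant (\<open>f2_dvd_eliminant\<close>), and the free parameters
  in the combination can be chosen so that the resultant is nonzero at any given tangency-free
  quadric (\<open>f2_nonzero_of_no_tangent\<close>).
\<close>

hide_const (open) Polynomials.degree Polynomials.lead_coeff Divisibility.irreducible Divisibility.prime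
  Coset.order up_ring.coeff up_ring.monom

section \<open>Ring homomorphisms and evaluation\<close>

text \<open>
  Polynomials in several variables are iterated univariate polynomials; a homomorphism on the coefficients and one
  value at a time determine evaluation in any target ring, including another polynomial ring.
\<close>
definition ev :: "('a::comm_ring_1 \<Rightarrow> 's::comm_ring_1) \<Rightarrow> 's \<Rightarrow> 'a poly \<Rightarrow> 's" where
  "ev h x p = poly (map_poly h p) x"

lemma map_poly_comm_ring_hom:
  assumes "comm_ring_hom h" shows "comm_ring_hom (map_poly h)"
proof -
  interpret h: comm_ring_hom h by fact
  interpret m: map_poly_comm_ring_hom h ..
  show ?thesis ..
qed

lemma comm_ring_hom_ev:
  assumes "comm_ring_hom h" shows "comm_ring_hom (ev h x)"
proof -
  interpret h: comm_ring_hom h by fact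
  interpret m: map_poly_comm_ring_hom h ..
  show ?thesis by unfold_locales (auto simp: ev_def hom_distribs)
qed

lemma ev_const [simp]: "comm_ring_hom h \<Longrightarrow> ev h x [:c:] = h c"
proof -
  assume "comm_ring_hom h"
  then interpret h: comm_ring_hom h .
  have "map_poly h [:c:] = [:h c:]"
    by (rule poly_eqI) (simp add: coeff_map_poly coeff_pCons split: nat.split)
  then show ?thesis by (simp add: ev_def)
qed

lemma ev_var [simp]: "comm_ring_hom h \<Longrightarrow> ev h x [:0, 1:] = x"
proof -
  assume "comm_ring_hom h"
  then interpret h: comm_ring_hom h .
  show ?thesis by (simp add: ev_def)
qed

lemma hom_ev:
  assumes "comm_ring_hom g" "comm_ring_hom h"
  shows "g (ev h x p) = ev (g \<circ> h) (g x) p"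
proof -
  interpret g: comm_ring_hom g by fact
  interpret h: comm_ring_hom h by fact
  have "map_poly g (map_poly h p) = map_poly (g \<circ> h) p"
    by (rule map_poly_map_poly) auto
  then show ?thesis by (simp add: ev_def flip: g.poly_map_poly)
qed

lemma ev_poly_poly:
  fixes h :: "'a::comm_ring_1 \<Rightarrow> 's::comm_ring_1"
  assumes h: "comm_ring_hom h"
  shows "h (poly p c) = ev h (h c) p"
proof -
  interpret comm_ring_hom h by fact
  show ?thesis using poly_map_poly[of p c] by (simp add: ev_def)
qed

lemma comm_ring_hom_id: "comm_ring_hom (\<lambda>x. x)" by unfold_locales auto

lemma comm_ring_hom_const: "comm_ring_hom (\<lambda>c :: 'a::comm_ring_1. [:c:])"
  by unfold_locales (simp_all add: pCons_one)

lemma comm_ring_hom_poly: "comm_ring_hom (\<lambda>p :: 'a::comm_ring_1 poly. poly p x)"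
  by unfold_locales simp_all

lemma comm_ring_hom_zero: "comm_ring_hom h \<Longrightarrow> h 0 = 0"
proof -
  assume "comm_ring_hom h"
  then interpret h: comm_ring_hom h .
  show ?thesis by (rule h.hom_zero)
qed

lemma comm_ring_hom_to_ac: "comm_ring_hom to_ac"
  by unfold_locales simp_all

lemma map_poly_linear_const:
  assumes "comm_ring_hom h"
  shows "map_poly h [:c:] = [:h c:]" "map_poly h [:0, 1:] = [:0, 1:]"
proof -
  interpret h: comm_ring_hom h by fact
  show "map_poly h [:c:] = [:h c:]" "map_poly h [:0, 1:] = [:0, 1:]"
    by (simp_all only: h.map_poly_pCons_hom h.hom_zero h.hom_one map_poly_0)
qed

lemma degree_map_poly_inj:
  assumes "comm_ring_hom h" "\<And>x. h x = 0 \<Longrightarrow> x = 0"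
  shows "degree (map_poly h p) = degree p"
proof -
  interpret h: comm_ring_hom h by fact
  show ?thesis by (rule degree_map_poly) (use assms(2)[of "lead_coeff p"] in auto)
qed

lemma hom_nonzero:
  fixes h :: "'k::field \<Rightarrow> 's::comm_ring_1"
  assumes "comm_ring_hom h" "c \<noteq> 0" shows "h c \<noteq> 0"
proof -
  interpret h: comm_ring_hom h by fact
  have "h c * h (inverse c) = 1" using assms by (simp flip: h.hom_mult)
  then show ?thesis by auto
qed

lemma six_nonzero_hom:
  fixes h :: "'k::field \<Rightarrow> 's::comm_ring_1"
  assumes "comm_ring_hom h" "(6 :: 'k) \<noteq> 0" shows "(6 :: 's) \<noteq> 0"
proof -
  interpret h: comm_ring_hom h by fact
  show ?thesis using hom_nonzero[OF assms] unfolding h.hom_numeral .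
qed

lemma six_factors:
  assumes "(6 :: 'l::field) \<noteq> 0"
  shows "(2 :: 'l) \<noteq> 0" "(3 :: 'l) \<noteq> 0" "(1296 :: 'l) \<noteq> 0"
proof -
  have "6 = (2 :: 'l) * 3" "1296 = (6 :: 'l) ^ 4" by simp_all
  then show "(2 :: 'l) \<noteq> 0" "(3 :: 'l) \<noteq> 0" "(1296 :: 'l) \<noteq> 0"
    using assms by (metis mult_zero_left, metis mult_zero_right, metis power_eq_0_iff)
qed

text \<open>
  Identities between resultants are proved by factoring over an algebraically closed field and transported
  to integral domains along this embedding.
\<close>
definition to_closed :: "'r::idom \<Rightarrow> 'r fract alg_closure" where "to_closed x = to_ac (to_fract x)"

lemma comm_ring_hom_to_closed: "comm_ring_hom to_closed"
  by unfold_locales (simp_all add: to_closed_def to_fract_hom.hom_add to_fract_hom.hom_mult)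

lemma to_closed_eq_iff [simp]: "to_closed x = to_closed y \<longleftrightarrow> x = y"
  by (simp add: to_closed_def)

lemma to_closed_0_iff: "to_closed x = 0 \<longleftrightarrow> x = 0"
proof -
  interpret e: comm_ring_hom to_closed by (rule comm_ring_hom_to_closed)
  show ?thesis using to_closed_eq_iff[of x 0] by simp
qed

lemma degree_map_poly_to_closed [simp]: "degree (map_poly to_closed p) = degree p"
  by (rule degree_map_poly_inj[OF comm_ring_hom_to_closed]) (simp add: to_closed_0_iff)

lemma to_closed_numeral [simp]: "to_closed (numeral n) = numeral n"
proof -
  interpret e: comm_ring_hom to_closed by (rule comm_ring_hom_to_closed)
  show ?thesis by (rule e.hom_numeral)
qed

section \<open>Resultants with formal degrees\<close>

text \<open>
  Both sides multiply the Leibniz summand of a permutation by the same product. In integral domains this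
  extracts a common factor from a determinant when only combinations of row and column scalings are divisible.
\<close>
lemma det_scaling:
  fixes M :: "'a::comm_ring_1 mat"
  assumes M: "M \<in> carrier_mat n n"
    and N: "\<And>i j. i < n \<Longrightarrow> j < n \<Longrightarrow> r i * M $$ (i,j) = c j * N i j"
  shows "(\<Prod>i<n. r i) * det M = (\<Prod>j<n. c j) * det (mat n n (\<lambda>(i,j). N i j))"
proof -
  have eq: "(\<Prod>i<n. r i) * (\<Prod>i = 0..<n. M $$ (i, p i)) = (\<Prod>j<n. c j) * (\<Prod>i = 0..<n. N i (p i))"
    if "p permutes {0..<n}" for p
  proof -
    have "(\<Prod>i<n. r i) * (\<Prod>i = 0..<n. M $$ (i, p i)) = (\<Prod>i = 0..<n. r i * M $$ (i, p i))"
      by (simp add: prod.distrib lessThan_atLeast0)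
    also have "\<dots> = (\<Prod>i = 0..<n. c (p i) * N i (p i))"
      using that by (intro prod.cong refl N) (auto simp: permutes_in_image dest: permutes_in_image)
    also have "\<dots> = (\<Prod>i = 0..<n. c (p i)) * (\<Prod>i = 0..<n. N i (p i))" by (rule prod.distrib)
    also have "(\<Prod>i = 0..<n. c (p i)) = (\<Prod>i<n. c i)"
      using prod.permute[OF that, of c] by (simp add: o_def lessThan_atLeast0)
    finally show ?thesis .
  qed
  have "(\<Prod>i<n. r i) * det M = (\<Sum>p | p permutes {0..<n}. of_int (sign p) * ((\<Prod>i<n. r i) * (\<Prod>i = 0..<n. M $$ (i, p i))))"
    unfolding det_def'[OF M] by (simp add: sum_distrib_left mult_ac)
  also have "\<dots> = (\<Sum>p | p permutes {0..<n}. of_int (sign p) * ((\<Prod>j<n. c j) * (\<Prod>i = 0..<n. N i (p i))))"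
    by (intro sum.cong refl) (simp add: eq)
  also have "\<dots> = (\<Prod>j<n. c j) * det (mat n n (\<lambda>(i,j). N i j))"
  proof -
    have "mat n n (\<lambda>(i,j). N i j) \<in> carrier_mat n n" by simp
    note d = det_def'[OF this]
    have "(\<Prod>i = 0..<n. mat n n (\<lambda>(i, j). N i j) $$ (i, p i)) = (\<Prod>i = 0..<n. N i (p i))" if "p permutes {0..<n}" for p
      using that by (intro prod.cong refl) (auto simp: permutes_in_image dest: permutes_in_image)
    then show ?thesis unfolding d by (simp add: sum_distrib_left mult_ac)
  qed
  finally show ?thesis .
qed

lemma det_mat_Suc:
  "det (mat (Suc n) (Suc n) f) =
    (\<Sum>j<Suc n. f (0, j) * (-1) ^ j * det (mat n n (\<lambda>(i, k). f (Suc i, if k < j then k else Suc k) :: 'a::comm_ring_1)))"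
proof -
  define A where "A = mat (Suc n) (Suc n) f"
  have A: "A \<in> carrier_mat (Suc n) (Suc n)" by (simp add: A_def)
  have "mat_delete A 0 j = mat n n (\<lambda>(i, k). f (Suc i, if k < j then k else Suc k))" for j
    by (rule eq_matI) (auto simp: A_def mat_delete_def)
  then show ?thesis
    using laplace_expansion_row[OF A, of 0] by (simp add: cofactor_def A_def mult.assoc)
qed

lemma resultant_sub_hom:
  assumes "comm_ring_hom h"
  shows "resultant_sub m n (map_poly h p) (map_poly h q) = h (resultant_sub m n p q)"
proof -
  interpret h: comm_ring_hom h by fact
  show ?thesis unfolding resultant_sub_def by (simp add: sylvester_mat_sub_map flip: h.hom_det)
qed

text \<open>
  The product over the two square roots \<open>y\<close> of \<open>c\<close> of \<open>a y^2 + l y + m\<close>, that is, the norm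
  of \<open>(a c + m) + l y\<close>.
\<close>
lemma resultant_sub_quadratics:
  "resultant_sub 2 2 [:- c, 0, 1:] [:m, l, a:] = (a * c + m)\<^sup>2 - l\<^sup>2 * (c :: 'a::comm_ring_1)"
proof -
  define S where "S = sylvester_mat_sub 2 2 [:- c, 0, 1:] [:m, l, a:]"
  define f where "f = (\<lambda>(i :: nat, j :: nat). if i = 0 then (if j = 0 then 1 else if j = 2 then - c else 0)
    else if i = 1 then (if j = 1 then 1 else if j = 3 then - c else 0)
    else if i = 2 then (if j = 0 then a else if j = 1 then l else if j = 2 then m else 0)
    else (if j = 1 then a else if j = 2 then l else if j = 3 then m else 0))"
  have S: "S = mat (Suc (Suc (Suc (Suc 0)))) (Suc (Suc (Suc (Suc 0)))) f"
  proof (rule eq_matI)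
    fix i j assume "i < dim_row (mat (Suc (Suc (Suc (Suc 0)))) (Suc (Suc (Suc (Suc 0)))) f)"
      "j < dim_col (mat (Suc (Suc (Suc (Suc 0)))) (Suc (Suc (Suc (Suc 0)))) f)"
    then have ij: "i = 0 \<or> i = 1 \<or> i = 2 \<or> i = 3" "j = 0 \<or> j = 1 \<or> j = 2 \<or> j = 3" by auto
    then show "S $$ (i, j) = mat (Suc (Suc (Suc (Suc 0)))) (Suc (Suc (Suc (Suc 0)))) f $$ (i, j)"
      by (elim disjE; simp add: S_def f_def sylvester_mat_sub_index coeff_pCons numeral_2_eq_2 numeral_3_eq_3)
  qed (auto simp: S_def)
  have "resultant_sub 2 2 [:- c, 0, 1:] [:m, l, a:] = det S" by (simp add: resultant_sub_def S_def)
  also have "\<dots> = (a * c + m)\<^sup>2 - l\<^sup>2 * c" unfolding S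
    by (simp add: det_mat_Suc f_def det_dim_zero algebra_simps power2_eq_square)
  finally show ?thesis .
qed

text \<open>
  If the formal leading coefficient vanishes, the first column of the Sylvester matrix has a single
  nonzero entry.
\<close>
lemma resultant_sub_drop_right:
  assumes "coeff q (Suc n) = 0"
  shows "resultant_sub m (Suc n) p q = coeff p m * resultant_sub m n p (q :: 'a::comm_ring_1 poly)"
proof -
  define S where "S = sylvester_mat_sub m (Suc n) p q"
  have S: "S \<in> carrier_mat (m + Suc n) (m + Suc n)" using sylvester_mat_sub_carrier[of m "Suc n" p q] by (simp add: S_def)
  have idx: "S $$ (i, j) = (if i < Suc n then if i \<le> j \<and> j - i \<le> m then coeff p (m + i - j) else 0
     else if i - Suc n \<le> j \<and> j \<le> i then coeff q (i-j) else 0)" if "i < m + Suc n" "j < m + Suc n" for i j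
    using sylvester_mat_sub_index[of i m "Suc n" j p q] that by (simp add: S_def)
  have col: "S $$ (i, 0) = (if i = 0 then coeff p m else 0)" if "i < m + Suc n" for i
    using that assms by (subst idx) (auto simp: le_Suc_eq)
  have "det S = (\<Sum>i<m + Suc n. S $$ (i, 0) * cofactor S i 0)"
    using laplace_expansion_column[OF S, of 0] by simp
  also have "\<dots> = (\<Sum>i<m + Suc n. if i = 0 then coeff p m * cofactor S 0 0 else 0)"
    by (intro sum.cong refl) (simp add: col)
  also have "\<dots> = coeff p m * cofactor S 0 0" by (subst sum.delta) auto
  also have "cofactor S 0 0 = det (mat_delete S 0 0)" by (simp add: cofactor_def)
  also have "mat_delete S 0 0 = sylvester_mat_sub m n p q"
  proof (rule eq_matI)
    fix i j assume "i < dim_row (sylvester_mat_sub m n p q)" "j < dim_col (sylvester_mat_sub m n p q)"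
    then have ij: "i < m + n" "j < m + n" by auto
    have "coeff q (i - j) = 0" if "i - n = Suc j"
    proof -
      have "i - j = Suc n" using that by arith
      with assms show ?thesis by simp
    qed
    with ij show "mat_delete S 0 0 $$ (i, j) = sylvester_mat_sub m n p q $$ (i, j)"
      by (subst mat_delete_index[of S "m+n" 0 0, symmetric])
        (use S in \<open>auto simp: insert_index_def idx sylvester_mat_sub_index le_Suc_eq\<close>)
  qed (use S in \<open>auto simp: mat_delete_def\<close>)
  finally show ?thesis by (simp add: resultant_sub_def S_def)
qed

lemma resultant_sub_drop_left:
  assumes "coeff p (Suc m) = 0"
  shows "resultant_sub (Suc m) n p q = (-1)^n * coeff q n * resultant_sub m n (p :: 'a::comm_ring_1 poly) q"
proof -
  define S where "S = sylvester_mat_sub (Suc m) n p q"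
  have S: "S \<in> carrier_mat (Suc m + n) (Suc m + n)" using sylvester_mat_sub_carrier[of "Suc m" n p q] by (simp add: S_def)
  have idx: "S $$ (i, j) = (if i < n then if i \<le> j \<and> j - i \<le> Suc m then coeff p (Suc m + i - j) else 0
     else if i - n \<le> j \<and> j \<le> i then coeff q (i-j) else 0)" if "i < Suc m + n" "j < Suc m + n" for i j
    using sylvester_mat_sub_index[of i "Suc m" n j p q] that by (simp add: S_def)
  have col: "S $$ (i, 0) = (if i = n then coeff q n else 0)" if "i < Suc m + n" for i
    using that assms by (subst idx) auto
  have "det S = (\<Sum>i<Suc m + n. S $$ (i, 0) * cofactor S i 0)"
    using laplace_expansion_column[OF S, of 0] by simp
  also have "\<dots> = (\<Sum>i<Suc m + n. if i = n then coeff q n * cofactor S n 0 else 0)"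
    by (intro sum.cong refl) (simp add: col)
  also have "\<dots> = coeff q n * cofactor S n 0" by (subst sum.delta) auto
  also have "cofactor S n 0 = (-1)^n * det (mat_delete S n 0)" by (simp add: cofactor_def)
  also have "mat_delete S n 0 = sylvester_mat_sub m n p q"
  proof (rule eq_matI)
    fix i j assume "i < dim_row (sylvester_mat_sub m n p q)" "j < dim_col (sylvester_mat_sub m n p q)"
    then have ij: "i < m + n" "j < m + n" by auto
    have "coeff p (m + i - j) = 0" if "i = Suc j"
      using that assms by simp
    with ij show "mat_delete S n 0 $$ (i, j) = sylvester_mat_sub m n p q $$ (i, j)"
      by (subst mat_delete_index[of S "m+n" n 0, symmetric])
        (use S in \<open>auto simp: insert_index_def idx sylvester_mat_sub_index Suc_diff_le le_Suc_eq\<close>)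
  qed (use S in \<open>auto simp: mat_delete_def\<close>)
  finally show ?thesis by (simp add: resultant_sub_def S_def)
qed

lemma poly_eq_sum_lessThan:
  fixes p :: "'a::comm_semiring_1 poly"
  assumes "degree p < N" shows "poly p x = (\<Sum>k<N. coeff p k * x ^ k)"
  unfolding poly_altdef
  by (rule sum.mono_neutral_left) (use assms in \<open>auto simp: coeff_eq_0\<close>)

text \<open>
  The powers of the common root form a vector in the kernel of the Sylvester matrix, because each row holds
  the coefficients of a shift of one of the polynomials.
\<close>
lemma resultant_sub_common_root:
  fixes p q :: "'a::field poly"
  assumes "degree p \<le> m" "degree q \<le> n" "m + n > 0" "poly p x = 0" "poly q x = 0"
  shows "resultant_sub m n p q = 0"
proof -
  define S where "S = sylvester_mat_sub m n p q"
  have S: "S \<in> carrier_mat (m + n) (m + n)" by (simp add: S_def sylvester_mat_sub_carrier)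
  define v where "v = vec (m + n) (\<lambda>j. x ^ (m + n - Suc j))"
  have row_eq: "(\<Sum>j<m+n. coeff r (m + n - Suc j) * x ^ (m + n - Suc j)) = poly r x" if "degree r < m + n" for r
    using poly_eq_sum_lessThan[OF that, of x]
    by (simp add: sum.nat_diff_reindex[where g = "\<lambda>k. coeff r k * x ^ k"])
  have "S *\<^sub>v v = 0\<^sub>v (m + n)"
  proof (rule eq_vecI)
    fix i assume "i < dim_vec (0\<^sub>v (m + n) :: 'a vec)"
    then have i: "i < m + n" by simp
    \<comment> \<open>row \<open>i\<close> of the Sylvester matrix holds the coefficients of \<open>r\<close>, the highest first\<close>
    define r where "r = (if i < n then monom 1 (n - Suc i) * p else monom 1 (m + n - Suc i) * q)"
    have "degree r < m + n"
    proof (cases "i < n")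
      case True
      have "degree (monom 1 (n - Suc i) * p) \<le> n - Suc i + degree p"
        by (metis degree_mult_le degree_monom_eq one_neq_zero)
      then show ?thesis using True assms by (simp add: r_def)
    next
      case False
      have "degree (monom 1 (m + n - Suc i) * q) \<le> m + n - Suc i + degree q"
        by (metis degree_mult_le degree_monom_eq one_neq_zero)
      then show ?thesis using False assms i by (simp add: r_def)
    qed
    have entry: "S $$ (i, j) = coeff r (m + n - Suc j)" if j: "j < m + n" for j
    proof (cases "i < n")
      case True
      have e: "m + n - Suc j - (n - Suc i) = m + i - j" if "n - Suc i \<le> m + n - Suc j"
        using that True j by arith
      have z: "coeff p (m + i - j) = 0" if "j < i"
        using that assms by (intro coeff_eq_0) arith
      show ?thesis using True i j e z
        by (auto simp: S_def sylvester_mat_sub_index r_def coeff_monom_mult)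
    next
      case False
      have e: "m + n - Suc j - (m + n - Suc i) = i - j" if "m + n - Suc i \<le> m + n - Suc j"
        using that False i j by arith
      have z: "coeff q (i - j) = 0" if "\<not> i - n \<le> j"
        using that assms by (intro coeff_eq_0) arith
      show ?thesis using False i j e z
        by (auto simp: S_def sylvester_mat_sub_index r_def coeff_monom_mult)
    qed
    have "(S *\<^sub>v v) $ i = (\<Sum>j<m+n. S $$ (i,j) * x ^ (m + n - Suc j))"
      using i S by (simp add: scalar_prod_def v_def lessThan_atLeast0)
    also have "\<dots> = (\<Sum>j<m+n. coeff r (m + n - Suc j) * x ^ (m + n - Suc j))"
      by (intro sum.cong refl) (simp add: entry)
    also have "\<dots> = poly r x" by (rule row_eq) fact
    also have "\<dots> = 0" using assms by (simp add: r_def)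
    finally show "(S *\<^sub>v v) $ i = 0\<^sub>v (m + n) $ i" using i by simp
  qed (use S in auto)
  moreover have "v \<noteq> 0\<^sub>v (m + n)"
  proof
    assume "v = 0\<^sub>v (m + n)"
    then have "v $ (m + n - 1) = 0" using assms by simp
    then show False using assms by (simp add: v_def)
  qed
  moreover have "v \<in> carrier_vec (m + n)" by (simp add: v_def)
  ultimately have "det S = 0" using det_0_iff_vec_prod_zero_field[OF S] by blast
  then show ?thesis by (simp add: resultant_sub_def S_def)
qed

lemma size_linear_factors:
  fixes p :: "'a::field poly"
  assumes "p \<noteq> 0" "p = smult (lead_coeff p) (\<Prod>x\<in>#A. [:- x, 1:])"
  shows "size A = degree p"
proof -
  have "degree (\<Prod>x\<in>#B. [:- x, 1:]) = size B \<and> (\<Prod>x\<in>#B. [:- x, 1:]) \<noteq> (0 :: 'a poly)" for B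
    by (induction B) (auto simp: degree_mult_eq simp del: mult_pCons_left)
  then show ?thesis using assms(1) by (subst assms(2)) simp
qed

lemma poly_linear_factors:
  fixes p :: "'a::field poly"
  assumes "p = smult a (\<Prod>x\<in>#A. [:- x, 1:])"
  shows "poly p y = a * (\<Prod>x\<in>#A. y - x)"
proof -
  have "poly (\<Prod>x\<in>#B. [:- x, 1:]) y = (\<Prod>x\<in>#B. y - x)" for B
    by (induction B) (auto simp: algebra_simps)
  then show ?thesis by (subst assms) simp
qed

text \<open>
  Euclidean induction: replacing \<open>q\<close> by its remainder modulo \<open>p\<close> changes neither its values at the roots of \<open>p\<close> nor, up to
  a power of the leading coefficient of \<open>p\<close>, the resultant. If \<open>p\<close> has the larger degree, both sides are
  rewritten as a double product over pairs of roots, which is symmetric up to the sign of the swap.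
\<close>
lemma resultant_eq_prod_roots:
  fixes p q :: "'a::alg_closed_field poly"
  assumes "p \<noteq> 0" "q \<noteq> 0" "p = smult (lead_coeff p) (\<Prod>x\<in>#A. [:- x, 1:])"
  shows "resultant p q = lead_coeff p ^ degree q * (\<Prod>x\<in>#A. poly q x)"
  using assms
proof (induction "degree p + degree q" arbitrary: p q A rule: less_induct)
  case less
  have sgn1: "(- 1 :: 'a) ^ (degree p * degree q) * (- 1) ^ (degree q * degree p) = 1" for p q :: "'a poly"
    by (simp add: mult.commute[of "degree q"] flip: power_mult_distrib)
  \<comment> \<open>the Euclidean step, for the polynomial of larger degree in second position\<close>
  have main: "resultant p q = lead_coeff p ^ degree q * (\<Prod>x\<in>#A. poly q x)"
    if le: "degree p \<le> degree q" "degree p + degree q \<le> N"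
      and IH: "\<And>(p :: 'a poly) q A. degree p + degree q < N \<Longrightarrow> p \<noteq> 0 \<Longrightarrow> q \<noteq> 0 \<Longrightarrow>
        p = smult (lead_coeff p) (\<Prod>x\<in>#A. [:- x, 1:]) \<Longrightarrow>
        resultant p q = lead_coeff p ^ degree q * (\<Prod>x\<in>#A. poly q x)"
      and p: "p \<noteq> 0" "q \<noteq> 0" "p = smult (lead_coeff p) (\<Prod>x\<in>#A. [:- x, 1:])"
    for p q :: "'a poly" and A N
  proof (cases "degree p = 0")
    case True
    then obtain a where a: "p = [:a:]" by (rule degree_eq_zeroE)
    have "A = {#}" using size_linear_factors[OF p(1,3)] True by simp
    then show ?thesis by (simp add: a)
  next
    case False
    define h where "h = q mod p"
    have qh: "q + (- (q div p)) * p = h" by (simp add: h_def minus_div_mult_eq_mod algebra_simps)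
    have root: "poly p x = 0" if "x \<in># A" for x
      using poly_linear_factors[OF p(3), of x] that by (auto simp: prod_mset_zero_iff)
    have eval: "poly q x = poly h x" if "x \<in># A" for x
      using root[OF that] arg_cong[OF qh, of "\<lambda>r. poly r x"] by simp
    have A: "size A = degree p" by (rule size_linear_factors) (use p in auto)
    show ?thesis
    proof (cases "h = 0")
      case True
      obtain x where x: "x \<in># A" using A False by (metis multiset_nonemptyE size_empty)
      have "resultant_sub (degree p) (degree q) p q = 0"
        by (rule resultant_sub_common_root[of _ _ _ _ x]) (use x root eval[OF x] True False in auto)
      moreover have "(\<Prod>x\<in>#A. poly q x) = 0" using x eval[OF x] True by (force simp: prod_mset_zero_iff)
      ultimately show ?thesis by (simp add: resultant_sub)
    next
      case h0: False
      have dh: "degree h < degree p" using h0 False degree_mod_less[OF p(1), of q] by (auto simp: h_def)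
      \<comment> \<open>the fundamental step of subresultant theory; a constant remainder is a separate case of it\<close>
      have step: "resultant q p = (- 1) ^ (degree q * degree p) * lead_coeff p ^ (degree q - degree h) * resultant p h"
      proof (cases "degree h = 0")
        case True
        then obtain c where c: "h = [:c:]" by (rule degree_eq_zeroE)
        have "subresultant (degree h) q p = smult ((- 1) ^ ((degree q - degree h) * (degree p - degree h)) *
            lead_coeff p ^ (degree q - degree h) * lead_coeff h ^ (degree p - degree h - 1)) h"
          by (rule BT_lemma_1_13[OF qh le(1)]) (use dh h0 in auto)
        then have "resultant q p = (- 1) ^ (degree q * degree p) * lead_coeff p ^ degree q * (c ^ (degree p - 1) * c)"
          by (simp add: True subresultant_resultant c)
        also have "c ^ (degree p - 1) * c = c ^ degree p" using False by (metis One_nat_def Suc_pred neq0_conv power_Suc2)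
        finally show ?thesis by (simp add: c)
      next
        case dh0: False
        have "subresultant 0 q p = smult ((- 1) ^ ((degree q - 0) * (degree p - 0)) *
            lead_coeff p ^ (degree q - degree h)) (subresultant 0 p h)"
          by (rule BT_lemma_1_12[OF qh le(1)]) (use dh dh0 in auto)
        then show ?thesis by (simp add: subresultant_resultant)
      qed
      have "resultant p q = ((- 1) ^ (degree p * degree q) * (- 1) ^ (degree q * degree p)) *
          lead_coeff p ^ (degree q - degree h) * resultant p h"
        unfolding resultant_swap[of p q] step by (simp only: mult.assoc)
      then have "resultant p q = lead_coeff p ^ (degree q - degree h) * resultant p h"
        by (simp only: sgn1 mult_1)
      also have "resultant p h = lead_coeff p ^ degree h * (\<Prod>x\<in>#A. poly h x)"
        by (rule IH) (use p h0 dh le in auto)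
      also have "(\<Prod>x\<in>#A. poly h x) = (\<Prod>x\<in>#A. poly q x)"
        using eval by (intro arg_cong[of _ _ prod_mset] image_mset_cong) simp
      also have "lead_coeff p ^ (degree q - degree h) * (lead_coeff p ^ degree h * (\<Prod>x\<in>#A. poly q x))
          = lead_coeff p ^ degree q * (\<Prod>x\<in>#A. poly q x)"
        using dh le by (simp flip: power_add mult.assoc)
      finally show ?thesis .
    qed
  qed
  show ?case
  proof (cases "degree p \<le> degree q")
    case True
    then show ?thesis using main[OF True order_refl less(1), of A] less by simp
  next
    case False
    obtain B where B: "q = smult (lead_coeff q) (\<Prod>x\<in>#B. [:- x, 1:])" "size B = degree q"
      using alg_closed_imp_factorization[OF less(3)] by auto
    have "resultant q p = lead_coeff q ^ degree p * (\<Prod>y\<in>#B. poly p y)"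
      using main[of q p "degree p + degree q" B] less(1,2,3) False B(1) by (simp only: add.commute nat_le_linear order_refl le_refl) (metis nat_le_linear)
    also have "(\<Prod>y\<in>#B. poly p y) = (\<Prod>y\<in>#B. lead_coeff p * (\<Prod>x\<in>#A. y - x))"
      by (simp add: poly_linear_factors[OF less(4)])
    also have "\<dots> = lead_coeff p ^ degree q * (\<Prod>y\<in>#B. \<Prod>x\<in>#A. y - x)"
      by (simp add: prod_mset.distrib B(2))
    also have "(\<Prod>y\<in>#B. \<Prod>x\<in>#A. y - x) = (\<Prod>x\<in>#A. \<Prod>y\<in>#B. y - x)"
      by (rule prod_mset.swap)
    also have "\<dots> = (\<Prod>x\<in>#A. (-1) ^ degree q * (\<Prod>y\<in>#B. x - y))"
    proof -
      have "(\<Prod>y\<in>#B. y - x) = (-1) ^ size B * (\<Prod>y\<in>#B. x - y)" for x :: 'a and B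
        by (induction B) (auto simp: algebra_simps)
      then show ?thesis by (simp add: B(2))
    qed
    also have "\<dots> = (-1) ^ (degree q * degree p) * (\<Prod>x\<in>#A. \<Prod>y\<in>#B. x - y)"
      using size_linear_factors[OF less(2,4)] by (simp add: prod_mset.distrib power_mult)
    finally have 1: "resultant q p = lead_coeff q ^ degree p * (lead_coeff p ^ degree q *
      ((-1) ^ (degree q * degree p) * (\<Prod>x\<in>#A. \<Prod>y\<in>#B. x - y)))" .
    have *: "(\<Prod>x\<in>#A. poly q x) = lead_coeff q ^ degree p * (\<Prod>x\<in>#A. \<Prod>y\<in>#B. x - y)"
      using size_linear_factors[OF less(2,4)] by (simp add: poly_linear_factors[OF B(1)] prod_mset.distrib)
    have "resultant p q = ((- 1) ^ (degree p * degree q) * (- 1) ^ (degree q * degree p)) *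
        (lead_coeff p ^ degree q * (lead_coeff q ^ degree p * (\<Prod>x\<in>#A. \<Prod>y\<in>#B. x - y)))"
      unfolding resultant_swap[of p q] 1 by (simp only: mult_ac)
    then show ?thesis using * by (simp only: sgn1 mult_1)
  qed
qed

lemma resultant_sub_eq_prod_roots:
  fixes p q :: "'a::alg_closed_field poly"
  assumes p: "p \<noteq> 0" "p = smult (lead_coeff p) (\<Prod>x\<in>#A. [:- x, 1:])" and q: "degree q \<le> n"
  shows "resultant_sub (degree p) n p q = lead_coeff p ^ n * (\<Prod>x\<in>#A. poly q x)"
  using q
proof (induction n rule: dec_induct)
  case base
  show ?case
  proof (cases "q = 0")
    case True
    have "size A = degree p" by (rule size_linear_factors) (use p in auto)
    moreover have "resultant p 0 = 0 ^ degree p" by (metis resultant_const(2) pCons_0_0)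
    ultimately show ?thesis using True by (simp add: resultant_sub)
  next
    case False
    then show ?thesis using resultant_eq_prod_roots[OF p(1) False p(2)] by (simp add: resultant_sub)
  qed
next
  case (step n)
  have "coeff q (Suc n) = 0" using step by (intro coeff_eq_0) auto
  from resultant_sub_drop_right[OF this, of "degree p" p] step show ?case by simp
qed

text \<open>If both formal leading coefficients vanish, the common root is the point at infinity of the projective line.\<close>
lemma resultant_sub_eq_0_iff:
  fixes p q :: "'a::alg_closed_field poly"
  assumes "degree p \<le> m" "degree q \<le> n" "m + n > 0"
  shows "resultant_sub m n p q = 0 \<longleftrightarrow> (coeff p m = 0 \<and> coeff q n = 0) \<or> (\<exists>x. poly p x = 0 \<and> poly q x = 0)"
proof
  assume "(coeff p m = 0 \<and> coeff q n = 0) \<or> (\<exists>x. poly p x = 0 \<and> poly q x = 0)"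
  then show "resultant_sub m n p q = 0"
  proof
    assume *: "coeff p m = 0 \<and> coeff q n = 0"
    show ?thesis
    proof (cases n)
      case (Suc n')
      then show ?thesis using * resultant_sub_drop_right[of q n' m p] by simp
    next
      case 0
      then obtain m' where "m = Suc m'" using assms by (cases m) auto
      then show ?thesis using * 0 resultant_sub_drop_left[of p m' n q] by simp
    qed
  qed (use resultant_sub_common_root[OF assms] in blast)
next
  assume 0: "resultant_sub m n p q = 0"
  have main: "\<exists>x. poly p x = 0 \<and> poly q x = 0" if *: "resultant_sub (degree p) n p q = 0" "p \<noteq> 0"
  proof -
    obtain A where A: "p = smult (lead_coeff p) (\<Prod>x\<in>#A. [:- x, 1:])"
      using alg_closed_imp_factorization[OF *(2)] by auto
    have "(\<Prod>x\<in>#A. poly q x) = 0"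
      using * resultant_sub_eq_prod_roots[OF *(2) A assms(2)] by simp
    then obtain x where x: "x \<in># A" "poly q x = 0" by (auto simp: prod_mset_zero_iff)
    then have "poly p x = 0" using poly_linear_factors[OF A, of x] by (auto simp: prod_mset_zero_iff)
    with x show ?thesis by blast
  qed
  show "(coeff p m = 0 \<and> coeff q n = 0) \<or> (\<exists>x. poly p x = 0 \<and> poly q x = 0)"
  proof (cases "coeff p m = 0 \<and> coeff q n = 0")
    case False
    consider "coeff p m \<noteq> 0" | "coeff p m = 0" "coeff q n \<noteq> 0" using False by blast
    then show ?thesis
    proof cases
      case 1
      then have "degree p = m" "p \<noteq> 0" using assms le_degree[OF 1] by auto
      with main 0 show ?thesis by auto
    next
      case 2
      have dq: "degree q = n" "q \<noteq> 0" using assms 2 le_degree[OF 2(2)] by auto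
      \<comment> \<open>lowering the formal degree of \<open>p\<close> only costs powers of the nonzero \<open>coeff q n\<close>\<close>
      have "resultant_sub k n p q = 0 \<Longrightarrow> resultant_sub (degree p) n p q = 0" if "degree p \<le> k" for k
        using that
      proof (induction k rule: dec_induct)
        case (step k)
        have "coeff p (Suc k) = 0" using step by (intro coeff_eq_0) auto
        then have "(-1) ^ n * coeff q n * resultant_sub k n p q = 0"
          using resultant_sub_drop_left[of p k n q] step(4) by simp
        then show ?case using step 2 by simp
      qed
      then have r0: "resultant_sub (degree p) n p q = 0" using 0 assms by blast
      show ?thesis
      proof (cases "p = 0")
        case True
        have "n > 0"
        proof (rule ccontr)
          assume "\<not> n > 0"
          then have "resultant p q = 1" using dq True
            by (metis gr_zeroI degree_eq_zeroE power_0 resultant_const(2) degree_0)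
          then show False using r0 dq by (simp add: resultant_sub)
        qed
        then obtain x where "poly q x = 0" using alg_closed_imp_poly_has_root[of q] dq by auto
        then show ?thesis using True by auto
      qed (use main r0 in blast)
    qed
  qed blast
qed

section \<open>The discriminant of a binary sextic form\<close>

text \<open>
  If \<open>F(x, z)\<close> is the sextic form with \<open>F(x, 1) = f\<close>, then \<open>f'\<close> and \<open>6 f - x f'\<close> are the
  dehomogenised partial derivatives of \<open>F\<close>. Their resultant is the discriminant up to a constant; unlike the
  definition with a division by the leading coefficient it is visibly compatible with ring homomorphisms, also with
  those that kill the leading coefficient.
\<close>
definition disc6 :: "'a::idom poly \<Rightarrow> 'a" where
  "disc6 f = resultant_sub 5 5 (pderiv f) (smult 6 f - pCons 0 (pderiv f))"

lemma coeff_polar: "coeff (smult 6 f - pCons 0 (pderiv f)) n = (6 - of_nat n) * coeff (f :: 'a::idom poly) n"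
  by (cases n) (auto simp: coeff_pderiv algebra_simps)

lemma degree_polar: "degree f \<le> 6 \<Longrightarrow> degree (smult 6 f - pCons 0 (pderiv (f :: 'a::idom poly))) \<le> 5"
proof (rule degree_le, intro allI impI)
  fix i :: nat assume "degree f \<le> 6" "5 < i"
  then show "coeff (smult 6 f - pCons 0 (pderiv f)) i = 0"
    unfolding coeff_polar by (cases "i = 6") (auto simp: coeff_eq_0)
qed

lemma degree_pderiv_le6: "degree f \<le> 6 \<Longrightarrow> degree (pderiv (f :: 'a::idom poly)) \<le> 5"
proof (rule degree_le, intro allI impI)
  fix i :: nat assume "degree f \<le> 6" "5 < i"
  then show "coeff (pderiv f) i = 0" by (simp add: coeff_pderiv coeff_eq_0)
qed

lemma map_poly_pderiv_hom:
  fixes h :: "'a::idom \<Rightarrow> 'b::idom"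
  assumes "comm_ring_hom h" shows "map_poly h (pderiv f) = pderiv (map_poly h f)"
proof -
  interpret h: comm_ring_hom h by fact
  show ?thesis by (rule poly_eqI) (simp add: coeff_pderiv hom_distribs)
qed

lemma disc6_hom:
  assumes "comm_ring_hom h" shows "disc6 (map_poly h f) = h (disc6 f)"
proof -
  interpret h: comm_ring_hom h by fact
  interpret m: map_poly_comm_ring_hom h ..
  have "map_poly h (smult 6 f - pCons 0 (pderiv f)) = smult 6 (map_poly h f) - pCons 0 (pderiv (map_poly h f))"
    by (rule poly_eqI) (simp only: h.coeff_map_poly_hom coeff_polar h.hom_mult h.hom_minus h.hom_of_nat h.hom_numeral)
  then show ?thesis
    unfolding disc6_def by (simp add: map_poly_pderiv_hom[OF assms] flip: resultant_sub_hom[OF assms])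
qed

text \<open>
  Euler's relation makes the common zeros of the partial derivatives the multiple roots of the form; vanishing of
  the two top coefficients is a multiple root at infinity.
\<close>
lemma disc6_eq_0_iff:
  fixes f :: "'a::alg_closed_field poly"
  assumes "(6 :: 'a) \<noteq> 0" "degree f \<le> 6"
  shows "disc6 f = 0 \<longleftrightarrow> (coeff f 6 = 0 \<and> coeff f 5 = 0) \<or> (\<exists>x. poly f x = 0 \<and> poly (pderiv f) x = 0)"
proof -
  have "disc6 f = 0 \<longleftrightarrow> (coeff (pderiv f) 5 = 0 \<and> coeff (smult 6 f - pCons 0 (pderiv f)) 5 = 0) \<or>
      (\<exists>x. poly (pderiv f) x = 0 \<and> poly (smult 6 f - pCons 0 (pderiv f)) x = 0)"
    unfolding disc6_def
    by (rule resultant_sub_eq_0_iff) (use degree_polar[OF assms(2)] degree_pderiv_le6[OF assms(2)] in auto)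
  also have "coeff (pderiv f) 5 = 0 \<longleftrightarrow> coeff f 6 = 0" using assms by (simp add: coeff_pderiv)
  also have "coeff (smult 6 f - pCons 0 (pderiv f)) 5 = 0 \<longleftrightarrow> coeff f 5 = 0" by (subst coeff_polar) simp
  also have "(\<exists>x. poly (pderiv f) x = 0 \<and> poly (smult 6 f - pCons 0 (pderiv f)) x = 0) \<longleftrightarrow>
      (\<exists>x. poly f x = 0 \<and> poly (pderiv f) x = 0)" using assms by auto
  finally show ?thesis .
qed

lemma disc6_double_root:
  fixes f :: "'a::field poly"
  assumes "degree f \<le> 6" "poly f x = 0" "poly (pderiv f) x = 0"
  shows "disc6 f = 0"
  unfolding disc6_def
  by (rule resultant_sub_common_root[of _ _ _ _ x])
    (use assms degree_polar[OF assms(1)] degree_pderiv_le6[OF assms(1)] in auto)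

lemma disc6_double_root_idom:
  fixes f :: "'r::idom poly"
  assumes "degree f \<le> 6" "poly f x = 0" "poly (pderiv f) x = 0"
  shows "disc6 f = 0"
proof -
  interpret e: comm_ring_hom "to_closed :: 'r \<Rightarrow> _" by (rule comm_ring_hom_to_closed)
  have "disc6 (map_poly to_closed f) = 0"
    by (rule disc6_double_root[of _ "to_closed x"])
      (use assms in \<open>simp_all add: e.poly_map_poly flip: map_poly_pderiv_hom[OF comm_ring_hom_to_closed]\<close>)
  then show ?thesis by (simp add: disc6_hom[OF comm_ring_hom_to_closed] to_closed_0_iff)
qed

lemma degree_pderiv6:
  fixes f :: "'a::idom poly"
  assumes "(6 :: 'a) \<noteq> 0" "degree f = 6" shows "degree (pderiv f) = 5" "coeff (pderiv f) 5 = 6 * coeff f 6"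
proof -
  show 1: "coeff (pderiv f) 5 = 6 * coeff f 6" by (simp add: coeff_pderiv)
  have "coeff f 6 \<noteq> 0" using assms by (metis leading_coeff_0_iff degree_0 zero_neq_numeral)
  then have "coeff (pderiv f) 5 \<noteq> 0" using assms 1 by simp
  then show "degree (pderiv f) = 5" using degree_pderiv_le6[of f] assms le_degree[of "pderiv f" 5] by simp
qed

lemma prod_mset_smult_const: "(\<Prod>x\<in>#A. c * g x) = c ^ size A * (\<Prod>x\<in>#A. g x :: 'a::comm_monoid_mult)"
  by (induction A) (auto simp: mult_ac)

text \<open>
  At a root of \<open>f'\<close> the polar \<open>6 f - x f'\<close> takes the value \<open>6 f\<close>, so the two products over the
  roots of \<open>f'\<close> agree up to powers of 6 and of the leading coefficient.
\<close>
lemma resultant_pderiv_eq_disc6: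
  fixes f :: "'a::alg_closed_field poly"
  assumes 6: "(6 :: 'a) \<noteq> 0" and f: "degree f = 6"
  shows "1296 * resultant_sub 6 5 f (pderiv f) = coeff f 6 * disc6 f"
proof -
  define g where "g = pderiv f"
  note dg = degree_pderiv6[OF assms, folded g_def]
  have g0: "g \<noteq> 0" using dg by auto
  obtain S where S: "g = smult (lead_coeff g) (\<Prod>x\<in>#S. [:- x, 1:])" "size S = degree g"
    using alg_closed_imp_factorization[OF g0] by auto
  have "resultant_sub 6 5 f g = resultant f g" by (simp add: resultant_sub f dg)
  also have "\<dots> = resultant g f" by (subst resultant_swap) (simp add: f dg)
  also have "\<dots> = (6 * coeff f 6) ^ 6 * (\<Prod>x\<in>#S. poly f x)"
    using resultant_sub_eq_prod_roots[OF g0 S(1), of f 6] f dg by (simp add: resultant_sub)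
  finally have 1: "resultant_sub 6 5 f g = (6 * coeff f 6) ^ 6 * (\<Prod>x\<in>#S. poly f x)" .
  have "disc6 f = (6 * coeff f 6) ^ 5 * (\<Prod>x\<in>#S. poly (smult 6 f - pCons 0 g) x)"
    using resultant_sub_eq_prod_roots[OF g0 S(1) degree_polar[of f, folded g_def]] f dg by (simp add: disc6_def g_def)
  also have "(\<Prod>x\<in>#S. poly (smult 6 f - pCons 0 g) x) = (\<Prod>x\<in>#S. 6 * poly f x)"
  proof (intro arg_cong[of _ _ prod_mset] image_mset_cong)
    fix x assume "x \<in># S"
    then have "poly g x = 0" using poly_linear_factors[OF S(1), of x] by (auto simp: prod_mset_zero_iff)
    then show "poly (smult 6 f - pCons 0 g) x = 6 * poly f x" by simp
  qed
  also have "\<dots> = 6 ^ 5 * (\<Prod>x\<in>#S. poly f x)" by (simp add: prod_mset_smult_const S(2) dg)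
  finally show ?thesis unfolding 1[unfolded g_def] by (simp add: power_mult_distrib power_def algebra_simps numeral_eq_Suc)
qed

lemma resultant_pderiv_eq_disc6_idom:
  fixes f :: "'r::idom poly"
  assumes "(6 :: 'r) \<noteq> 0" "degree f = 6"
  shows "1296 * resultant_sub 6 5 f (pderiv f) = coeff f 6 * disc6 f"
proof -
  interpret e: comm_ring_hom "to_closed :: 'r \<Rightarrow> _" by (rule comm_ring_hom_to_closed)
  have 6: "(6 :: 'r fract alg_closure) \<noteq> 0" using assms(1) to_closed_0_iff[of "6::'r"] by simp
  have "to_closed (1296 * resultant_sub 6 5 f (pderiv f)) = to_closed (coeff f 6 * disc6 f)"
    using resultant_pderiv_eq_disc6[OF 6, of "map_poly to_closed f"] assms(2)
    by (simp add: e.hom_mult disc6_hom[OF comm_ring_hom_to_closed] resultant_sub_hom[OF comm_ring_hom_to_closed]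
        flip: map_poly_pderiv_hom[OF comm_ring_hom_to_closed])
  then show ?thesis by simp
qed

lemma disc6_smult: "disc6 (smult c f) = c ^ 10 * disc6 f"
proof -
  have "sylvester_mat_sub 5 5 (smult c p) (smult c q) = c \<cdot>\<^sub>m sylvester_mat_sub 5 5 p q" for p q :: "'a poly"
    by (rule eq_matI) (auto simp: sylvester_mat_sub_index)
  moreover have "smult 6 (smult c f) - pCons 0 (pderiv (smult c f)) = smult c (smult 6 f - pCons 0 (pderiv f))"
    by (simp add: pderiv_smult smult_diff_right mult.commute)
  ultimately show ?thesis unfolding disc6_def resultant_sub_def by (simp add: pderiv_smult det_smult)
qed

text \<open>The roots are moved by the inverse affine map; compare the two sides of the product formula for \<open>Res(f, f')\<close>.\<close>
lemma disc6_affine: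
  fixes f :: "'a::alg_closed_field poly"
  assumes 6: "(6 :: 'a) \<noteq> 0" and f: "degree f = 6" and a: "a \<noteq> 0"
  shows "disc6 (f \<circ>\<^sub>p [:b, a:]) = a ^ 30 * disc6 f"
proof -
  have f0: "f \<noteq> 0" using f by auto
  obtain A where A: "f = smult (lead_coeff f) (\<Prod>x\<in>#A. [:- x, 1:])" "size A = degree f"
    using alg_closed_imp_factorization[OF f0] by auto
  define g where "g = f \<circ>\<^sub>p [:b, a:]"
  define B where "B = image_mset (\<lambda>x. (x - b) / a) A"
  have "(\<Prod>x\<in>#A. [:- x, 1:]) \<circ>\<^sub>p [:b, a:] = smult (a ^ size A) (\<Prod>x\<in>#image_mset (\<lambda>x. (x - b) / a) A. [:- x, 1:])" for A
  proof (induction A)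
    case (add x A)
    have "[:- x, 1:] \<circ>\<^sub>p [:b, a:] = smult a [:- ((x - b) / a), 1:]" using a by (simp add: pcompose_pCons)
    then show ?case
      by (simp only: image_mset_add_mset prod_mset.add_mset pcompose_mult add.IH size_add_mset power_Suc
          mult_smult_left mult_smult_right smult_smult mult.commute[of a])
  qed simp
  then have g1: "g = smult (lead_coeff f * a ^ 6) (\<Prod>x\<in>#B. [:- x, 1:])"
    unfolding g_def B_def by (subst A(1)) (simp add: pcompose_smult A(2) f)
  have dg: "degree g = 6" using a by (simp add: g_def f degree_pcompose)
  have g0: "g \<noteq> 0" using dg by auto
  have lg: "lead_coeff g = lead_coeff f * a ^ 6"
    using lead_coeff_comp[of "[:b, a:]" f] a f by (simp add: g_def)
  have g2: "g = smult (lead_coeff g) (\<Prod>x\<in>#B. [:- x, 1:])" unfolding lg by (rule g1)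
  have pg: "pderiv g = smult a (pderiv f \<circ>\<^sub>p [:b, a:])"
    by (simp add: g_def pderiv_pcompose pderiv_pCons)
  have "resultant_sub 6 5 g (pderiv g) = lead_coeff g ^ 5 * (\<Prod>x\<in>#B. poly (pderiv g) x)"
    using resultant_sub_eq_prod_roots[OF g0 g2, of "pderiv g" 5] degree_pderiv_le6[of g] dg by simp
  also have "(\<Prod>x\<in>#B. poly (pderiv g) x) = (\<Prod>x\<in>#A. a * poly (pderiv f) x)"
    using a by (simp add: B_def pg poly_pcompose image_mset.compositionality o_def)
  also have "\<dots> = a ^ 6 * (\<Prod>x\<in>#A. poly (pderiv f) x)"
    by (simp add: prod_mset_smult_const A(2) f)
  also have "lead_coeff g ^ 5 * (a ^ 6 * (\<Prod>x\<in>#A. poly (pderiv f) x)) = a ^ 36 * resultant_sub 6 5 f (pderiv f)"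
    using resultant_sub_eq_prod_roots[OF f0 A(1), of "pderiv f" 5] degree_pderiv_le6[of f] f 
    by (simp add: lg power_mult_distrib flip: power_mult)
  finally have R: "resultant_sub 6 5 g (pderiv g) = a ^ 36 * resultant_sub 6 5 f (pderiv f)" .
  have cg: "coeff g 6 = coeff f 6 * a ^ 6" using lg f dg by simp
  \<comment> \<open>the surplus \<open>a ^ 6\<close> belongs to the leading coefficient of \<open>g\<close>\<close>
  have a36: "a ^ 36 = a ^ 6 * a ^ 30" by (simp flip: power_add)
  have "coeff g 6 * disc6 g = a ^ 36 * (1296 * resultant_sub 6 5 f (pderiv f))"
    unfolding resultant_pderiv_eq_disc6[OF 6 dg, symmetric] R by (rule mult.left_commute)
  then have eq: "(coeff f 6 * a ^ 6) * disc6 g = (coeff f 6 * a ^ 6) * (a ^ 30 * disc6 f)"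
    unfolding resultant_pderiv_eq_disc6[OF 6 f] cg a36 by (simp only: mult_ac)
  have "coeff f 6 \<noteq> 0" using f0 f leading_coeff_0_iff[of f] by simp
  then have "coeff f 6 * a ^ 6 \<noteq> 0" using a by simp
  from iffD1[OF mult_left_cancel[OF this] eq] show ?thesis by (simp add: g_def)
qed

lemma disc6_affine_idom:
  fixes f :: "'r::idom poly"
  assumes "(6 :: 'r) \<noteq> 0" "degree f = 6" "a \<noteq> 0"
  shows "disc6 (f \<circ>\<^sub>p [:b, a:]) = a ^ 30 * disc6 f"
proof -
  interpret e: comm_ring_hom "to_closed :: 'r \<Rightarrow> _" by (rule comm_ring_hom_to_closed)
  have 6: "(6 :: 'r fract alg_closure) \<noteq> 0" using assms(1) to_closed_0_iff[of "6::'r"] by simp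
  have "to_closed (disc6 (f \<circ>\<^sub>p [:b, a:])) = disc6 (map_poly to_closed f \<circ>\<^sub>p [:to_closed b, to_closed a:])"
    by (simp add: e.map_poly_pcompose e.map_poly_pCons_hom flip: disc6_hom[OF comm_ring_hom_to_closed])
  also have "\<dots> = to_closed (a ^ 30 * disc6 f)"
    using disc6_affine[OF 6, of "map_poly to_closed f" "to_closed a" "to_closed b"] assms(2,3)
    by (simp add: to_closed_0_iff disc6_hom[OF comm_ring_hom_to_closed] e.hom_mult e.hom_power)
  finally show ?thesis by simp
qed

text \<open>
  If multiplying the rows by a total factor \<open>t\<close> makes the columns divisible by a total factor \<open>t^3\<close>, then \<open>t^2\<close>
  divides the determinant.
\<close>
lemma disc6_scaling_dvd:
  fixes f :: "'a::idom poly"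
  assumes t: "t \<noteq> 0"
    and M: "M = sylvester_mat_sub 5 5 (pderiv f) (smult 6 f - pCons 0 (pderiv f))"
    and dvd: "\<And>i j. i < 10 \<Longrightarrow> j < 10 \<Longrightarrow> c j dvd r i * M $$ (i, j)"
    and c: "(\<Prod>j<10. c j) = t ^ 3" and r: "(\<Prod>i<10. r i) = t"
  shows "t\<^sup>2 dvd disc6 f"
proof -
  define N where "N i j = (SOME n. r i * M $$ (i, j) = c j * n)" for i j
  have N: "r i * M $$ (i,j) = c j * N i j" if "i < 10" "j < 10" for i j
    unfolding N_def using dvd[OF that] by (intro someI_ex[of "\<lambda>n. r i * M $$ (i, j) = c j * n"]) (auto simp: dvd_def)
  have "M \<in> carrier_mat 10 10" using sylvester_mat_sub_carrier[of 5 5] by (simp add: M)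
  from det_scaling[OF this N] have "t * disc6 f = t * (t\<^sup>2 * det (mat 10 10 (\<lambda>(i, j). N i j)))"
    by (simp add: c r disc6_def resultant_sub_def M power2_eq_square power3_eq_cube mult_ac)
  with t show ?thesis by simp
qed

text \<open>
  A double root at 0 to first order in \<open>t\<close>: the discriminant vanishes to second order when the constant
  coefficient vanishes to second and the linear one to first order.
\<close>
lemma disc6_low_coeffs_dvd:
  fixes f :: "'a::idom poly"
  assumes t: "t \<noteq> 0" and f: "t\<^sup>2 dvd coeff f 0" "t dvd coeff f 1"
  shows "t\<^sup>2 dvd disc6 f"
proof -
  define M where "M = sylvester_mat_sub 5 5 (pderiv f) (smult 6 f - pCons 0 (pderiv f))"
  \<comment> \<open>after row 4 is multiplied by \<open>t\<close>, the last column is divisible by \<open>t\<^sup>2\<close> and the one before by \<open>t\<close>\<close>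
  have cols: "M $$ (i, 9) = (if i = 4 then coeff f 1 else if i = 9 then 6 * coeff f 0 else 0) \<and>
     M $$ (i, 8) = (if i = 3 then coeff f 1 else if i = 4 then 2 * coeff f 2
       else if i = 8 then 6 * coeff f 0 else if i = 9 then 5 * coeff f 1 else 0)" if "i < 10" for i
  proof -
    have "i = 0 \<or> i = 1 \<or> i = 2 \<or> i = 3 \<or> i = 4 \<or> i = 5 \<or> i = 6 \<or> i = 7 \<or> i = 8 \<or> i = 9"
      using that by arith
    then show ?thesis unfolding M_def
      by (elim disjE; simp add: sylvester_mat_sub_index coeff_polar coeff_pderiv numeral_2_eq_2 del: coeff_diff coeff_smult)
  qed
  obtain a b where ab: "coeff f 0 = t\<^sup>2 * a" "coeff f 1 = t * b" using f by (auto simp: dvd_def)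
  show ?thesis
  proof (rule disc6_scaling_dvd[OF t M_def, where r = "\<lambda>i. if i = 4 then t else 1"
        and c = "\<lambda>j. if j = 9 then t\<^sup>2 else if j = 8 then t else 1"])
    fix i j :: nat assume ij: "i < 10" "j < 10"
    consider "j = 9" | "j = 8" | "j \<noteq> 9" "j \<noteq> 8" by blast
    then show "(if j = 9 then t\<^sup>2 else if j = 8 then t else 1) dvd (if i = 4 then t else 1) * M $$ (i, j)"
      by cases (use cols[OF ij(1)] in \<open>simp_all add: ab ab[unfolded One_nat_def] power2_eq_square dvd_mult\<close>)
  qed (simp_all add: lessThan_nat_numeral power2_eq_square power3_eq_cube mult.assoc)
qed

text \<open>The mirror image of the previous lemma, for a double root at infinity.\<close>
lemma disc6_high_coeffs_dvd:
  fixes f :: "'a::idom poly"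
  assumes t: "t \<noteq> 0" and f: "t\<^sup>2 dvd coeff f 6" "t dvd coeff f 5"
  shows "t\<^sup>2 dvd disc6 f"
proof -
  define M where "M = sylvester_mat_sub 5 5 (pderiv f) (smult 6 f - pCons 0 (pderiv f))"
  \<comment> \<open>after row 5 is multiplied by \<open>t\<close>, the first column is divisible by \<open>t\<^sup>2\<close> and the second by \<open>t\<close>\<close>
  have cols: "M $$ (i, 0) = (if i = 0 then 6 * coeff f 6 else if i = 5 then coeff f 5 else 0) \<and>
     M $$ (i, 1) = (if i = 0 then 5 * coeff f 5 else if i = 1 then 6 * coeff f 6
       else if i = 5 then 2 * coeff f 4 else if i = 6 then coeff f 5 else 0)" if "i < 10" for i
  proof -
    have "i = 0 \<or> i = 1 \<or> i = 2 \<or> i = 3 \<or> i = 4 \<or> i = 5 \<or> i = 6 \<or> i = 7 \<or> i = 8 \<or> i = 9"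
      using that by arith
    then show ?thesis unfolding M_def
      by (elim disjE; simp add: sylvester_mat_sub_index coeff_polar coeff_pderiv del: coeff_diff coeff_smult)
  qed
  obtain a b where ab: "coeff f 6 = t\<^sup>2 * a" "coeff f 5 = t * b" using f by (auto simp: dvd_def)
  show ?thesis
  proof (rule disc6_scaling_dvd[OF t M_def, where r = "\<lambda>i. if i = 5 then t else 1"
        and c = "\<lambda>j. if j = 0 then t\<^sup>2 else if j = 1 then t else 1"])
    fix i j :: nat assume ij: "i < 10" "j < 10"
    consider "j = 0" | "j = 1" | "j \<noteq> 0" "j \<noteq> 1" by blast
    then show "(if j = 0 then t\<^sup>2 else if j = 1 then t else 1) dvd (if i = 5 then t else 1) * M $$ (i, j)"
      by cases (use cols[OF ij(1)] in \<open>simp_all add: ab ab[unfolded One_nat_def] power2_eq_square dvd_mult\<close>)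
  qed (simp_all add: lessThan_nat_numeral power2_eq_square power3_eq_cube mult.assoc)
qed

text \<open>
  The derivative of \<open>x^6 + b x^3 + d\<close> is \<open>6 x^2 (x^3 + b/2)\<close>, so its roots, and the values of the polar
  \<open>3 b x^3 + 6 d\<close> there, are explicit.
\<close>
lemma disc6_trinomial:
  fixes b d :: "'l::alg_closed_field"
  assumes six: "(6 :: 'l) \<noteq> 0"
  shows "disc6 [:d, 0, 0, b, 0, 0, 1:] = - 944784 * d\<^sup>2 * (b\<^sup>2 - 4 * d) ^ 3"
proof -
  define f where "f = [:d, 0, 0, b, 0, 0, 1:]"
  define r where "r = [:b / 2, 0, 0, 1:]"
  have two: "(2 :: 'l) \<noteq> 0" using six_factors[OF six] by simp
  have pd: "pderiv f = smult 6 ([:- 0, 1:] * ([:- 0, 1:] * r))"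
    using two by (simp add: f_def r_def pderiv_pCons numeral_poly)
  have r0: "r \<noteq> 0" "degree r = 3" "lead_coeff r = 1" by (simp_all add: r_def)
  obtain S where S: "size S = 3" "r = smult (lead_coeff r) (\<Prod>x\<in>#S. [:- x, 1:])"
    using alg_closed_imp_factorization[OF r0(1)] r0 by auto
  have pf: "pderiv f = smult 6 (\<Prod>x\<in>#add_mset 0 (add_mset 0 S). [:- x, 1:])"
    unfolding pd using S(2) r0(3) by (simp del: mult_pCons_left)
  have "degree f = 6" by (simp add: f_def)
  note dp = degree_pderiv6[OF six this]
  have "coeff f 6 = 1" by (simp add: f_def numeral_eq_Suc)
  then have lc: "lead_coeff (pderiv f) = 6" using dp by simp
  have p0: "pderiv f \<noteq> 0" using dp by auto
  define h where "h = [:6 * d, 0, 0, 3 * b:]"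
  define T where "T = add_mset 0 (add_mset 0 S)"
  have polar: "smult 6 f - pCons 0 (pderiv f) = h"
    by (simp add: f_def h_def pderiv_pCons numeral_poly)
  have pf2: "pderiv f = smult (lead_coeff (pderiv f)) (\<Prod>x\<in>#T. [:- x, 1:])"
    unfolding lc T_def by (rule pf)
  have dh: "degree h \<le> 5" by (simp add: h_def)
  have h0: "poly h 0 = 6 * d" by (simp add: h_def)
  \<comment> \<open>the nonzero critical points satisfy \<open>x^3 = - b / 2\<close>\<close>
  have val: "poly h x = - (3 / 2) * (b\<^sup>2 - 4 * d)" if xS: "x \<in># S" for x
  proof -
    have "poly r x = 0" using poly_linear_factors[OF S(2), of x] xS by (auto simp: prod_mset_zero_iff)
    then have x: "x * (x * x) = - b / 2" by (simp add: r_def eq_neg_iff_add_eq_0 add.commute)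
    have "poly h x = 6 * d + 3 * b * (x * (x * x))" by (simp add: h_def algebra_simps)
    then show ?thesis unfolding x using two by (simp add: field_simps power2_eq_square)
  qed
  have "disc6 f = lead_coeff (pderiv f) ^ 5 * (\<Prod>x\<in>#T. poly h x)"
    unfolding disc6_def polar using resultant_sub_eq_prod_roots[OF p0 pf2 dh] dp(1) by (simp only:)
  also have "\<dots> = 6 ^ 5 * (6 * d * (6 * d * (\<Prod>x\<in>#S. poly h x)))"
    unfolding lc T_def by (simp only: image_mset_add_mset prod_mset.add_mset h0)
  also have "(\<Prod>x\<in>#S. poly h x) = (\<Prod>x\<in>#S. - (3 / 2) * (b\<^sup>2 - 4 * d))"
    by (intro arg_cong[of _ _ prod_mset] image_mset_cong val)
  also have "(\<Prod>x\<in>#S. - (3 / 2) * (b\<^sup>2 - 4 * d)) = (- (3 / 2) * (b\<^sup>2 - 4 * d)) ^ 3"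
    by (simp only: image_mset_const_eq prod_mset_replicate_mset S(1))
  also have "\<dots> = - (27 / 8) * (b\<^sup>2 - 4 * d) ^ 3" by (simp only: power_mult_distrib) (simp add: power3_eq_cube)
  finally have e: "disc6 f = 6 ^ 5 * (6 * d * (6 * d * (- (27 / 8) * (b\<^sup>2 - 4 * d) ^ 3)))" .
  have "8 = (2 :: 'l) ^ 3" by simp
  then have "(8 :: 'l) \<noteq> 0" using two by (metis power_eq_0_iff)
  then have n: "(6 :: 'l) ^ 5 * (6 * (6 * (27 / 8))) = 944784" by (simp add: field_simps)
  have "disc6 f = - (6 ^ 5 * (6 * (6 * (27 / 8)))) * d\<^sup>2 * (b\<^sup>2 - 4 * d) ^ 3"
    unfolding e by (simp only: power2_eq_square mult_ac mult_minus_left mult_minus_right)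
  then show ?thesis unfolding n f_def .
qed

lemma disc6_trinomial_idom:
  fixes b d :: "'r::idom"
  assumes six: "(6 :: 'r) \<noteq> 0"
  shows "disc6 [:d, 0, 0, b, 0, 0, 1:] = - 944784 * d\<^sup>2 * (b\<^sup>2 - 4 * d) ^ 3"
proof -
  interpret e: comm_ring_hom "to_closed :: 'r \<Rightarrow> _" by (rule comm_ring_hom_to_closed)
  have 6: "(6 :: 'r fract alg_closure) \<noteq> 0" using six to_closed_0_iff[of "6::'r"] by simp
  have "to_closed (disc6 [:d, 0, 0, b, 0, 0, 1:]) = disc6 [:to_closed d, 0, 0, to_closed b, 0, 0, 1:]"
    unfolding disc6_hom[OF comm_ring_hom_to_closed, symmetric]
    by (simp only: e.map_poly_pCons_hom e.hom_zero e.hom_one map_poly_0)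
  also have "\<dots> = to_closed (- 944784 * d\<^sup>2 * (b\<^sup>2 - 4 * d) ^ 3)"
    unfolding disc6_trinomial[OF 6]
    by (simp only: e.hom_mult e.hom_power e.hom_minus e.hom_uminus e.hom_numeral)
  finally show ?thesis by (simp only: to_closed_eq_iff)
qed

section \<open>The norm sextic\<close>

definition cubic :: "'r::idom \<Rightarrow> 'r \<Rightarrow> 'r poly" where
  "cubic A B = [:B, A, 0, 1:]"

definition odd_part :: "'r::idom \<Rightarrow> 'r \<Rightarrow> 'r poly" where
  "odd_part a1 a4 = [:a4, a1:]"

definition even_part :: "'r::idom \<Rightarrow> 'r \<Rightarrow> 'r \<Rightarrow> 'r \<Rightarrow> 'r \<Rightarrow> 'r \<Rightarrow> 'r poly" where
  "even_part A B a0 a2 a3 a5 = smult a3 (cubic A B) + [:a5, a2, a0:]"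

text \<open>
  On the cubic \<open>y^2 = c\<close> the quadric is the function \<open>even_part + odd_part y\<close>; this is its norm to the
  polynomials in \<open>x\<close>.
\<close>
definition G_form :: "'r::idom \<Rightarrow> 'r \<Rightarrow> 'r \<Rightarrow> 'r \<Rightarrow> 'r \<Rightarrow> 'r \<Rightarrow> 'r \<Rightarrow> 'r \<Rightarrow> 'r poly" where
  "G_form A B a0 a1 a2 a3 a4 a5 = (even_part A B a0 a2 a3 a5)\<^sup>2 - (odd_part a1 a4)\<^sup>2 * cubic A B"

definition f3_form :: "'r::idom \<Rightarrow> 'r \<Rightarrow> 'r \<Rightarrow> 'r \<Rightarrow> 'r \<Rightarrow> 'r \<Rightarrow> 'r \<Rightarrow> 'r \<Rightarrow> 'r" where
  "f3_form A B a0 a1 a2 a3 a4 a5 = A * a1^2 * a3 * a4 - B * a1^3 * a3 - a0 * a1 * a4^2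
     - a1^3 * a5 + a1^2 * a2 * a4 + a3 * a4^3"

lemma var_nonzero:
  "var_A \<noteq> 0" "var_B \<noteq> 0" "var_a0 \<noteq> 0" "var_a1 \<noteq> 0" "var_a2 \<noteq> 0" "var_a3 \<noteq> 0" "var_a4 \<noteq> 0" "var_a5 \<noteq> 0"
  by (simp_all add: var_A_def var_B_def var_a0_def var_a1_def var_a2_def var_a3_def var_a4_def var_a5_def)

lemma G_poly_eq_G_form: "G_poly = G_form var_A var_B var_a0 var_a1 var_a2 var_a3 var_a4 var_a5"
proof -
  have P: "P_affine A B = [:- cubic A B, 0, 1:]" for A B :: "'b::idom"
    by (simp add: P_affine_def cubic_form_def cubic_def power2_eq_square power3_eq_cube)
  have q: "q_affine a0 a1 a2 a3 a4 a5 = [:[:a5, a2, a0:], odd_part a1 a4, [:a3:]:]" for a0 a1 a2 a3 a4 a5 :: "'b::idom"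
    by (simp add: q_affine_def quadratic_form_def odd_part_def power2_eq_square)
  have "G_poly = resultant_sub 2 2 [:- cubic var_A var_B, 0, 1:]
      [:[:var_a5, var_a2, var_a0:], odd_part var_a1 var_a4, [:var_a3:]:]"
    unfolding G_poly_def P q resultant_sub by (simp add: var_nonzero numeral_2_eq_2)
  also have "\<dots> = G_form var_A var_B var_a0 var_a1 var_a2 var_a3 var_a4 var_a5"
    unfolding resultant_sub_quadratics by (simp add: G_form_def even_part_def)
  finally show ?thesis .
qed

lemma f3_poly_eq: "f3_poly = f3_form var_A var_B var_a0 var_a1 var_a2 var_a3 var_a4 var_a5"
  by (simp add: f3_poly_def f3_form_def)

lemma map_poly_G_form:
  assumes "comm_ring_hom h"
  shows "map_poly h (G_form A B a0 a1 a2 a3 a4 a5) = G_form (h A) (h B) (h a0) (h a1) (h a2) (h a3) (h a4) (h a5)"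
proof -
  interpret h: comm_ring_hom h by fact
  interpret m: map_poly_comm_ring_hom h ..
  show ?thesis
    by (simp only: G_form_def even_part_def cubic_def odd_part_def m.hom_minus m.hom_add m.hom_mult m.hom_power
        h.map_poly_hom_smult h.map_poly_pCons_hom h.hom_zero h.hom_one m.hom_zero)
qed

lemma hom_f3_form:
  assumes "comm_ring_hom h"
  shows "h (f3_form A B a0 a1 a2 a3 a4 a5) = f3_form (h A) (h B) (h a0) (h a1) (h a2) (h a3) (h a4) (h a5)"
proof -
  interpret h: comm_ring_hom h by fact
  show ?thesis by (simp only: f3_form_def h.hom_minus h.hom_add h.hom_mult h.hom_power)
qed

lemma G_form_coeffs:
  "degree (G_form A B a0 a1 a2 a3 a4 a5) \<le> 6"
  "coeff (G_form A B a0 a1 a2 a3 a4 a5) 6 = a3\<^sup>2"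
  "coeff (G_form A B a0 a1 a2 a3 a4 a5) 5 = 2 * a0 * a3 - a1\<^sup>2"
proof -
  have "G_form A B a0 a1 a2 a3 a4 a5 = [:(a5 + a3 * B)\<^sup>2 - a4\<^sup>2 * B,
     2 * (a5 + a3 * B) * (a2 + a3 * A) - 2 * a1 * a4 * B - a4\<^sup>2 * A,
     2 * (a5 + a3 * B) * a0 + (a2 + a3 * A)\<^sup>2 - a1\<^sup>2 * B - 2 * a1 * a4 * A,
     2 * (a5 + a3 * B) * a3 + 2 * (a2 + a3 * A) * a0 - a1\<^sup>2 * A - a4\<^sup>2,
     2 * (a2 + a3 * A) * a3 + a0\<^sup>2 - 2 * a1 * a4,
     2 * a0 * a3 - a1\<^sup>2, a3\<^sup>2:]"
    by (simp add: G_form_def even_part_def cubic_def odd_part_def power2_eq_square algebra_simps)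
  note e = this
  show "degree (G_form A B a0 a1 a2 a3 a4 a5) \<le> 6" unfolding e
    by (rule degree_le) (auto simp: coeff_pCons numeral_eq_Suc split: nat.split)
  show "coeff (G_form A B a0 a1 a2 a3 a4 a5) 6 = a3\<^sup>2"
  "coeff (G_form A B a0 a1 a2 a3 a4 a5) 5 = 2 * a0 * a3 - a1\<^sup>2" unfolding e by (simp_all add: numeral_eq_Suc)
qed

lemma G_form_degree: "a3 \<noteq> 0 \<Longrightarrow> degree (G_form A B a0 a1 a2 a3 a4 a5) = 6"
proof (rule antisym)
  assume "a3 \<noteq> 0"
  then show "6 \<le> degree (G_form A B a0 a1 a2 a3 a4 a5)" by (intro le_degree) (simp add: G_form_coeffs)
qed (rule G_form_coeffs)

lemma poly_G_form:
  "poly (G_form A B a0 a1 a2 a3 a4 a5) x =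
     (a3 * (x^3 + A * x + B) + a0 * x^2 + a2 * x + a5)\<^sup>2 - (a1 * x + a4)\<^sup>2 * (x^3 + A * x + B)"
  by (simp add: G_form_def even_part_def odd_part_def cubic_def power2_eq_square power3_eq_cube algebra_simps)

lemma poly_pderiv_G_form:
  "poly (pderiv (G_form A B a0 a1 a2 a3 a4 a5)) x =
     2 * (a3 * (x^3 + A * x + B) + a0 * x^2 + a2 * x + a5) * (a3 * (3 * x^2 + A) + 2 * a0 * x + a2)
     - 2 * a1 * (a1 * x + a4) * (x^3 + A * x + B) - (a1 * x + a4)\<^sup>2 * (3 * x^2 + A)"
  by (simp add: G_form_def even_part_def odd_part_def cubic_def pderiv_mult pderiv_diff pderiv_add pderiv_smult pderiv_pCons
      power2_eq_square power3_eq_cube algebra_simps)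

text \<open>
  The substitution that makes \<open>l = a1 x + a4\<close> the coordinate, cleared of denominators, turns
  \<open>G = u^2 - l^2 c\<close> into \<open>U^2 - a1^3 l^2 C\<close> with \<open>U(0) = - f3\<close>. Its two lowest coefficients satisfy the
  hypotheses of \<open>disc6_low_coeffs_dvd\<close>.
\<close>
lemma f3_form_sq_dvd_disc6:
  fixes a1 :: "'r::idom"
  assumes 6: "(6 :: 'r) \<noteq> 0" and nz: "a1 \<noteq> 0" "a3 \<noteq> 0" "f3_form A B a0 a1 a2 a3 a4 a5 \<noteq> 0"
  shows "(f3_form A B a0 a1 a2 a3 a4 a5)\<^sup>2 dvd a1 ^ 30 * disc6 (G_form A B a0 a1 a2 a3 a4 a5)"
proof -
  \<comment> \<open>\<open>Y\<close>, \<open>C\<close> and \<open>U\<close> are \<open>a1 x\<close>, \<open>a1^3 c\<close> and \<open>a1^3 u\<close> as polynomials in \<open>l = a1 x + a4\<close>\<close>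
  define Y where "Y = [:- a4, 1:]"
  define C where "C = Y ^ 3 + smult (A * a1^2) Y + [:B * a1^3:]"
  define U where "U = smult a3 C + smult (a0 * a1) (Y^2) + smult (a1^2 * a2) Y + [:a1^3 * a5:]"
  define H where "H = U\<^sup>2 - smult (a1^3) ([:0, 1:]^2 * C)"
  have Y: "Y \<circ>\<^sub>p [:a4, a1:] = [:0, a1:]" by (simp add: Y_def pcompose_pCons)
  have C: "C \<circ>\<^sub>p [:a4, a1:] = smult (a1^3) (cubic A B)"
    unfolding C_def by (simp add: pcompose_add pcompose_smult pcompose_mult Y cubic_def power2_eq_square power3_eq_cube)
  have U: "U \<circ>\<^sub>p [:a4, a1:] = smult (a1^3) (even_part A B a0 a2 a3 a5)"
    unfolding U_def by (simp add: pcompose_add pcompose_smult pcompose_mult Y C cubic_def even_part_def power2_eq_square power3_eq_cube algebra_simps)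
  have X: "[:0, 1:] \<circ>\<^sub>p [:a4, a1:] = odd_part a1 a4" by (simp add: pcompose_pCons odd_part_def)
  have H: "H \<circ>\<^sub>p [:a4, a1:] = smult (a1^6) (G_form A B a0 a1 a2 a3 a4 a5)"
  proof -
    have "H \<circ>\<^sub>p [:a4, a1:] = (smult (a1^3) (even_part A B a0 a2 a3 a5))\<^sup>2 - smult (a1^3) ((odd_part a1 a4)^2 * smult (a1^3) (cubic A B))"
      unfolding H_def by (simp only: pcompose_diff pcompose_smult pcompose_mult pcompose_hom.hom_power C U X)
    also have "\<dots> = smult (a1^3 * a1^3) (G_form A B a0 a1 a2 a3 a4 a5)"
      by (simp add: G_form_def power2_eq_square smult_diff_right)
    also have "a1^3 * a1^3 = a1^6" by (simp flip: power_add)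
    finally show ?thesis .
  qed
  have dH: "degree H = 6"
  proof -
    have "degree (H \<circ>\<^sub>p [:a4, a1:]) = degree H" using nz by (simp add: degree_pcompose)
    then show ?thesis using nz by (simp add: H G_form_degree)
  qed
  have "a1 ^ 30 * disc6 H = a1 ^ 60 * disc6 (G_form A B a0 a1 a2 a3 a4 a5)"
    using disc6_affine_idom[OF 6 dH nz(1), of a4] by (simp add: H disc6_smult flip: power_mult)
  also have "a1 ^ 60 = a1 ^ 30 * a1 ^ 30" by (simp flip: power_add)
  finally have E: "a1 ^ 30 * disc6 H = a1 ^ 30 * (a1 ^ 30 * disc6 (G_form A B a0 a1 a2 a3 a4 a5))"
    by (simp only: mult.assoc)
  have "a1 ^ 30 \<noteq> 0" using nz by simp
  from iffD1[OF mult_left_cancel[OF this] E]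
  have "disc6 H = a1 ^ 30 * disc6 (G_form A B a0 a1 a2 a3 a4 a5)" .
  moreover have "(f3_form A B a0 a1 a2 a3 a4 a5)\<^sup>2 dvd disc6 H"
  proof (rule disc6_low_coeffs_dvd)
    have U0: "coeff U 0 = - f3_form A B a0 a1 a2 a3 a4 a5"
      by (simp add: U_def C_def Y_def f3_form_def power2_eq_square power3_eq_cube algebra_simps)
    show "(f3_form A B a0 a1 a2 a3 a4 a5)\<^sup>2 dvd coeff H 0"
      by (simp add: H_def power2_eq_square coeff_mult U0)
    show "f3_form A B a0 a1 a2 a3 a4 a5 dvd coeff H 1"
      by (simp add: H_def power2_eq_square coeff_mult U0)
  qed fact
  ultimately show ?thesis by simp
qed

section \<open>Polynomials in the eight coefficients\<close>

text \<open>
  Evaluation with coefficients mapped into an arbitrary ring, so that specialisations to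
  polynomial rings and substitutions of polynomials are also instances.
\<close>
definition ev8 :: "('k::field \<Rightarrow> 's::comm_ring_1) \<Rightarrow> 's \<Rightarrow> 's \<Rightarrow> 's \<Rightarrow> 's \<Rightarrow> 's \<Rightarrow> 's \<Rightarrow> 's \<Rightarrow> 's \<Rightarrow> 'k poly8 \<Rightarrow> 's" where
  "ev8 h A B a0 a1 a2 a3 a4 a5 = ev (ev (ev (ev (ev (ev (ev (ev h A) B) a0) a1) a2) a3) a4) a5"

abbreviation "at8 \<equiv> ev8 (\<lambda>x. x)"

definition const8 :: "'k::field \<Rightarrow> 'k poly8" where "const8 c = [:[:[:[:[:[:[:[:c:]:]:]:]:]:]:]:]"

lemma comm_ring_hom_const8: "comm_ring_hom const8"
  by unfold_locales (simp_all add: const8_def pCons_one)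

lemma ev8_hom:
  assumes h: "comm_ring_hom h"
  shows "comm_ring_hom (ev8 h A B a0 a1 a2 a3 a4 a5)"
    and "ev8 h A B a0 a1 a2 a3 a4 a5 (const8 c) = h c"
    and "ev8 h A B a0 a1 a2 a3 a4 a5 var_A = A"
    and "ev8 h A B a0 a1 a2 a3 a4 a5 var_B = B"
    and "ev8 h A B a0 a1 a2 a3 a4 a5 var_a0 = a0"
    and "ev8 h A B a0 a1 a2 a3 a4 a5 var_a1 = a1"
    and "ev8 h A B a0 a1 a2 a3 a4 a5 var_a2 = a2"
    and "ev8 h A B a0 a1 a2 a3 a4 a5 var_a3 = a3"
    and "ev8 h A B a0 a1 a2 a3 a4 a5 var_a4 = a4"
    and "ev8 h A B a0 a1 a2 a3 a4 a5 var_a5 = a5"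
proof -
  note e1 = comm_ring_hom_ev[OF h, of A]
  note e2 = comm_ring_hom_ev[OF e1, of B]
  note e3 = comm_ring_hom_ev[OF e2, of a0]
  note e4 = comm_ring_hom_ev[OF e3, of a1]
  note e5 = comm_ring_hom_ev[OF e4, of a2]
  note e6 = comm_ring_hom_ev[OF e5, of a3]
  note e7 = comm_ring_hom_ev[OF e6, of a4]
  note e8 = comm_ring_hom_ev[OF e7, of a5]
  show "comm_ring_hom (ev8 h A B a0 a1 a2 a3 a4 a5)" unfolding ev8_def by (rule e8)
  note evs = ev_const[OF h] ev_const[OF e1] ev_const[OF e2] ev_const[OF e3] ev_const[OF e4] ev_const[OF e5] ev_const[OF e6] ev_const[OF e7]
    ev_var[OF h] ev_var[OF e1] ev_var[OF e2] ev_var[OF e3] ev_var[OF e4] ev_var[OF e5] ev_var[OF e6] ev_var[OF e7]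
  show "ev8 h A B a0 a1 a2 a3 a4 a5 (const8 c) = h c"
    and "ev8 h A B a0 a1 a2 a3 a4 a5 var_A = A"
    and "ev8 h A B a0 a1 a2 a3 a4 a5 var_B = B"
    and "ev8 h A B a0 a1 a2 a3 a4 a5 var_a0 = a0"
    and "ev8 h A B a0 a1 a2 a3 a4 a5 var_a1 = a1"
    and "ev8 h A B a0 a1 a2 a3 a4 a5 var_a2 = a2"
    and "ev8 h A B a0 a1 a2 a3 a4 a5 var_a3 = a3"
    and "ev8 h A B a0 a1 a2 a3 a4 a5 var_a4 = a4"
    and "ev8 h A B a0 a1 a2 a3 a4 a5 var_a5 = a5"
    unfolding ev8_def const8_def var_A_def var_B_def var_a0_def var_a1_def var_a2_def var_a3_def var_a4_def var_a5_def
    by (simp_all only: evs)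
qed

lemmas ev8_vars = ev8_hom(2-)

lemma eval8_eq: "eval8 p A B a0 a1 a2 a3 a4 a5 = ev8 (\<lambda>x. x) A B a0 a1 a2 a3 a4 a5 p"
proof -
  note e0 = comm_ring_hom_id
  note e1 = comm_ring_hom_ev[OF e0, of A]
  note e2 = comm_ring_hom_ev[OF e1, of B]
  note e3 = comm_ring_hom_ev[OF e2, of a0]
  note e4 = comm_ring_hom_ev[OF e3, of a1]
  note e5 = comm_ring_hom_ev[OF e4, of a2]
  note e6 = comm_ring_hom_ev[OF e5, of a3]
  note e7 = comm_ring_hom_ev[OF e6, of a4]
  have s0: "poly p A = ev (\<lambda>x. x) A p" for p by (simp add: ev_def map_poly_id[unfolded id_def])
  show ?thesis unfolding eval8_def ev8_def
    unfolding s0 ev_poly_poly[OF e1] ev_const[OF e0] ev_poly_poly[OF e2] ev_const[OF e1]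
      ev_poly_poly[OF e3] ev_const[OF e2] ev_poly_poly[OF e4] ev_const[OF e3]
      ev_poly_poly[OF e5] ev_const[OF e4] ev_poly_poly[OF e6] ev_const[OF e5] ev_poly_poly[OF e7] ev_const[OF e6] ..
qed

lemma hom_ev8:
  fixes g :: "'a::comm_ring_1 \<Rightarrow> 'b::comm_ring_1" and h :: "'k::field \<Rightarrow> 'a"
  assumes g: "comm_ring_hom g" and h: "comm_ring_hom h"
  shows "g (ev8 h A B a0 a1 a2 a3 a4 a5 p) = ev8 (\<lambda>c. g (h c)) (g A) (g B) (g a0) (g a1) (g a2) (g a3) (g a4) (g a5) p"
proof -
  note e1 = comm_ring_hom_ev[OF h, of A]
  note e2 = comm_ring_hom_ev[OF e1, of B]
  note e3 = comm_ring_hom_ev[OF e2, of a0]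
  note e4 = comm_ring_hom_ev[OF e3, of a1]
  note e5 = comm_ring_hom_ev[OF e4, of a2]
  note e6 = comm_ring_hom_ev[OF e5, of a3]
  note e7 = comm_ring_hom_ev[OF e6, of a4]
  have s: "g \<circ> ev f x = ev (g \<circ> f) (g x)" if "comm_ring_hom f" for f :: "'z::comm_ring_1 \<Rightarrow> 'a" and x
    by (rule ext) (simp add: hom_ev[OF g that])
  show ?thesis unfolding ev8_def hom_ev[OF g e7] s[OF e6] s[OF e5] s[OF e4] s[OF e3] s[OF e2] s[OF e1] s[OF h]
    by (simp add: o_def)
qed

text \<open>The constants that occur are products of powers of 2 and 3 and can be cancelled in divisibility statements.\<close>
lemma numeral_unit:
  assumes "(numeral n :: 'k::field) \<noteq> 0" shows "is_unit (numeral n :: 'k poly8)"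
proof -
  interpret c: comm_ring_hom "const8 :: 'k \<Rightarrow> 'k poly8" by (rule comm_ring_hom_const8)
  have "numeral n * const8 (inverse (numeral n :: 'k)) = 1" using assms by (simp flip: c.hom_mult c.hom_numeral)
  then show ?thesis by (metis dvd_triv_left)
qed

lemma prime_elem_X: "prime_elem ([:0, 1:] :: 'r::idom poly)"
proof (rule prime_elemI)
  have dvd: "[:0, 1:] dvd p \<longleftrightarrow> poly p 0 = 0" for p :: "'r poly"
    using poly_eq_0_iff_dvd[of p 0] by simp
  show "\<not> [:0, 1:] dvd (1 :: 'r poly)" unfolding dvd by simp
  show "\<And>a b. [:0, 1:] dvd a * b \<Longrightarrow> [:0, 1:] dvd a \<or> [:0, 1:] dvd (b :: 'r poly)" unfolding dvd by simp
qed simp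

lemma prime_var_a1: "prime_elem (var_a1 :: 'k::field poly8)"
  unfolding var_a1_def by (intro lift_prime_elem_poly prime_elem_X)

lemma prime_var_a3: "prime_elem (var_a3 :: 'k::field poly8)"
  unfolding var_a3_def by (intro lift_prime_elem_poly prime_elem_X)

section \<open>Divisibility of the discriminant by the square of f3\<close>

text \<open>Used to remove the power of \<open>a1\<close> that an affine substitution introduces.\<close>
lemma prime_power_cancel:
  fixes p :: "'r::idom"
  assumes p: "prime_elem p" and c: "\<not> p dvd c" and "c dvd p ^ n * z"
  shows "c dvd z"
  using assms(3)
proof (induction n)
  case (Suc n)
  then obtain q where q: "p * (p ^ n * z) = c * q" by (auto simp: dvd_def mult.assoc)
  have "p dvd c * q" unfolding q[symmetric] by (rule dvd_triv_left)
  then have "p dvd q" using p c by (simp add: prime_elem_dvd_mult_iff)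
  then obtain q' where "q = p * q'" by (auto simp: dvd_def)
  then have "p * (p ^ n * z) = p * (c * q')" using q by (simp only: mult_ac)
  then have "p ^ n * z = c * q'" using prime_elem_not_zeroI[OF p] by (simp only: mult_left_cancel not_False_eq_True simp_thms)
  then show ?case using Suc.IH by simp
qed simp

abbreviation "generic_G \<equiv> G_form var_A var_B var_a0 var_a1 var_a2 var_a3 var_a4 var_a5"

abbreviation "generic_f3 \<equiv> f3_form var_A var_B var_a0 var_a1 var_a2 var_a3 var_a4 var_a5"

lemma ev8_generic_f3:
  assumes "comm_ring_hom h" shows "ev8 h A B a0 a1 a2 a3 a4 a5 generic_f3 = f3_form A B a0 a1 a2 a3 a4 (a5 :: 's::idom)"
  by (simp only: hom_f3_form[OF ev8_hom(1)[OF assms]] ev8_vars[OF assms])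

text \<open>For \<open>a1 = 0\<close> the form \<open>f3\<close> is \<open>a3 a4^3\<close>.\<close>
lemma a1_not_dvd_generic_f3: "\<not> var_a1 dvd (generic_f3 :: 'k::field poly8)"
proof
  assume "var_a1 dvd (generic_f3 :: 'k poly8)"
  then obtain q where q: "(generic_f3 :: 'k poly8) = var_a1 * q" by (auto simp: dvd_def)
  interpret e: comm_ring_hom "ev8 (\<lambda>x. x) 0 0 0 0 0 1 1 0 :: 'k poly8 \<Rightarrow> 'k"
    by (rule ev8_hom(1)[OF comm_ring_hom_id])
  have "ev8 (\<lambda>x. x) 0 0 0 0 0 1 1 0 (generic_f3 :: 'k poly8) = 0"
    unfolding q e.hom_mult ev8_vars[OF comm_ring_hom_id] by simp
  then show False unfolding ev8_generic_f3[OF comm_ring_hom_id] by (simp add: f3_form_def)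
qed

lemma generic_f3_nonzero: "generic_f3 \<noteq> (0 :: 'k::field poly8)"
  by (metis a1_not_dvd_generic_f3 dvd_0_right)

lemma generic_f3_sq_dvd_disc6:
  assumes six: "(6 :: 'k::field) \<noteq> 0"
  shows "generic_f3\<^sup>2 dvd disc6 (generic_G :: 'k poly8 poly)"
proof (rule prime_power_cancel[OF prime_var_a1])
  show "\<not> var_a1 dvd (generic_f3 :: 'k poly8)\<^sup>2"
    using a1_not_dvd_generic_f3 prime_elem_dvd_power[OF prime_var_a1] by blast
  show "(generic_f3 :: 'k poly8)\<^sup>2 dvd var_a1 ^ 30 * disc6 generic_G"
    by (rule f3_form_sq_dvd_disc6[OF six_nonzero_hom[OF comm_ring_hom_const8 six] var_nonzero(4,6) generic_f3_nonzero])
qed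

lemma unit_1296:
  assumes six: "(6 :: 'k::field) \<noteq> 0"
  shows "\<exists>w :: 'k poly8. 1296 * w = 1"
  using numeral_unit[OF six_factors(3)[OF six]] by (metis dvdE)

text \<open>
  The sign is that of the discriminant in degree 6, \<open>(-1)^15\<close>, and \<open>1296 = 6^4\<close> comes from
  \<open>resultant_pderiv_eq_disc6\<close>.
\<close>
lemma Delta_eq_disc6:
  assumes six: "(6 :: 'k::field) \<noteq> 0"
  shows "1296 * (Delta_poly :: 'k poly8) = - disc6 generic_G"
proof -
  define R where "R = resultant_sub 6 5 (generic_G :: 'k poly8 poly) (pderiv generic_G)"
  obtain w :: "'k poly8" where u: "1296 * w = 1" using unit_1296[OF six] by blast
  have cf: "coeff (generic_G :: 'k poly8 poly) 6 \<noteq> 0" unfolding G_form_coeffs using var_nonzero by (simp add: var_nonzero)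
  have E: "1296 * R = coeff generic_G 6 * disc6 generic_G"
    unfolding R_def
    by (rule resultant_pderiv_eq_disc6_idom[OF six_nonzero_hom[OF comm_ring_hom_const8 six] G_form_degree[OF var_nonzero(6)]])
  have "R = (1296 * w) * R" by (simp only: u mult_1)
  also have "\<dots> = w * (1296 * R)" by (simp only: mult_ac)
  finally have "R = coeff generic_G 6 * (w * disc6 generic_G)" unfolding E by (simp only: mult_ac)
  then have "R div coeff generic_G 6 = w * disc6 generic_G" using cf by simp
  then have D: "(Delta_poly :: 'k poly8) = - (w * disc6 generic_G)"
    by (simp add: Delta_poly_def discriminant_def G_poly_eq_G_form R_def)
  have "1296 * (Delta_poly :: 'k poly8) = - ((1296 * w) * disc6 generic_G)"
    unfolding D mult_minus_right mult.assoc ..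
  then show ?thesis by (simp only: u mult_1)
qed

lemma f3_sq_dvd_Delta:
  assumes six: "(6 :: 'k::field) \<noteq> 0"
  shows "(f3_poly :: 'k poly8)\<^sup>2 dvd Delta_poly"
proof -
  obtain w :: "'k poly8" where u: "1296 * w = 1" using unit_1296[OF six] by blast
  have "f3_poly\<^sup>2 dvd (1296 * Delta_poly :: 'k poly8)"
    unfolding Delta_eq_disc6[OF six] f3_poly_eq using generic_f3_sq_dvd_disc6[OF six] by simp
  then have "f3_poly\<^sup>2 dvd w * (1296 * Delta_poly :: 'k poly8)" by (rule dvd_mult)
  also have "w * (1296 * Delta_poly :: 'k poly8) = 1296 * w * Delta_poly"
    by (simp only: mult_ac)
  finally show ?thesis by (simp add: u)
qed

lemma disc6_eq_f2:
  assumes six: "(6 :: 'k::field) \<noteq> 0"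
  shows "disc6 (generic_G :: 'k poly8 poly) = - (1296 * f2_poly * generic_f3\<^sup>2)"
proof -
  have "(Delta_poly :: 'k poly8) = f3_poly\<^sup>2 * f2_poly"
    using f3_sq_dvd_Delta[OF six] by (simp add: f2_poly_def)
  with Delta_eq_disc6[OF six] have "disc6 (generic_G :: 'k poly8 poly) = - (1296 * (f3_poly\<^sup>2 * f2_poly))" by simp
  then show ?thesis by (simp only: f3_poly_eq mult_ac)
qed

text \<open>
  The relation between \<open>\<Delta>\<close>, \<open>f2\<close> and \<open>f3\<close> survives every specialisation, also where \<open>a3 = 0\<close>
  makes the degree of \<open>G\<close> drop. All later information about \<open>f2\<close> is read off from this identity.
\<close>
lemma disc6_eq_ev8_f2:
  fixes h :: "'k::field \<Rightarrow> 's::idom"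
  assumes six: "(6 :: 'k) \<noteq> 0" and h: "comm_ring_hom h"
  shows "disc6 (G_form A B a0 a1 a2 a3 a4 a5) =
    - (1296 * ev8 h A B a0 a1 a2 a3 a4 a5 f2_poly * (f3_form A B a0 a1 a2 a3 a4 a5)\<^sup>2)"
proof -
  note H = ev8_hom(1)[OF h, of A B a0 a1 a2 a3 a4 a5]
  interpret e: comm_ring_hom "ev8 h A B a0 a1 a2 a3 a4 a5" by (rule H)
  have "disc6 (G_form A B a0 a1 a2 a3 a4 a5) = ev8 h A B a0 a1 a2 a3 a4 a5 (disc6 generic_G)"
    by (simp only: disc6_hom[OF H, symmetric] map_poly_G_form[OF H] ev8_vars[OF h])
  also have "\<dots> = - (1296 * ev8 h A B a0 a1 a2 a3 a4 a5 f2_poly * (f3_form A B a0 a1 a2 a3 a4 a5)\<^sup>2)"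
    by (simp only: disc6_eq_f2[OF six] e.hom_mult e.hom_power e.hom_uminus e.hom_numeral ev8_generic_f3[OF h])
  finally show ?thesis .
qed

section \<open>Tangency of the quadric and the cubic\<close>

text \<open>
  The last equation is the vanishing of the Jacobian determinant of the affine equations of the cubic and the
  quadric: their gradients at the common point \<open>(x, y)\<close> are linearly dependent.
\<close>
definition tangent :: "'r::idom \<Rightarrow> 'r \<Rightarrow> 'r \<Rightarrow> 'r \<Rightarrow> 'r \<Rightarrow> 'r \<Rightarrow> 'r \<Rightarrow> 'r \<Rightarrow> 'r \<Rightarrow> 'r \<Rightarrow> bool" where
  "tangent A B a0 a1 a2 a3 a4 a5 x y \<longleftrightarrow>
     y^2 = x^3 + A * x + B \<and>
     a0 * x^2 + a1 * x * y + a2 * x + a3 * y^2 + a4 * y + a5 = 0 \<and>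
     2 * y * (2 * a0 * x + a1 * y + a2) + (3 * x^2 + A) * (a1 * x + 2 * a3 * y + a4) = 0"

definition quadric where "quadric a0 a1 a2 a3 a4 a5 x y = a0 * x^2 + a1 * x * y + a2 * x + a3 * y^2 + a4 * y + (a5 :: 'r::idom)"

definition tangency where "tangency A a0 a1 a2 a3 a4 x y = 2 * y * (2 * a0 * x + a1 * y + a2) + (3 * x^2 + A) * (a1 * x + 2 * a3 * y + (a4 :: 'r::idom))"

lemma tangent_iff: "tangent A B a0 a1 a2 a3 a4 a5 x y \<longleftrightarrow>
  y^2 = x^3 + A * x + B \<and> quadric a0 a1 a2 a3 a4 a5 x y = 0 \<and> tangency A a0 a1 a2 a3 a4 x y = 0"
  by (simp add: tangent_def quadric_def tangency_def)

text \<open>With \<open>u = - l y\<close> the derivative of \<open>u^2 - l^2 c\<close> is \<open>- l\<close> times the Jacobian determinant.\<close>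
lemma tangent_double_root:
  assumes "tangent A B a0 a1 a2 a3 a4 a5 x y"
  shows "poly (G_form A B a0 a1 a2 a3 a4 a5) x = 0" "poly (pderiv (G_form A B a0 a1 a2 a3 a4 a5)) x = 0"
proof -
  define u where "u = a3 * (x^3 + A * x + B) + a0 * x^2 + a2 * x + a5"
  define l where "l = a1 * x + a4"
  define u' where "u' = a3 * (3 * x^2 + A) + 2 * a0 * x + a2"
  from assms have c: "y^2 = x^3 + A * x + B" by (simp add: tangent_def)
  have "u + l * y = a0 * x^2 + a1 * x * y + a2 * x + a3 * y^2 + a4 * y + a5"
    unfolding u_def l_def c[symmetric] by (simp add: algebra_simps)
  also have "\<dots> = 0" using assms unfolding tangent_def by blast
  finally have F: "u + l * y = 0" .
  then have u: "u = - (l * y)" by (simp add: eq_neg_iff_add_eq_0)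
  have "2 * a1 * y^2 + l * (3 * x^2 + A) + 2 * u' * y =
      2 * y * (2 * a0 * x + a1 * y + a2) + (3 * x^2 + A) * (a1 * x + 2 * a3 * y + a4)"
    by (simp add: u'_def l_def algebra_simps power2_eq_square)
  also have "\<dots> = 0" using assms unfolding tangent_def by blast
  finally have D: "2 * a1 * y^2 + l * (3 * x^2 + A) + 2 * u' * y = 0" .
  have "poly (G_form A B a0 a1 a2 a3 a4 a5) x = u\<^sup>2 - l\<^sup>2 * y\<^sup>2"
    by (simp only: poly_G_form u_def l_def c)
  then show "poly (G_form A B a0 a1 a2 a3 a4 a5) x = 0" by (simp add: u power_mult_distrib)
  have "poly (pderiv (G_form A B a0 a1 a2 a3 a4 a5)) x = 2 * u * u' - 2 * a1 * l * y\<^sup>2 - l\<^sup>2 * (3 * x^2 + A)"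
    by (simp only: poly_pderiv_G_form u_def l_def u'_def c)
  also have "\<dots> = - l * (2 * a1 * y^2 + l * (3 * x^2 + A) + 2 * u' * y)"
    unfolding u by (simp add: algebra_simps power2_eq_square)
  finally show "poly (pderiv (G_form A B a0 a1 a2 a3 a4 a5)) x = 0" by (simp add: D)
qed

text \<open>
  If \<open>l\<close> vanished at the double root, so would \<open>u\<close>, and \<open>f3\<close> would be \<open>- a1^3 u = 0\<close>. Otherwise the
  point of the cubic above \<open>x\<close> is \<open>(x, - u / l)\<close>.
\<close>
lemma double_root_tangent:
  fixes A :: "'l::field"
  assumes f3_form: "f3_form A B a0 a1 a2 a3 a4 a5 \<noteq> 0"
    and r: "poly (G_form A B a0 a1 a2 a3 a4 a5) x = 0" "poly (pderiv (G_form A B a0 a1 a2 a3 a4 a5)) x = 0"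
  shows "\<exists>y. tangent A B a0 a1 a2 a3 a4 a5 x y"
proof -
  define u where "u = a3 * (x^3 + A * x + B) + a0 * x^2 + a2 * x + a5"
  define l where "l = a1 * x + a4"
  define c where "c = x^3 + A * x + B"
  define u' where "u' = a3 * (3 * x^2 + A) + 2 * a0 * x + a2"
  have g: "u\<^sup>2 = l\<^sup>2 * c" using r(1) unfolding poly_G_form by (simp add: u_def l_def c_def)
  have g': "2 * u * u' - 2 * a1 * l * c - l\<^sup>2 * (3 * x^2 + A) = 0"
    using r(2) unfolding poly_pderiv_G_form u_def l_def c_def u'_def .
  have l: "l \<noteq> 0"
  proof
    assume l0: "l = 0"
    then have u0: "u = 0" using g by simp
    have a4: "a4 = - (a1 * x)" using l0 by (simp add: l_def eq_neg_iff_add_eq_0 add.commute)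
    have "f3_form A B a0 a1 a2 a3 a4 a5 = - (a1^3 * u)"
      unfolding a4 by (simp add: f3_form_def u_def algebra_simps power2_eq_square power3_eq_cube)
    with u0 f3_form show False by simp
  qed
  define y where "y = - u / l"
  have uy: "u = - (l * y)" using l by (simp add: y_def)
  have "l\<^sup>2 * y\<^sup>2 = l\<^sup>2 * c" using g unfolding uy by (simp add: power_mult_distrib)
  then have y2: "y\<^sup>2 = c" using l by simp
  have "l * (2 * a1 * y^2 + l * (3 * x^2 + A) + 2 * u' * y) = - (2 * u * u' - 2 * a1 * l * c - l\<^sup>2 * (3 * x^2 + A))"
    unfolding uy y2 by (simp add: algebra_simps power2_eq_square)
  then have D: "2 * a1 * y^2 + l * (3 * x^2 + A) + 2 * u' * y = 0" using g' l by simp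
  have "tangent A B a0 a1 a2 a3 a4 a5 x y"
    unfolding tangent_def
  proof (intro conjI)
    show "y^2 = x^3 + A * x + B" using y2 by (simp add: c_def)
    have "a0 * x^2 + a1 * x * y + a2 * x + a3 * y^2 + a4 * y + a5 = u + l * y"
      unfolding y2 by (simp add: u_def l_def c_def algebra_simps)
    then show "a0 * x^2 + a1 * x * y + a2 * x + a3 * y^2 + a4 * y + a5 = 0" by (simp add: uy)
    have "2 * y * (2 * a0 * x + a1 * y + a2) + (3 * x^2 + A) * (a1 * x + 2 * a3 * y + a4) =
      2 * a1 * y^2 + l * (3 * x^2 + A) + 2 * u' * y"
      by (simp add: u'_def l_def algebra_simps power2_eq_square)
    then show "2 * y * (2 * a0 * x + a1 * y + a2) + (3 * x^2 + A) * (a1 * x + 2 * a3 * y + a4) = 0" by (simp add: D)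
  qed
  then show ?thesis ..
qed

text \<open>A double root of \<open>G\<close> at infinity would mean \<open>a1 = a3 = 0\<close>, hence \<open>f3 = 0\<close>.\<close>
lemma f2_zero_imp_tangent:
  fixes A :: "'l::alg_closed_field"
  assumes six: "(6 :: 'l) \<noteq> 0"
    and "at8 A B a0 a1 a2 a3 a4 a5 f2_poly = 0" and f3_form: "f3_form A B a0 a1 a2 a3 a4 a5 \<noteq> 0"
  shows "\<exists>x y. tangent A B a0 a1 a2 a3 a4 a5 x y"
proof -
  have "disc6 (G_form A B a0 a1 a2 a3 a4 a5) = 0"
    using disc6_eq_ev8_f2[OF six comm_ring_hom_id] assms by simp
  then consider "a3\<^sup>2 = 0" "2 * a0 * a3 - a1\<^sup>2 = 0" |
    x where "poly (G_form A B a0 a1 a2 a3 a4 a5) x = 0" "poly (pderiv (G_form A B a0 a1 a2 a3 a4 a5)) x = 0"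
    unfolding disc6_eq_0_iff[OF six G_form_coeffs(1)] G_form_coeffs by blast
  then show ?thesis
  proof cases
    case 1
    then have "a3 = 0" "a1 = 0" by auto
    then show ?thesis using f3_form by (simp add: f3_form_def)
  next
    case 2
    then show ?thesis using double_root_tangent[OF f3_form] by blast
  qed
qed

text \<open>
  \<open>f1\<close> is, up to sign, the discriminant of \<open>x^3 + A x + B\<close>, whose multiple roots are the singular points
  of the cubic.
\<close>
lemma smooth_of_f1:
  fixes A :: "'l::field"
  assumes six: "(6 :: 'l) \<noteq> 0" and f1: "4 * A^3 + 27 * B^2 \<noteq> 0" and c: "y^2 = x^3 + A * x + B"
  shows "3 * x^2 + A \<noteq> 0 \<or> 2 * y \<noteq> 0"
proof (rule ccontr)
  assume "\<not> ?thesis"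
  then have "y = 0" and A: "A = - (3 * x^2)" using six_factors[OF six] by (auto simp: eq_neg_iff_add_eq_0 add.commute)
  then have B: "B = 2 * x^3" using c by (simp add: algebra_simps power2_eq_square power3_eq_cube)
  have "4 * A^3 + 27 * B^2 = 0" unfolding A B by (simp add: power_mult_distrib power_minus_odd flip: power_mult)
  with f1 show False by contradiction
qed

section \<open>The tangency locus is parametrised\<close>

text \<open>
  The argument list is that of a quadric tangent to the cubic at \<open>(s, t)\<close>: \<open>m\<close> is the multiplier
  in \<open>grad q = m grad (y^2 - c)\<close>. This equation is solved for \<open>a2\<close> and \<open>a4\<close>, the equation of the cubic for \<open>B\<close> and
  that of the quadric for \<open>a5\<close>. The function \<open>f\<close> is a parameter because the same substitution is made
  in \<open>tangent\<close>, in \<open>G_form\<close>, in \<open>f3_form\<close> and in evaluation maps.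
\<close>
definition on_tangency :: "('r::idom \<Rightarrow> 'r \<Rightarrow> 'r \<Rightarrow> 'r \<Rightarrow> 'r \<Rightarrow> 'r \<Rightarrow> 'r \<Rightarrow> 'r \<Rightarrow> 'b) \<Rightarrow> 'r \<Rightarrow> 'r \<Rightarrow> 'r \<Rightarrow> 'r \<Rightarrow> 'r \<Rightarrow> 'r \<Rightarrow> 'r \<Rightarrow> 'b" where
  "on_tangency f A s t a0 a1 a3 m =
     f A (t^2 - s^3 - A * s) a0 a1 (- m * (3 * s^2 + A) - 2 * a0 * s - a1 * t) a3 (2 * m * t - a1 * s - 2 * a3 * t)
       (- (a0 * s^2 + a1 * s * t + (- m * (3 * s^2 + A) - 2 * a0 * s - a1 * t) * s + a3 * t^2
         + (2 * m * t - a1 * s - 2 * a3 * t) * t))"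

lemma tangent_on_tangency: "on_tangency tangent A s t a0 a1 a3 m s t"
  by (simp add: on_tangency_def tangent_def algebra_simps power2_eq_square power3_eq_cube)

text \<open>
  At a smooth point of the cubic the gradient \<open>(- (3 s^2 + A), 2 t)\<close> is nonzero, so dependence of the gradients
  provides a multiplier.
\<close>
lemma tangent_imp_on_tangency:
  fixes A :: "'l::field"
  assumes "tangent A B a0 a1 a2 a3 a4 a5 s t" and smooth: "3 * s^2 + A \<noteq> 0 \<or> 2 * t \<noteq> 0"
  obtains m where "\<And>f :: _ \<Rightarrow> _ \<Rightarrow> _ \<Rightarrow> _ \<Rightarrow> _ \<Rightarrow> _ \<Rightarrow> _ \<Rightarrow> _ \<Rightarrow> 'b. f A B a0 a1 a2 a3 a4 a5 = on_tangency f A s t a0 a1 a3 m"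
proof -
  define qx where "qx = 2 * a0 * s + a1 * t + a2"
  define qy where "qy = a1 * s + 2 * a3 * t + a4"
  define k where "k = 3 * s^2 + A"
  have D: "2 * t * qx + k * qy = 0" and B: "B = t^2 - s^3 - A * s"
    using assms(1) by (simp_all add: tangent_def qx_def qy_def k_def)
  have Q: "a5 = - (a0 * s^2 + a1 * s * t + a2 * s + a3 * t^2 + a4 * t)"
    using assms(1) unfolding tangent_def by (metis add.commute eq_neg_iff_add_eq_0)
  \<comment> \<open>one component of the gradient of the cubic is nonzero and determines the multiplier\<close>
  define m where "m = (if k = 0 then qy / (2 * t) else - qx / k)"
  have m: "qx = - m * k" "qy = 2 * m * t"
  proof -
    have "qx = - m * k \<and> qy = 2 * m * t"
    proof (cases "k = 0")
      case True
      then have "2 * t \<noteq> 0" using smooth k_def by simp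
      moreover from this have "qx = 0" using D True by (metis add.right_neutral mult_eq_0_iff mult_zero_left)
      ultimately show ?thesis using True by (simp add: m_def)
    next
      case False
      have "k * qy = 2 * (- qx) * t" using D by (simp add: eq_neg_iff_add_eq_0 algebra_simps)
      then have "qy = 2 * (- qx / k) * t" using False by (simp add: field_simps)
      then show ?thesis using False by (simp add: m_def)
    qed
    then show "qx = - m * k" "qy = 2 * m * t" by auto
  qed
  have a2: "a2 = - m * (3 * s^2 + A) - 2 * a0 * s - a1 * t" using m(1) by (simp add: qx_def k_def algebra_simps)
  have a4: "a4 = 2 * m * t - a1 * s - 2 * a3 * t" using m(2) by (simp add: qy_def algebra_simps)
  show ?thesis
    by (rule that[of m]) (unfold on_tangency_def Q, fold a2 a4 B, rule refl)
qed

text \<open>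
  The restriction homomorphism to the tangency locus. The variables \<open>B\<close>, \<open>a2\<close> and \<open>a4\<close>, which are
  determined there, are reused as the parameters \<open>s\<close>, \<open>t\<close> and \<open>m\<close>.
\<close>
abbreviation "restrict_tangency \<equiv> on_tangency (ev8 const8) var_A var_B var_a2 var_a0 var_a1 var_a3 var_a4"

text \<open>The discriminant vanishes identically on the locus, \<open>f3\<close> does not, and \<open>\<Delta> = f2 f3^2\<close>.\<close>
lemma restrict_tangency_f2:
  assumes six: "(6 :: 'k::field) \<noteq> 0"
  shows "restrict_tangency f2_poly = (0 :: 'k poly8)"
proof -
  define w where "w = (on_tangency f3_form var_A var_B var_a2 var_a0 var_a1 var_a3 var_a4 :: 'k poly8)"
  interpret c: comm_ring_hom "const8 :: 'k \<Rightarrow> 'k poly8" by (rule comm_ring_hom_const8)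
  have disc: "disc6 (on_tangency G_form A s t a0 a1 a3 m) = 0" for A s t a0 a1 a3 m :: "'r::idom"
    using tangent_on_tangency[of A s t a0 a1 a3 m] unfolding on_tangency_def
    by (intro disc6_double_root_idom[of _ s] G_form_coeffs tangent_double_root)
  \<comment> \<open>at \<open>A = s = a0 = a1 = 0\<close>, \<open>t = a3 = 1\<close>, \<open>m = 2\<close> the value of \<open>w\<close> is \<open>a3 a4^3\<close> with \<open>a4 = 2\<close>\<close>
  have "w \<noteq> 0"
  proof
    let ?e = "at8 0 0 0 0 1 1 2 0 :: 'k poly8 \<Rightarrow> 'k"
    note H = ev8_hom(1)[OF comm_ring_hom_id, of 0 0 0 0 1 1 2 0]
    interpret e: comm_ring_hom ?e by (rule H)
    assume "w = 0"
    then have "?e w = 0" by simp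
    moreover have "?e w = (2 :: 'k) ^ 3"
      unfolding w_def on_tangency_def hom_f3_form[OF H] e.hom_mult e.hom_power e.hom_minus e.hom_add e.hom_uminus e.hom_numeral ev8_vars[OF comm_ring_hom_id]
      by (simp add: f3_form_def)
    ultimately have "(2 :: 'k) ^ 3 = 0" by (simp only:)
    then show False using six_factors(1)[OF six] by (simp only: power_eq_0_iff) simp
  qed
  moreover have "1296 * restrict_tangency f2_poly * w\<^sup>2 = 0"
    using disc[of var_A var_B var_a2 var_a0 var_a1 var_a3 "var_a4 :: 'k poly8"] unfolding on_tangency_def w_def
    by (subst (asm) disc6_eq_ev8_f2[OF six comm_ring_hom_const8]) simp
  moreover have "(1296 :: 'k poly8) \<noteq> 0"
    using hom_nonzero[OF comm_ring_hom_const8 six_factors(3)[OF six]] unfolding c.hom_numeral .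
  ultimately show ?thesis by simp
qed

lemma at8_restrict_tangency:
  "at8 A s a0 a1 t a3 m a5 (restrict_tangency p) = on_tangency at8 A s t a0 a1 a3 m (p :: 'k::field poly8)"
proof -
  note H = ev8_hom(1)[OF comm_ring_hom_id, of A s a0 a1 t a3 m a5]
  interpret e: comm_ring_hom "at8 A s a0 a1 t a3 m a5" by (rule H)
  show ?thesis
    unfolding on_tangency_def hom_ev8[OF H comm_ring_hom_const8]
    by (simp only: ev8_vars[OF comm_ring_hom_id] e.hom_mult e.hom_power e.hom_minus e.hom_add e.hom_uminus e.hom_numeral)
qed

lemma tangent_imp_f2_zero:
  fixes A :: "'k::field"
  assumes six: "(6 :: 'k) \<noteq> 0"
    and "tangent A B a0 a1 a2 a3 a4 a5 s t" "3 * s^2 + A \<noteq> 0 \<or> 2 * t \<noteq> 0"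
  shows "at8 A B a0 a1 a2 a3 a4 a5 f2_poly = 0"
proof -
  \<comment> \<open>evaluation at the given coefficients factors through the restriction to the tangency locus\<close>
  obtain m where m: "at8 A B a0 a1 a2 a3 a4 a5 = on_tangency at8 A s t a0 a1 a3 m"
    using tangent_imp_on_tangency[OF assms(2,3), where 'b = "'k poly8 \<Rightarrow> 'k"] by metis
  interpret e: comm_ring_hom "at8 A s a0 a1 t a3 m 0 :: 'k poly8 \<Rightarrow> 'k" by (rule ev8_hom(1)[OF comm_ring_hom_id])
  show ?thesis unfolding m by (simp add: restrict_tangency_f2[OF six] flip: at8_restrict_tangency[where ?a5.0 = 0])
qed

text \<open>
  For \<open>a3 = 0\<close> the two top coefficients of \<open>G\<close> are \<open>0\<close> and \<open>- a1^2\<close>, so \<open>a1^4\<close> divides the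
  discriminant, while \<open>f3 = a1 h\<close> with \<open>h\<close> prime to \<open>a1\<close>. Hence \<open>a1\<close> divides \<open>f2\<close> restricted to \<open>a3 = 0\<close>.
\<close>
lemma f2_zero_at_infinity:
  assumes six: "(6 :: 'k::field) \<noteq> 0"
  shows "at8 A B a0 0 a2 0 a4 a5 (f2_poly :: 'k poly8) = 0"
proof -
  define h where "h = (- var_a0 * var_a4^2 - var_a1^2 * var_a5 + var_a1 * var_a2 * var_a4 :: 'k poly8)"
  define f where "f = ev8 const8 var_A var_B var_a0 var_a1 var_a2 0 var_a4 var_a5 (f2_poly :: 'k poly8)"
  have h: "f3_form var_A var_B var_a0 var_a1 var_a2 0 var_a4 var_a5 = var_a1 * h"
    by (simp add: f3_form_def h_def algebra_simps power2_eq_square power3_eq_cube)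
  have "(var_a1\<^sup>2)\<^sup>2 dvd disc6 (G_form var_A var_B var_a0 var_a1 var_a2 0 var_a4 (var_a5 :: 'k poly8))"
    by (rule disc6_high_coeffs_dvd) (simp_all add: G_form_coeffs var_nonzero)
  then have "var_a1\<^sup>2 * var_a1\<^sup>2 dvd var_a1\<^sup>2 * (1296 * f * h\<^sup>2)"
    unfolding disc6_eq_ev8_f2[OF six comm_ring_hom_const8] h f_def[symmetric]
    by (simp add: power_mult_distrib mult_ac power2_eq_square)
  then have "var_a1\<^sup>2 dvd 1296 * f * h\<^sup>2" using var_nonzero(4) by (subst (asm) dvd_times_left_cancel_iff) auto
  then have "var_a1 dvd 1296 * f * h\<^sup>2" by (metis dvd_mult_left power2_eq_square)
  moreover have "\<not> var_a1 dvd h"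
  proof
    assume "var_a1 dvd h"
    then obtain q where q: "h = var_a1 * q" by (auto simp: dvd_def)
    let ?e = "at8 0 0 1 0 0 0 1 0 :: 'k poly8 \<Rightarrow> 'k"
    interpret e: comm_ring_hom ?e by (rule ev8_hom(1)[OF comm_ring_hom_id])
    have "?e h = 0" unfolding q e.hom_mult ev8_vars[OF comm_ring_hom_id] by simp
    moreover have "?e h = -1"
      unfolding h_def e.hom_mult e.hom_power e.hom_minus e.hom_add e.hom_uminus ev8_vars[OF comm_ring_hom_id] by simp
    ultimately show False by simp
  qed
  moreover have "\<not> var_a1 dvd (1296 :: 'k poly8)"
  proof
    assume "var_a1 dvd (1296 :: 'k poly8)"
    moreover obtain w where "1296 * w = (1 :: 'k poly8)" using unit_1296[OF six] by blast
    ultimately have "is_unit (var_a1 :: 'k poly8)" by (metis dvd_mult2)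
    then show False using prime_elem_not_unit[OF prime_var_a1[where 'k = 'k]] by simp
  qed
  ultimately have "var_a1 dvd f"
    using prime_elem_dvd_mult_iff[OF prime_var_a1] prime_elem_dvd_power[OF prime_var_a1] by metis
  then obtain q where q: "f = var_a1 * q" by (auto simp: dvd_def)
  let ?e = "at8 A B a0 0 a2 0 a4 a5"
  note H = ev8_hom(1)[OF comm_ring_hom_id, of A B a0 0 a2 0 a4 a5]
  interpret e: comm_ring_hom ?e by (rule H)
  have "?e f = 0" unfolding q e.hom_mult ev8_vars[OF comm_ring_hom_id] by simp
  moreover have "?e f = ?e f2_poly"
    unfolding f_def hom_ev8[OF H comm_ring_hom_const8] by (simp only: ev8_vars[OF comm_ring_hom_id] e.hom_zero)
  ultimately show ?thesis by simp
qed

section \<open>Hypersurfaces over an algebraically closed field\<close>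

lemma ev_nonzero:
  fixes E :: "('a::comm_ring_1 \<Rightarrow> 's::idom) set"
  assumes inf: "infinite (UNIV :: 's set)"
    and hom: "\<And>h. h \<in> E \<Longrightarrow> comm_ring_hom h"
    and sep: "\<And>a. a \<noteq> 0 \<Longrightarrow> \<exists>h\<in>E. h a \<noteq> 0"
    and p: "p \<noteq> 0"
  shows "\<exists>h\<in>E. \<exists>x. ev h x p \<noteq> 0"
proof -
  obtain h where h: "h \<in> E" "h (lead_coeff p) \<noteq> 0" using sep[of "lead_coeff p"] p by auto
  interpret h: comm_ring_hom h by (rule hom) fact
  have "coeff (map_poly h p) (degree p) \<noteq> 0" using h by simp
  then have "map_poly h p \<noteq> 0" by (metis coeff_0)
  then have "finite {x. poly (map_poly h p) x = 0}" by (rule poly_roots_finite)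
  then obtain x where "poly (map_poly h p) x \<noteq> 0" using inf by (metis (mono_tags, lifting) UNIV_eq_I mem_Collect_eq)
  then show ?thesis using h by (auto simp: ev_def)
qed

lemma alg_closed_infinite: "infinite (UNIV :: 'l::alg_closed_field set)"
proof
  assume fin: "finite (UNIV :: 'l set)"
  define p :: "'l poly" where "p = 1 + (\<Prod>a\<in>UNIV. [:- a, 1:])"
  have "degree (\<Prod>a\<in>UNIV. [:- a, 1:] :: 'l poly) = card (UNIV :: 'l set)"
    by (subst degree_prod_sum_eq) auto
  moreover have "card (UNIV :: 'l set) > 0" using fin by (simp add: card_gt_0_iff)
  ultimately have "degree p > 0" unfolding p_def by (subst degree_add_eq_right) auto
  then obtain x where "poly p x = 0" using alg_closed_imp_poly_has_root by blast
  moreover have "poly p x = 1" unfolding p_def using fin by (auto simp: poly_prod prod_zero_iff)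
  ultimately show False by simp
qed

lemma poly_all_zero:
  fixes p :: "'l::alg_closed_field poly"
  assumes "\<And>x. poly p x = 0" shows "p = 0"
proof (rule ccontr)
  assume "p \<noteq> 0"
  then have "finite {x. poly p x = 0}" by (rule poly_roots_finite)
  then show False using assms alg_closed_infinite[where 'l = 'l] by simp
qed

text \<open>
  Families of homomorphisms that detect nonzero elements; the property passes to polynomial rings over an
  infinite field and so by iteration to polynomials in several variables.
\<close>
definition separating :: "('a::comm_ring_1 \<Rightarrow> 's::comm_ring_1) set \<Rightarrow> bool" where
  "separating E \<longleftrightarrow> (\<forall>h\<in>E. comm_ring_hom h) \<and> (\<forall>a. a \<noteq> 0 \<longrightarrow> (\<exists>h\<in>E. h a \<noteq> 0))"

lemma separating_ev:
  fixes E :: "('a::comm_ring_1 \<Rightarrow> 's::alg_closed_field) set"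
  assumes "separating E" shows "separating {ev h x | h x. h \<in> E}"
  unfolding separating_def
proof (intro conjI ballI allI impI)
  show "comm_ring_hom g" if "g \<in> {ev h x | h x. h \<in> E}" for g
    using that assms comm_ring_hom_ev by (auto simp: separating_def)
  show "\<exists>g\<in>{ev h x | h x. h \<in> E}. g p \<noteq> 0" if "p \<noteq> 0" for p
    using ev_nonzero[OF alg_closed_infinite, of E p] assms that by (fastforce simp: separating_def)
qed

text \<open>Specialises all variables but \<open>a5\<close>, when applied to the coefficients of a polynomial in \<open>a5\<close>.\<close>
definition ev7 where
  "ev7 h A B a0 a1 a2 a3 a4 = ev (ev (ev (ev (ev (ev (ev h A) B) a0) a1) a2) a3) a4"

lemma ev8_ev7: "ev8 h A B a0 a1 a2 a3 a4 a5 = ev (ev7 h A B a0 a1 a2 a3 a4) a5"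
  by (simp add: ev8_def ev7_def)

lemma ev7_hom: "comm_ring_hom h \<Longrightarrow> comm_ring_hom (ev7 h A B a0 a1 a2 a3 a4)"
  unfolding ev7_def by (intro comm_ring_hom_ev)

lemma hom_ev7:
  fixes g :: "'a::comm_ring_1 \<Rightarrow> 'b::comm_ring_1" and h :: "'k::field \<Rightarrow> 'a"
  assumes g: "comm_ring_hom g" and h: "comm_ring_hom h"
  shows "g (ev7 h A B a0 a1 a2 a3 a4 p) = ev7 (\<lambda>c. g (h c)) (g A) (g B) (g a0) (g a1) (g a2) (g a3) (g a4) p"
proof -
  have gh: "comm_ring_hom (\<lambda>c. g (h c))"
  proof -
    interpret g: comm_ring_hom g by fact
    interpret h: comm_ring_hom h by fact
    show ?thesis by unfold_locales (simp_all only: h.hom_add h.hom_mult h.hom_zero h.hom_one g.hom_add g.hom_mult g.hom_zero g.hom_one)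
  qed
  show ?thesis
    using hom_ev8[OF g h, of A B a0 a1 a2 a3 a4 0 "[:p:]"]
    unfolding ev8_ev7 ev_const[OF ev7_hom[OF h]] ev_const[OF ev7_hom[OF gh]] .
qed

lemma poly_map_ev7: "poly (map_poly (ev7 h A B a0 a1 a2 a3 a4) p) x = ev8 h A B a0 a1 a2 a3 a4 x p"
  by (simp add: ev8_ev7 ev_def)

lemma ev7_nonzero:
  fixes p :: "'l::alg_closed_field poly poly poly poly poly poly poly"
  assumes "p \<noteq> 0" shows "\<exists>A B a0 a1 a2 a3 a4. ev7 (\<lambda>x. x) A B a0 a1 a2 a3 a4 p \<noteq> 0"
proof -
  have "separating {\<lambda>x :: 'l. x}" unfolding separating_def using comm_ring_hom_id by auto
  then have "separating {ev h x | h x. h \<in> {\<lambda>x :: 'l. x}}" by (rule separating_ev)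
  note s = this[THEN separating_ev, THEN separating_ev, THEN separating_ev, THEN separating_ev, THEN separating_ev, THEN separating_ev]
  obtain g where g: "g p \<noteq> 0" "g \<in> {ev h x |h x. h \<in> {ev h x |h x. h \<in> {ev h x |h x. h \<in> {ev h x |h x. h \<in> {ev h x |h x.
      h \<in> {ev h x |h x. h \<in> {ev h x |h x. h \<in> {\<lambda>x. x}}}}}}}}"
    using s assms unfolding separating_def by meson
  from g(2) obtain A B a0 a1 a2 a3 a4 where "g = ev7 (\<lambda>x. x) A B a0 a1 a2 a3 a4"
    unfolding ev7_def by auto
  with g(1) show ?thesis by blast
qed

text \<open>
  If \<open>p\<close> did not divide \<open>q\<close>, the resultant of the two with respect to \<open>a5\<close> would be a nonzero polynomial in the
  remaining variables. At a point where neither it nor the leading coefficient of \<open>p\<close> vanishes, \<open>p\<close> has a root in \<open>a5\<close>, and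
  by hypothesis this is a common root of \<open>p\<close> and \<open>q\<close>, a contradiction.
\<close>
lemma hypersurface_nullstellensatz:
  fixes p q :: "'l::{alg_closed_field, field_gcd} poly8"
  assumes p: "prime_elem p" "degree p > 0"
    and zero: "\<And>A B a0 a1 a2 a3 a4 a5. at8 A B a0 a1 a2 a3 a4 a5 p = 0 \<Longrightarrow> at8 A B a0 a1 a2 a3 a4 a5 q = 0"
  shows "p dvd q"
proof (rule ccontr)
  assume "\<not> p dvd q"
  then have "coprime p q" using p(1) prime_elem_imp_coprime by blast
  then have "gcd p q = 1" by simp
  then have "resultant p q \<noteq> 0" by (simp add: resultant_0_gcd)
  then have "resultant p q * lead_coeff p \<noteq> 0" using p by auto
  then obtain A B a0 a1 a2 a3 a4 where w: "ev7 (\<lambda>x. x) A B a0 a1 a2 a3 a4 (resultant p q * lead_coeff p) \<noteq> 0"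
    using ev7_nonzero by blast
  define g where "g = ev7 (\<lambda>x :: 'l. x) A B a0 a1 a2 a3 a4"
  have g: "comm_ring_hom g" unfolding g_def by (rule ev7_hom[OF comm_ring_hom_id])
  interpret g: comm_ring_hom g by (rule g)
  have nz: "g (resultant p q) \<noteq> 0" "g (lead_coeff p) \<noteq> 0" using w by (auto simp: g_def[symmetric] g.hom_mult)
  have "degree (map_poly g p) = degree p" by (rule degree_map_poly) (use nz in auto)
  then obtain x where x: "poly (map_poly g p) x = 0" using p(2) alg_closed_imp_poly_has_root[of "map_poly g p"] by auto
  have "poly (map_poly g q) x = 0"
    using zero[of A B a0 a1 a2 a3 a4 x] x unfolding ev8_ev7 g_def[symmetric] ev_def by blast
  then have "resultant_sub (degree p) (degree q) (map_poly g p) (map_poly g q) = 0"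
    using x p(2) by (intro resultant_sub_common_root[of _ _ _ _ x]) (auto intro: degree_map_poly_le)
  then have "g (resultant p q) = 0" by (simp add: resultant_sub_hom[OF g] resultant_sub)
  with nz show False by simp
qed

section \<open>Special values of f2 and its leading coefficient in a5\<close>

text \<open>
  Here \<open>G\<close> is the trinomial with \<open>b = 2 a5 - t^2\<close> and \<open>d = a5^2\<close>, \<open>f3 = t^3\<close>, and
  \<open>944784 = 1296 * 729\<close>.
\<close>
lemma f2_on_line:
  fixes h :: "'k::field \<Rightarrow> 's::idom"
  assumes six: "(6 :: 'k) \<noteq> 0" and h: "comm_ring_hom h" and t: "t \<noteq> 0"
  shows "ev8 h 0 0 0 0 0 1 t x f2_poly = - 729 * x ^ 4 * (4 * x - t\<^sup>2) ^ 3"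
proof -
  interpret h: comm_ring_hom h by (rule h)
  define w where "w = ev8 h 0 0 0 0 0 1 t x f2_poly"
  have n: "(1296 :: 's) \<noteq> 0" using hom_nonzero[OF h six_factors(3)[OF six]] unfolding h.hom_numeral .
  have G: "G_form 0 0 0 0 0 1 t x = [:x\<^sup>2, 0, 0, 2 * x - t\<^sup>2, 0, 0, 1:]"
    by (simp add: G_form_def even_part_def cubic_def odd_part_def power2_eq_square algebra_simps)
  have F: "f3_form 0 0 0 0 0 1 t x = t ^ 3" by (simp add: f3_form_def)
  have "- (1296 * w * (t ^ 3)\<^sup>2) = - 944784 * (x\<^sup>2)\<^sup>2 * ((2 * x - t\<^sup>2)\<^sup>2 - 4 * x\<^sup>2) ^ 3"
    using disc6_eq_ev8_f2[OF six h, of 0 0 0 0 0 1 t x] disc6_trinomial_idom[OF six_nonzero_hom[OF h six]]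
    unfolding G F w_def by simp
  also have "(2 * x - t\<^sup>2)\<^sup>2 - 4 * x\<^sup>2 = - (t\<^sup>2 * (4 * x - t\<^sup>2))" by (simp add: power2_eq_square algebra_simps)
  also have "(- (t\<^sup>2 * (4 * x - t\<^sup>2))) ^ 3 = - ((t ^ 3)\<^sup>2 * (4 * x - t\<^sup>2) ^ 3)"
    by (simp add: power_mult_distrib power_minus_odd flip: power_mult)
  also have "(x\<^sup>2)\<^sup>2 = x ^ 4" by (simp flip: power_mult)
  finally have e0: "- (1296 * w * (t ^ 3)\<^sup>2) = - 944784 * x ^ 4 * - ((t ^ 3)\<^sup>2 * (4 * x - t\<^sup>2) ^ 3)" .
  have "(1296 * (t ^ 3)\<^sup>2) * w = - (- (1296 * w * (t ^ 3)\<^sup>2))" by (simp only: minus_minus mult_ac)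
  also have "\<dots> = (1296 * (t ^ 3)\<^sup>2) * (- 729 * x ^ 4 * (4 * x - t\<^sup>2) ^ 3)"
    unfolding e0 by (simp add: mult_ac)
  finally have eq: "(1296 * (t ^ 3)\<^sup>2) * w = (1296 * (t ^ 3)\<^sup>2) * (- 729 * x ^ 4 * (4 * x - t\<^sup>2) ^ 3)" .
  have "1296 * (t ^ 3)\<^sup>2 \<noteq> 0" using n t by simp
  from iffD1[OF mult_left_cancel[OF this] eq] show ?thesis unfolding w_def .
qed

text \<open>
  Since \<open>f3\<close> vanishes for \<open>t = 0\<close>, the value is obtained by treating \<open>t\<close> as an indeterminate and
  then setting it to 0.
\<close>
lemma f2_on_line_0:
  assumes six: "(6 :: 'k::field) \<noteq> 0"
  shows "at8 0 0 0 0 0 1 0 x (f2_poly :: 'k poly8) = - 46656 * x ^ 7"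
proof -
  have "ev8 (\<lambda>c. [:c:]) 0 0 0 0 0 1 [:0, 1:] [:x:] (f2_poly :: 'k poly8) = - 729 * [:x:] ^ 4 * (4 * [:x:] - [:0, 1:]\<^sup>2) ^ 3"
    by (rule f2_on_line[OF six comm_ring_hom_const]) simp
  then have "poly (ev8 (\<lambda>c. [:c:]) 0 0 0 0 0 1 [:0, 1:] [:x:] (f2_poly :: 'k poly8)) 0 = - 729 * x ^ 4 * (4 * x) ^ 3"
    by (simp del: mult_pCons_left mult_pCons_right)
  then show ?thesis unfolding hom_ev8[OF comm_ring_hom_poly comm_ring_hom_const] by (simp add: power_mult_distrib flip: power_add)
qed

text \<open>
  For \<open>a3 = 0\<close> the point \<open>B = a^2\<close>, \<open>a1 = a5 = 1\<close>, \<open>a2 = a\<close> and zeros elsewhere gives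
  \<open>G = 1 + 2 a x - x^5\<close>, which is separable for \<open>a = 0\<close>, or in characteristic 5 for \<open>a = 1\<close>.
\<close>
lemma a3_not_dvd_f2:
  assumes six: "(6 :: 'l::alg_closed_field) \<noteq> 0"
  shows "\<not> var_a3 dvd (f2_poly :: 'l poly8)"
proof
  assume "var_a3 dvd (f2_poly :: 'l poly8)"
  then obtain q where q: "(f2_poly :: 'l poly8) = var_a3 * q" by (auto simp: dvd_def)
  have z: "at8 A B a0 a1 a2 0 a4 a5 (f2_poly :: 'l poly8) = 0" for A B a0 a1 a2 a4 a5
  proof -
    interpret e: comm_ring_hom "at8 A B a0 a1 a2 0 a4 a5 :: 'l poly8 \<Rightarrow> 'l" by (rule ev8_hom(1)[OF comm_ring_hom_id])
    show ?thesis unfolding q e.hom_mult ev8_vars[OF comm_ring_hom_id] by simp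
  qed
  have root: "\<exists>x. poly (G_form 0 (a\<^sup>2) 0 1 a 0 0 1) x = 0 \<and> poly (pderiv (G_form 0 (a\<^sup>2) 0 1 a 0 0 (1 :: 'l))) x = 0" for a
    using disc6_eq_ev8_f2[OF six comm_ring_hom_id, of 0 "a\<^sup>2" 0 1 a 0 0 1] z
    by (simp add: disc6_eq_0_iff[OF six G_form_coeffs(1)] G_form_coeffs)
  have g: "poly (G_form 0 (a\<^sup>2) 0 1 a 0 0 1) x = 1 + 2 * a * x - x ^ 5" for a x :: 'l
    unfolding poly_G_form by (simp add: power2_eq_square power3_eq_cube numeral_eq_Suc algebra_simps)
  have g': "poly (pderiv (G_form 0 (a\<^sup>2) 0 1 a 0 0 1)) x = 2 * a - 5 * x ^ 4" for a x :: 'l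
    unfolding poly_pderiv_G_form by (simp add: power2_eq_square power3_eq_cube numeral_eq_Suc algebra_simps)
  show False
  proof (cases "(5 :: 'l) = 0")
    case True
    then show False using root[of 1] six_factors[OF six] unfolding g g' by simp
  next
    case False
    then obtain x :: 'l where "x = 0" "1 - x ^ 5 = 0" using root[of 0] unfolding g g' by auto
    then show False by simp
  qed
qed

lemma f2_nonzero:
  assumes six: "(6 :: 'l::alg_closed_field) \<noteq> 0"
  shows "(f2_poly :: 'l poly8) \<noteq> 0"
  using a3_not_dvd_f2[OF six] by auto

text \<open>
  The change of coordinates \<open>(x, y) \<mapsto> (l^2 x, l^3 y)\<close> preserves the shape of the cubic and replaces \<open>G\<close> by
  \<open>m^2 l^12 G\<close> when the quadric is rescaled by \<open>m\<close>. So \<open>f2\<close> is homogeneous of degree 12 in the coefficients of the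
  quadric and of weight 42 when \<open>A, B, a0, ..., a5\<close> have weights 4, 6, 2, 1, 4, 0, 3, 6.
\<close>
lemma f2_scaling:
  fixes A :: "'l::field"
  assumes six: "(6 :: 'l) \<noteq> 0" and nz: "l \<noteq> 0" "m \<noteq> 0" "a3 \<noteq> 0" "f3_form A B a0 a1 a2 a3 a4 a5 \<noteq> 0"
  shows "at8 (l^4 * A) (l^6 * B) (m * l^2 * a0) (m * l * a1) (m * l^4 * a2) (m * a3) (m * l^3 * a4) (m * l^6 * a5) f2_poly
    = m ^ 12 * l ^ 42 * at8 A B a0 a1 a2 a3 a4 a5 f2_poly"
proof -
  define H where "H = G_form (l^4 * A) (l^6 * B) (m * l^2 * a0) (m * l * a1) (m * l^4 * a2) (m * a3) (m * l^3 * a4) (m * l^6 * a5)"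
  define f where "f = at8 A B a0 a1 a2 a3 a4 a5 f2_poly"
  define f' where "f' = at8 (l^4 * A) (l^6 * B) (m * l^2 * a0) (m * l * a1) (m * l^4 * a2) (m * a3) (m * l^3 * a4) (m * l^6 * a5) f2_poly"
  define t where "t = f3_form A B a0 a1 a2 a3 a4 a5"
  have c: "cubic (l^4 * A) (l^6 * B) \<circ>\<^sub>p [:0, l^2:] = smult (l^6) (cubic A B)"
    by (simp add: cubic_def pcompose_pCons power2_eq_square numeral_eq_Suc algebra_simps)
  have ll: "odd_part (m * l * a1) (m * l^3 * a4) \<circ>\<^sub>p [:0, l^2:] = smult (m * l^3) (odd_part a1 a4)"
    by (simp add: odd_part_def pcompose_pCons power2_eq_square power3_eq_cube algebra_simps)
  have q: "[:m * l^6 * a5, m * l^4 * a2, m * l^2 * a0:] \<circ>\<^sub>p [:0, l^2:] = smult (m * l^6) [:a5, a2, a0:]"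
    by (simp add: pcompose_pCons power2_eq_square numeral_eq_Suc algebra_simps)
  have u: "even_part (l^4 * A) (l^6 * B) (m * l^2 * a0) (m * l^4 * a2) (m * a3) (m * l^6 * a5) \<circ>\<^sub>p [:0, l^2:]
      = smult (m * l^6) (even_part A B a0 a2 a3 a5)"
    unfolding even_part_def pcompose_add pcompose_smult c q by (simp add: smult_add_right mult_ac)
  have "H \<circ>\<^sub>p [:0, l^2:] = (smult (m * l^6) (even_part A B a0 a2 a3 a5))\<^sup>2
      - (smult (m * l^3) (odd_part a1 a4))\<^sup>2 * smult (l^6) (cubic A B)"
    unfolding H_def G_form_def pcompose_diff pcompose_mult power2_eq_square[of "_ :: 'l poly"] c ll u ..
  also have "\<dots> = smult (m^2 * l^12) (G_form A B a0 a1 a2 a3 a4 a5)"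
    by (simp add: G_form_def smult_diff_right power2_eq_square numeral_eq_Suc mult_ac)
  finally have H: "H \<circ>\<^sub>p [:0, l^2:] = smult (m^2 * l^12) (G_form A B a0 a1 a2 a3 a4 a5)" .
  have dH: "degree H = 6" unfolding H_def by (rule G_form_degree) (use nz in simp)
  have "(m^2 * l^12) ^ 10 * disc6 (G_form A B a0 a1 a2 a3 a4 a5) = (l^2) ^ 30 * disc6 H"
    using disc6_affine_idom[OF six dH, of "l^2" 0] nz by (simp only: H disc6_smult) simp
  also have "disc6 H = - (1296 * f' * (m^4 * l^9 * t)\<^sup>2)"
  proof -
    have "f3_form (l^4 * A) (l^6 * B) (m * l^2 * a0) (m * l * a1) (m * l^4 * a2) (m * a3) (m * l^3 * a4) (m * l^6 * a5) = m^4 * l^9 * t"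
      by (simp add: f3_form_def t_def power2_eq_square numeral_eq_Suc algebra_simps)
    then show ?thesis unfolding H_def disc6_eq_ev8_f2[OF six comm_ring_hom_id] f'_def by simp
  qed
  also have "disc6 (G_form A B a0 a1 a2 a3 a4 a5) = - (1296 * f * t\<^sup>2)"
    unfolding disc6_eq_ev8_f2[OF six comm_ring_hom_id] f_def t_def ..
  finally have e: "(m^2 * l^12) ^ 10 * - (1296 * f * t\<^sup>2) = (l^2) ^ 30 * - (1296 * f' * (m^4 * l^9 * t)\<^sup>2)" .
  have "(1296 * t\<^sup>2 * m^8 * l^78) * f' = - ((l^2) ^ 30 * - (1296 * f' * (m^4 * l^9 * t)\<^sup>2))"
    by (simp add: power_mult_distrib mult_ac flip: power_mult power_add)
  also have "\<dots> = (1296 * t\<^sup>2 * m^8 * l^78) * (m^12 * l^42 * f)"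
    unfolding e[symmetric] by (simp add: power_mult_distrib mult_ac flip: power_mult power_add)
  finally have e2: "(1296 * t\<^sup>2 * m^8 * l^78) * f' = (1296 * t\<^sup>2 * m^8 * l^78) * (m^12 * l^42 * f)" .
  have "1296 * t\<^sup>2 * m^8 * l^78 \<noteq> 0" using nz six_factors[OF six] by (simp add: t_def)
  from iffD1[OF mult_left_cancel[OF this] e2] show ?thesis unfolding f_def f'_def .
qed

lemma f3_form_linear:
  "f3_form A B a0 a1 a2 a3 a4 x = poly [:A * a1^2 * a3 * a4 - B * a1^3 * a3 - a0 * a1 * a4^2 + a1^2 * a2 * a4 + a3 * a4^3, - (a1^3):] x"
  by (simp add: f3_form_def algebra_simps)

text \<open>
  Since \<open>a5^7\<close> has degree 7 and weight 42, its coefficient in \<open>f2\<close> has degree 5 and weight 0. As an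
  identity of polynomials in \<open>a5\<close> the scaling law only needs to be checked outside the zeros of \<open>f3\<close>.
\<close>
lemma f2_coeff7_scaling:
  fixes A :: "'l::alg_closed_field"
  assumes six: "(6 :: 'l) \<noteq> 0" and nz: "l \<noteq> 0" "m \<noteq> 0" "a1 \<noteq> 0" "a3 \<noteq> 0"
  shows "ev7 (\<lambda>x. x) (l^4 * A) (l^6 * B) (m * l^2 * a0) (m * l * a1) (m * l^4 * a2) (m * a3) (m * l^3 * a4) (coeff f2_poly 7)
    = m ^ 5 * ev7 (\<lambda>x. x) A B a0 a1 a2 a3 a4 (coeff f2_poly 7)"
proof -
  define g where "g = ev7 (\<lambda>x :: 'l. x) A B a0 a1 a2 a3 a4"
  define g' where "g' = ev7 (\<lambda>x :: 'l. x) (l^4 * A) (l^6 * B) (m * l^2 * a0) (m * l * a1) (m * l^4 * a2) (m * a3) (m * l^3 * a4)"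
  define P where "P = map_poly g f2_poly"
  define P' where "P' = map_poly g' f2_poly"
  have g0: "g 0 = 0" "g' 0 = 0"
    using comm_ring_hom_zero[OF ev7_hom[OF comm_ring_hom_id]] by (simp_all add: g_def g'_def)
  define t where "t = [:A * a1^2 * a3 * a4 - B * a1^3 * a3 - a0 * a1 * a4^2 + a1^2 * a2 * a4 + a3 * a4^3, - (a1^3):]"
  have "(P' \<circ>\<^sub>p [:0, m * l^6:] - smult (m ^ 12 * l ^ 42) P) * t = 0"
  proof (rule poly_all_zero)
    fix x
    show "poly ((P' \<circ>\<^sub>p [:0, m * l^6:] - smult (m ^ 12 * l ^ 42) P) * t) x = 0"
    proof (cases "poly t x = 0")
      case False
      then have "f3_form A B a0 a1 a2 a3 a4 x \<noteq> 0" by (simp only: f3_form_linear t_def not_False_eq_True)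
      from f2_scaling[OF six nz(1,2,4) this]
      have "poly P' (m * l^6 * x) = m ^ 12 * l ^ 42 * poly P x"
        unfolding P'_def P_def g_def g'_def poly_map_ev7 .
      then show ?thesis by (simp add: poly_pcompose mult.commute)
    qed simp
  qed
  moreover have "t \<noteq> 0" using nz by (simp add: t_def)
  ultimately have "P' \<circ>\<^sub>p [:0, m * l^6:] = smult (m ^ 12 * l ^ 42) P" by simp
  then have "coeff (P' \<circ>\<^sub>p [:0, m * l^6:]) 7 = m ^ 12 * l ^ 42 * coeff P 7" by simp
  moreover have "coeff (P' \<circ>\<^sub>p [:0, m * l^6:]) 7 = (m * l^6) ^ 7 * coeff P' 7"
    by (simp add: coeff_pcompose_linear)
  ultimately have "(m ^ 7 * l ^ 42) * coeff P' 7 = (m ^ 7 * l ^ 42) * (m ^ 5 * coeff P 7)"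
    by (simp add: power_mult_distrib mult_ac flip: power_mult power_add)
  then have "coeff P' 7 = m ^ 5 * coeff P 7" using nz by simp
  then show ?thesis unfolding P_def P'_def by (simp add: coeff_map_poly g0) (simp add: g_def g'_def)
qed

lemma f2_coeff7_base_point:
  assumes six: "(6 :: 'l::alg_closed_field) \<noteq> 0"
  shows "ev7 (\<lambda>x :: 'l. x) 0 0 0 0 0 1 0 (coeff f2_poly 7) = - 46656"
proof -
  define g where "g = ev7 (\<lambda>x :: 'l. x) 0 0 0 0 0 1 0"
  interpret g: comm_ring_hom g unfolding g_def by (rule ev7_hom[OF comm_ring_hom_id])
  have "map_poly g f2_poly - monom (- 46656) 7 = 0"
  proof (rule poly_all_zero)
    fix x show "poly (map_poly g f2_poly - monom (- 46656) 7) x = 0"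
      using f2_on_line_0[OF six, of x] unfolding g_def by (simp add: poly_map_ev7 poly_monom)
  qed
  then have "coeff (map_poly g f2_poly) 7 = - 46656" by simp
  then show ?thesis by (simp add: g_def[symmetric])
qed

text \<open>
  Weight 0 makes the coefficient independent of everything but \<open>a3\<close>: scale \<open>a3\<close> to 1 with
  \<open>m = 1 / a3\<close> and let \<open>l\<close> tend to 0, that is, set \<open>l = 0\<close> in a polynomial that is constant for \<open>l \<noteq> 0\<close>.
\<close>
lemma f2_coeff7_eval:
  fixes A :: "'l::alg_closed_field"
  assumes six: "(6 :: 'l) \<noteq> 0" and nz: "a1 \<noteq> 0" "a3 \<noteq> 0"
  shows "ev7 (\<lambda>x. x) A B a0 a1 a2 a3 a4 (coeff f2_poly 7) = - 46656 * a3 ^ 5"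
proof -
  define m where "m = inverse a3"
  have m: "m \<noteq> 0" "m * a3 = 1" using nz by (simp_all add: m_def)
  define T :: "'l poly" where "T = [:0, 1:]"
  define q where "q = ev7 (\<lambda>c. [:c:]) (T^4 * [:A:]) (T^6 * [:B:]) ([:m:] * T^2 * [:a0:]) ([:m:] * T * [:a1:]) ([:m:] * T^4 * [:a2:]) ([:m:] * [:a3:]) ([:m:] * T^3 * [:a4:]) (coeff f2_poly 7)"
  define k where "k = m ^ 5 * ev7 (\<lambda>x. x) A B a0 a1 a2 a3 a4 (coeff f2_poly 7)"
  have q: "poly q l = ev7 (\<lambda>x. x) (l^4 * A) (l^6 * B) (m * l^2 * a0) (m * l * a1) (m * l^4 * a2) (m * a3) (m * l^3 * a4) (coeff f2_poly 7)" for l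
    unfolding q_def hom_ev7[OF comm_ring_hom_poly comm_ring_hom_const] T_def poly_mult poly_power
    by simp
  have "(q - [:k:]) * T = 0"
  proof (rule poly_all_zero)
    fix l
    show "poly ((q - [:k:]) * T) l = 0"
    proof (cases "l = 0")
      case False
      have "poly q l = k" unfolding q k_def by (rule f2_coeff7_scaling[OF six False m(1) nz])
      then show ?thesis by simp
    qed (simp add: T_def)
  qed
  then have "q = [:k:]" by (simp add: T_def)
  then have "poly q 0 = k" by simp
  moreover have "poly q 0 = - 46656" unfolding q by (simp add: m f2_coeff7_base_point[OF six])
  ultimately have k: "k = - 46656" by simp
  have "ev7 (\<lambda>x. x) A B a0 a1 a2 a3 a4 (coeff f2_poly 7) = (m * a3) ^ 5 * ev7 (\<lambda>x. x) A B a0 a1 a2 a3 a4 (coeff f2_poly 7)"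
    by (simp add: m)
  also have "\<dots> = k * a3 ^ 5" by (simp add: k_def power_mult_distrib)
  finally show ?thesis by (simp add: k)
qed

text \<open>Agreement of values outside \<open>a1 a3 = 0\<close> gives the identity of polynomials after multiplication by \<open>a1 a3\<close>.\<close>
lemma f2_coeff7:
  assumes six: "(6 :: 'l::alg_closed_field) \<noteq> 0"
  shows "[:coeff (f2_poly :: 'l poly8) 7:] = - 46656 * var_a3 ^ 5"
proof -
  obtain c where c: "(46656 :: 'l poly8) = [:c:]" by (metis numeral_poly)
  obtain v1 where v1: "(var_a1 :: 'l poly8) = [:v1:]" by (simp add: var_a1_def)
  obtain v3 where v3: "(var_a3 :: 'l poly8) = [:v3:]" by (simp add: var_a3_def)
  define d where "d = (coeff (f2_poly :: 'l poly8) 7 + c * v3 ^ 5) * v1 * v3"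
  have "d = 0"
  proof (rule ccontr)
    assume "d \<noteq> 0"
    then obtain A B a0 a1 a2 a3 a4 where nz: "ev7 (\<lambda>x. x) A B a0 a1 a2 a3 a4 d \<noteq> 0"
      using ev7_nonzero by blast
    define g where "g = ev7 (\<lambda>x :: 'l. x) A B a0 a1 a2 a3 a4"
    have g: "comm_ring_hom g" unfolding g_def by (rule ev7_hom[OF comm_ring_hom_id])
    interpret g: comm_ring_hom g by (rule g)
    interpret e: comm_ring_hom "at8 A B a0 a1 a2 a3 a4 0 :: 'l poly8 \<Rightarrow> 'l" by (rule ev8_hom(1)[OF comm_ring_hom_id])
    have e: "g p = at8 A B a0 a1 a2 a3 a4 0 [:p:]" for p unfolding ev8_ev7 g_def[symmetric] ev_const[OF g] ..
    have s: "g v1 = a1" "g v3 = a3" "g c = 46656"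
      unfolding e c[symmetric] v1[symmetric] v3[symmetric] ev8_vars[OF comm_ring_hom_id] by (rule refl, rule refl, rule e.hom_numeral)
    have gd: "g d = (g (coeff f2_poly 7) + 46656 * a3 ^ 5) * a1 * a3"
      unfolding d_def g.hom_mult g.hom_add g.hom_power s ..
    have gc: "g (coeff f2_poly 7) = - 46656 * a3 ^ 5" if "a1 \<noteq> 0" "a3 \<noteq> 0"
      unfolding g_def by (rule f2_coeff7_eval[OF six that])
    have "g d = 0"
      by (cases "a1 = 0 \<or> a3 = 0") (use gd gc in auto)
    with nz show False by (simp add: g_def)
  qed
  moreover have "v1 \<noteq> 0" "v3 \<noteq> 0" using v1 v3 var_nonzero(4,6) by (metis pCons_0_0)+
  ultimately have "coeff (f2_poly :: 'l poly8) 7 = - (c * v3 ^ 5)" by (simp add: d_def eq_neg_iff_add_eq_0)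
  then have "[:coeff (f2_poly :: 'l poly8) 7:] = - ([:c:] * [:v3:] ^ 5)"
    by (simp add: poly_const_pow)
  then show ?thesis by (simp only: c v3 mult_minus_left)
qed

section \<open>Irreducibility over an algebraically closed field\<close>

lemma prime_elem_dvd_nonunit_divisor:
  fixes p q :: "'r::{idom_divide, algebraic_semidom}"
  assumes "prime_elem p" "q dvd p" "\<not> is_unit q" shows "p dvd q"
  using irreducibleD'[OF prime_elem_imp_irreducible[OF assms(1)] assms(2)] assms(3) by simp

text \<open>
  \<open>f3\<close> is linear in \<open>a5\<close> with leading coefficient \<open>- a1^3\<close>, and the prime \<open>a1\<close> does not
  divide it; hence it is primitive and irreducible.
\<close>
lemma generic_f3_dvd_of_factor:
  fixes h :: "'l::{alg_closed_field, field_gcd} poly8"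
  assumes "h dvd generic_f3" "degree h > 0" shows "generic_f3 dvd h"
proof -
  obtain q where q: "generic_f3 = h * q" using assms by (auto simp: dvd_def)
  obtain v1 b where v1: "(var_a1 :: 'l poly8) = [:v1:]" and v: "(generic_f3 :: 'l poly8) = [:b, - (v1 ^ 3):]"
    by (simp add: f3_form_def var_A_def var_B_def var_a0_def var_a1_def var_a2_def var_a3_def var_a4_def var_a5_def
        power2_eq_square power3_eq_cube)
  have h0: "h \<noteq> 0" "q \<noteq> 0" using q generic_f3_nonzero by auto
  have "degree h + degree q = degree (generic_f3 :: 'l poly8)" using q h0 by (simp add: degree_mult_eq)
  also have "\<dots> \<le> 1" unfolding v by simp
  finally have "degree q = 0" using assms(2) by simp
  then obtain c where c: "q = [:c:]" by (rule degree_eq_zeroE)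
  \<comment> \<open>the cofactor is free of \<open>a5\<close>; a prime factor of it divides the leading coefficient and is thus \<open>a1\<close>\<close>
  have "is_unit c"
  proof (rule ccontr)
    assume "\<not> is_unit c"
    moreover have "c \<noteq> 0" using c h0 by auto
    ultimately obtain p where p: "p dvd c" "prime p" using prime_divisor_exists by blast
    have cF: "[:c:] dvd generic_f3" unfolding q c by (rule dvd_triv_right)
    then have "c dvd coeff [:b, - (v1 ^ 3):] 1" unfolding v const_poly_dvd_iff by blast
    then have "c dvd v1 ^ 3" by simp
    with p(1) have "p dvd v1 ^ 3" by (rule dvd_trans)
    then have "p dvd v1" by (rule prime_dvd_power[OF p(2)])
    moreover have "prime_elem v1" using prime_var_a1[where 'k = 'l] unfolding v1 by (simp add: prime_elem_const_poly_iff)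
    ultimately have "v1 dvd p"
      using prime_elem_dvd_nonunit_divisor[of v1 p] prime_elem_not_unit[OF prime_imp_prime_elem[OF p(2)]] by simp
    then have "v1 dvd c" using p(1) by (rule dvd_trans)
    then have "[:v1:] dvd [:c:]" by (simp add: const_poly_dvd_const_poly_iff)
    then have "[:v1:] dvd generic_f3" using cF by (rule dvd_trans)
    then have "var_a1 dvd (generic_f3 :: 'l poly8)" by (simp only: v1[symmetric])
    then show False using a1_not_dvd_generic_f3 by contradiction
  qed
  then have "is_unit q" by (simp add: c const_poly_dvd_1)
  then show ?thesis unfolding q by (simp add: mult_unit_dvd_iff)
qed

text \<open>At \<open>a3 = a5 = 1\<close> and zeros elsewhere \<open>f3 = 0\<close> but \<open>f2 = - 46656\<close>.\<close>
lemma generic_f3_not_dvd_f2: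
  assumes six: "(6 :: 'l::alg_closed_field) \<noteq> 0"
  shows "\<not> generic_f3 dvd (f2_poly :: 'l poly8)"
proof
  assume "generic_f3 dvd (f2_poly :: 'l poly8)"
  then obtain q where q: "(f2_poly :: 'l poly8) = generic_f3 * q" by (auto simp: dvd_def)
  interpret e: comm_ring_hom "at8 0 0 0 0 0 1 0 1 :: 'l poly8 \<Rightarrow> 'l" by (rule ev8_hom(1)[OF comm_ring_hom_id])
  have "at8 0 0 0 0 0 1 0 1 (f2_poly :: 'l poly8) = 0"
    unfolding q e.hom_mult ev8_generic_f3[OF comm_ring_hom_id] by (simp add: f3_form_def)
  then have "(46656 :: 'l) = 0" using f2_on_line_0[OF six, of 1] by simp
  moreover have "46656 = (6 :: 'l) ^ 6" by simp
  ultimately show False using six by (metis power_eq_0_iff)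
qed

text \<open>A prime factor free of \<open>a5\<close> would divide the coefficient \<open>- 46656 a3^5\<close>, hence be \<open>a3\<close>.\<close>
lemma prime_factor_f2_degree:
  fixes h :: "'l::{alg_closed_field, field_gcd} poly8"
  assumes six: "(6 :: 'l) \<noteq> 0" and h: "prime_elem h" "h dvd f2_poly"
  shows "degree h > 0"
proof (rule ccontr)
  assume "\<not> degree h > 0"
  then obtain h0 where h0: "h = [:h0:]" by (auto elim: degree_eq_zeroE)
  then have "h0 dvd coeff f2_poly 7" using h(2) by (simp add: const_poly_dvd_iff)
  then have "h dvd [:coeff f2_poly 7:]" by (simp add: h0 const_poly_dvd_const_poly_iff)
  then have "h dvd 46656 * var_a3 ^ 5" unfolding f2_coeff7[OF six] by simp
  moreover have "\<not> h dvd 46656"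
  proof
    assume "h dvd 46656"
    have "46656 = (6 :: 'l) ^ 6" by simp
    then have "(46656 :: 'l) \<noteq> 0" using six by (metis power_eq_0_iff)
    then have "is_unit (46656 :: 'l poly8)" by (rule numeral_unit)
    then have "is_unit h" by (rule dvd_trans[OF \<open>h dvd 46656\<close>])
    then show False using prime_elem_not_unit[OF h(1)] by contradiction
  qed
  ultimately have "h dvd var_a3 ^ 5" using prime_elem_dvd_multD[OF h(1)] by auto
  then have "h dvd var_a3" by (rule prime_elem_dvd_power[OF h(1)])
  then have "var_a3 dvd h"
    by (rule prime_elem_dvd_nonunit_divisor[OF prime_var_a3 _ prime_elem_not_unit[OF h(1)]])
  then have "var_a3 dvd (f2_poly :: 'l poly8)" using h(2) by (rule dvd_trans)
  then show False using a3_not_dvd_f2[OF six] by blast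
qed

text \<open>Restriction to the tangency locus is a homomorphism into an integral domain that kills \<open>f2\<close>.\<close>
lemma prime_factor_f2_restrict:
  assumes six: "(6 :: 'l::{alg_closed_field, field_gcd}) \<noteq> 0"
  shows "\<exists>g. prime_elem g \<and> g dvd (f2_poly :: 'l poly8) \<and> restrict_tangency g = (0 :: 'l poly8)"
proof -
  let ?f = "f2_poly :: 'l poly8"
  have f0: "?f \<noteq> 0" by (rule f2_nonzero[OF six])
  define phi where "phi = (restrict_tangency :: 'l poly8 \<Rightarrow> 'l poly8)"
  have hom: "comm_ring_hom phi" unfolding phi_def on_tangency_def by (rule ev8_hom(1)[OF comm_ring_hom_const8])
  interpret phi: comm_ring_hom phi by (rule hom)
  have "normalize (prod_mset (prime_factorization ?f)) = normalize ?f"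
    by (rule prod_mset_prime_factorization_weak[OF f0])
  then have "?f dvd prod_mset (prime_factorization ?f)" by (rule associatedD2)
  then obtain q where q: "prod_mset (prime_factorization ?f) = ?f * q" by (rule dvdE)
  have pf: "phi ?f = 0" unfolding phi_def by (rule restrict_tangency_f2[OF six])
  have p0: "phi (prod_mset (prime_factorization ?f)) = 0" unfolding q phi.hom_mult pf by simp
  have pm: "phi (prod_mset M) = (\<Prod>x\<in>#M. phi x)" for M :: "'l poly8 multiset"
    by (induction M) (simp_all only: image_mset_empty prod_mset_empty phi.hom_one image_mset_add_mset prod_mset.add_mset phi.hom_mult)
  obtain g where g: "g \<in># prime_factorization ?f" "phi g = 0"
    using p0 unfolding pm prod_mset_zero_iff set_image_mset by (auto simp only: image_iff)
  have "prime g" "g dvd ?f"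
    using g(1) by (rule in_prime_factors_imp_prime, rule in_prime_factors_imp_dvd)
  then show ?thesis using g(2) unfolding phi_def by (intro exI[of _ g] conjI prime_imp_prime_elem)
qed

text \<open>
  Where \<open>h = 0\<close> and \<open>f1 f3 \<noteq> 0\<close>, there is a tangency at a smooth point of the cubic, which is in the
  image of the parametrisation, so \<open>g = 0\<close> there. Hence \<open>h\<close> divides \<open>f1 f3 g\<close>; but \<open>h\<close> involves \<open>a5\<close>, unlike \<open>f1\<close>, and
  \<open>f3\<close> does not divide \<open>f2\<close>.
\<close>
lemma prime_factor_f2_dvd:
  fixes h g :: "'l::{alg_closed_field, field_gcd} poly8"
  assumes six: "(6 :: 'l) \<noteq> 0" and h: "prime_elem h" "h dvd f2_poly" and g: "restrict_tangency g = 0"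
  shows "h dvd g"
proof -
  define f1 where "f1 = (4 * var_A^3 + 27 * var_B^2 :: 'l poly8)"
  note dh = prime_factor_f2_degree[OF six h]
  have "h dvd g * (generic_f3 * f1)"
  proof (rule hypersurface_nullstellensatz[OF h(1) dh])
    fix A B a0 a1 a2 a3 a4 a5
    interpret e: comm_ring_hom "at8 A B a0 a1 a2 a3 a4 a5 :: 'l poly8 \<Rightarrow> 'l" by (rule ev8_hom(1)[OF comm_ring_hom_id])
    assume h0: "at8 A B a0 a1 a2 a3 a4 a5 h = 0"
    obtain q where q: "f2_poly = h * q" using h(2) by (rule dvdE)
    have f2: "at8 A B a0 a1 a2 a3 a4 a5 (f2_poly :: 'l poly8) = 0" unfolding q e.hom_mult h0 by simp
    have "at8 A B a0 a1 a2 a3 a4 a5 g = 0"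
      if F: "f3_form A B a0 a1 a2 a3 a4 a5 \<noteq> 0" and f1: "4 * A^3 + 27 * B^2 \<noteq> 0"
    proof -
      \<comment> \<open>the point lies on the parametrised locus, where \<open>g\<close> vanishes\<close>
      obtain s t where st: "tangent A B a0 a1 a2 a3 a4 a5 s t" using f2_zero_imp_tangent[OF six f2 F] by blast
      then have "3 * s^2 + A \<noteq> 0 \<or> 2 * t \<noteq> 0" by (intro smooth_of_f1[OF six f1]) (simp add: tangent_def)
      then obtain m where m: "at8 A B a0 a1 a2 a3 a4 a5 = on_tangency at8 A s t a0 a1 a3 m"
        using tangent_imp_on_tangency[OF st, where 'b = "'l poly8 \<Rightarrow> 'l"] by metis
      interpret p: comm_ring_hom "at8 A s a0 a1 t a3 m 0 :: 'l poly8 \<Rightarrow> 'l" by (rule ev8_hom(1)[OF comm_ring_hom_id])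
      show ?thesis unfolding m by (simp add: g flip: at8_restrict_tangency[where ?a5.0 = 0])
    qed
    moreover have "at8 A B a0 a1 a2 a3 a4 a5 f1 = 4 * A^3 + 27 * B^2"
      unfolding f1_def e.hom_add e.hom_mult e.hom_power e.hom_numeral ev8_vars[OF comm_ring_hom_id] ..
    ultimately show "at8 A B a0 a1 a2 a3 a4 a5 (g * (generic_f3 * f1)) = 0"
      unfolding e.hom_mult ev8_generic_f3[OF comm_ring_hom_id] by auto
  qed
  moreover have "\<not> h dvd generic_f3"
  proof
    assume "h dvd generic_f3"
    then have "generic_f3 dvd h" by (rule generic_f3_dvd_of_factor[OF _ dh])
    then have "generic_f3 dvd (f2_poly :: 'l poly8)" using h(2) by (rule dvd_trans)
    then show False using generic_f3_not_dvd_f2[OF six] by contradiction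
  qed
  moreover have "\<not> h dvd f1"
  proof
    assume "h dvd f1"
    have "degree f1 = 0"
      by (simp add: f1_def var_A_def var_B_def power2_eq_square power3_eq_cube numeral_poly)
    moreover have "f1 \<noteq> 0"
    proof
      assume f10: "f1 = 0"
      interpret e: comm_ring_hom "at8 1 0 0 0 0 0 0 0 :: 'l poly8 \<Rightarrow> 'l" by (rule ev8_hom(1)[OF comm_ring_hom_id])
      have "at8 1 0 0 0 0 0 0 0 f1 = (2 :: 'l) ^ 2"
        unfolding f1_def e.hom_add e.hom_mult e.hom_power e.hom_numeral ev8_vars[OF comm_ring_hom_id] by simp
      then have "(2 :: 'l) ^ 2 = 0" unfolding f10 e.hom_zero by (rule sym)
      then show False using six_factors(1)[OF six] by (simp only: power_eq_0_iff) simp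
    qed
    ultimately show False using \<open>h dvd f1\<close> dh dvd_imp_degree_le[of h f1] by auto
  qed
  ultimately show ?thesis using prime_elem_dvd_multD[OF h(1)] by metis
qed

lemma order_power: "p \<noteq> 0 \<Longrightarrow> order a (p ^ k) = k * order a (p :: 'a::idom poly)"
  by (induction k) (auto simp: order_mult)

text \<open>On this line \<open>f2 = - 729 a5^4 (4 a5 - 1)^3\<close>.\<close>
lemma f2_line_orders:
  assumes six: "(6 :: 'l::alg_closed_field) \<noteq> 0"
  defines "f \<equiv> ev8 (\<lambda>c. [:c:]) 0 0 0 0 0 1 1 [:0, 1:] (f2_poly :: 'l poly8)"
  shows "f \<noteq> 0" "order 0 f = 4" "order (1 / 4) f = 3"
proof -
  have four: "(4 :: 'l) \<noteq> 0"
  proof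
    assume "(4 :: 'l) = 0"
    then have "(2 :: 'l) ^ 2 = 0" by simp
    then show False using six_factors(1)[OF six] by (simp only: power_eq_0_iff) simp
  qed
  have c: "(729 :: 'l) \<noteq> 0"
  proof
    assume "(729 :: 'l) = 0"
    then have "(3 :: 'l) ^ 6 = 0" by simp
    then show False using six_factors(2)[OF six] by (simp only: power_eq_0_iff) simp
  qed
  define s where "s = smult (- 729 * 64) ([:- 0, 1:] ^ 4 * [:- (1 / 4), 1 :: 'l:] ^ 3)"
  have sm: "- 729 * p * smult 4 q ^ 3 = smult (- 729 * 64) (p * q ^ 3)" for p q :: "'l poly"
    by (simp add: numeral_poly power3_eq_cube)
  have "f = - 729 * [:0, 1:] ^ 4 * (4 * [:0, 1:] - 1\<^sup>2) ^ 3"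
    unfolding f_def by (rule f2_on_line[OF six comm_ring_hom_const]) simp
  also have "4 * [:0, 1:] - 1\<^sup>2 = smult 4 [:- (1 / 4), 1 :: 'l:]"
    using four by (intro poly_eqI) (simp add: numeral_poly coeff_pCons split: nat.split)
  also have "- 729 * [:0, 1:] ^ 4 * smult 4 [:- (1 / 4), 1 :: 'l:] ^ 3 = s"
    unfolding s_def minus_zero by (rule sm)
  finally have sf: "f = s" .
  have c64: "- 729 * 64 \<noteq> (0 :: 'l)"
  proof
    assume "- 729 * 64 = (0 :: 'l)"
    moreover have "64 = (4 :: 'l) ^ 3" by simp
    ultimately show False using c four by (metis mult_eq_0_iff neg_equal_0_iff_equal power_eq_0_iff)
  qed
  have "[:- 0, 1 :: 'l:] ^ 4 \<noteq> 0" "[:- (1 / 4), 1 :: 'l:] ^ 3 \<noteq> 0" by (simp_all only: power_eq_0_iff) simp_all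
  then have nz: "[:- 0, 1 :: 'l:] ^ 4 * [:- (1 / 4), 1 :: 'l:] ^ 3 \<noteq> 0" by (simp only: mult_eq_0_iff simp_thms)
  have "poly ([:- (1 / 4), 1 :: 'l:] ^ 3) 0 \<noteq> 0" using four by (simp only: poly_power power_eq_0_iff) simp
  then have "order 0 ([:- (1 / 4), 1 :: 'l:] ^ 3) = 0" by (rule order_0I)
  then have o0: "order 0 s = 4" unfolding s_def order_smult[OF c64] order_mult[OF nz] order_power_n_n by simp
  have "poly ([:- 0, 1 :: 'l:] ^ 4) (1 / 4) \<noteq> 0" using four by (simp only: poly_power power_eq_0_iff) simp
  then have "order (1 / 4) ([:- 0, 1 :: 'l:] ^ 4) = 0" by (rule order_0I)
  then have o1: "order (1 / 4) s = 3" unfolding s_def order_smult[OF c64] order_mult[OF nz] order_power_n_n by simp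
  have s0: "s \<noteq> 0" unfolding s_def smult_eq_0_iff using c64 nz by blast
  show "f \<noteq> 0" "order 0 f = 4" "order (1 / 4) f = 3" unfolding sf by (fact s0, fact o0, fact o1)
qed

text \<open>
  All prime factors are associated to one prime \<open>g\<close>, whose multiplicity divides the orders 4 and 3
  on the special line.
\<close>
lemma irreducible_f2_alg_closed:
  assumes six: "(6 :: 'l::{alg_closed_field, field_gcd}) \<noteq> 0"
  shows "irreducible (f2_poly :: 'l poly8)"
proof -
  let ?f = "f2_poly :: 'l poly8"
  have f0: "?f \<noteq> 0" by (rule f2_nonzero[OF six])
  obtain g where g: "prime_elem g" "g dvd ?f" "restrict_tangency g = (0 :: 'l poly8)"
    using prime_factor_f2_restrict[OF six] by blast
  have gnu: "\<not> is_unit g" by (rule prime_elem_not_unit[OF g(1)])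
  define k where "k = multiplicity g ?f"
  obtain r where r: "?f = g ^ k * r" "\<not> g dvd r"
    using multiplicity_decompose'[OF f0 gnu] unfolding k_def by blast
  have r0: "r \<noteq> 0" using r f0 by auto
  \<comment> \<open>the cofactor has no prime factor, since this would be associated to \<open>g\<close>\<close>
  have ru: "is_unit r"
  proof (rule ccontr)
    assume "\<not> is_unit r"
    then obtain h where h: "h dvd r" "prime h" using prime_divisor_exists r0 by blast
    then have "h dvd ?f" unfolding r(1) by (intro dvd_mult)
    then have "h dvd g" by (rule prime_factor_f2_dvd[OF six prime_imp_prime_elem[OF h(2)] _ g(3)])
    then have "g dvd h"
      by (rule prime_elem_dvd_nonunit_divisor[OF g(1) _ prime_elem_not_unit[OF prime_imp_prime_elem[OF h(2)]]])
    then have "g dvd r" using h(1) by (rule dvd_trans)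
    then show False using r(2) by contradiction
  qed
  have "k = 1"
  proof -
    define sg where "sg = (ev8 (\<lambda>c. [:c:]) 0 0 0 0 0 1 1 [:0, 1:] :: 'l poly8 \<Rightarrow> 'l poly)"
    have hom: "comm_ring_hom sg" unfolding sg_def by (rule ev8_hom(1)[OF comm_ring_hom_const])
    interpret sg: comm_ring_hom sg by (rule hom)
    note line = f2_line_orders[OF six, folded sg_def]
    obtain v where v: "r * v = 1" using ru by (auto simp: dvd_def)
    have sv: "sg r * sg v = 1" unfolding sg.hom_mult[symmetric] v by (rule sg.hom_one)
    have ur: "order a (sg r) = 0" for a
    proof -
      have "order a (sg r * sg v) = order a (sg r) + order a (sg v)" by (rule order_mult) (simp only: sv one_neq_zero not_False_eq_True)
      moreover have "order a (1 :: 'l poly) = 0" by (rule order_0I) simp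
      ultimately show ?thesis unfolding sv by simp
    qed
    have se: "sg ?f = sg g ^ k * sg r" by (subst r(1)) (simp add: sg.hom_mult sg.hom_power)
    have prod0: "sg g ^ k * sg r \<noteq> 0" using line(1) se by simp
    then have sg0: "sg g ^ k \<noteq> 0" by auto
    have o2: "order a (sg ?f) = order a (sg g ^ k)" for a
      unfolding se order_mult[OF prod0] ur by simp
    have "k \<noteq> 0"
    proof
      assume "k = 0"
      then have "order 0 (sg ?f) = order 0 (1 :: 'l poly)" unfolding o2 by simp
      moreover have "order 0 (1 :: 'l poly) = 0" by (rule order_0I) simp
      ultimately show False using line(2) by simp
    qed
    then have g0: "sg g \<noteq> 0" using sg0 by (auto simp: zero_power)
    have "4 = k * order 0 (sg g)" "3 = k * order (1 / 4) (sg g)"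
      using line(2,3) unfolding o2 order_power[OF g0] by simp_all
    then have "k dvd 4" "k dvd 3" by (metis dvd_triv_left)+
    then have "k dvd 4 - 3" by (rule dvd_diff_nat)
    then show ?thesis by simp
  qed
  then have fg: "?f = g * r" using r(1) by simp
  show ?thesis unfolding fg irreducible_mult_unit_right[OF ru] by (rule prime_elem_imp_irreducible[OF g(1)])
qed

section \<open>Elimination: f2 vanishes only at tangencies\<close>

definition cubic_deriv :: "'r::idom \<Rightarrow> 'r poly" where "cubic_deriv A = [:A, 0, 3:]"

text \<open>
  On the cubic, \<open>elim_even + elim_odd y\<close> is \<open>- (y + e) D + (2 c' + k) F\<close>, where \<open>F\<close> is the quadric
  and \<open>D\<close> the Jacobian determinant (\<open>elim_even_odd_eval\<close>). For \<open>e = k = 0\<close> this is the minor of the homogeneous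
  gradients without the derivatives by \<open>y\<close>, which is the Jacobian determinant near the point at infinity. There the terms
  \<open>6 a3 x^2 y^2\<close> of \<open>y D\<close> and of \<open>2 c' F\<close> cancel, so that the norm has formal degree 9 with leading coefficient
  \<open>- a1^2\<close>. Together with the leading coefficient \<open>a3^2\<close> of \<open>G\<close> it detects precisely the tangency at infinity.
\<close>
definition elim_even where
  "elim_even e k A B a0 a1 a2 a3 a4 a5 =
     (cubic A B - [:3 * B, 2 * A:]) * [:a2, 2 * a0:] + cubic_deriv A * [:2 * a5, a2:]
     - smult e (smult (2 * a1) (cubic A B) + odd_part a1 a4 * cubic_deriv A) + smult k (even_part A B a0 a2 a3 a5)"

definition elim_odd where
  "elim_odd e k A B a0 a1 a2 a3 a4 =
     smult a1 (cubic A B - [:3 * B, 2 * A:]) + smult a4 (cubic_deriv A)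
     - smult e (smult 2 (smult a3 (cubic_deriv A) + [:a2, 2 * a0:])) + smult k (odd_part a1 a4)"

definition elim_norm where
  "elim_norm e k A B a0 a1 a2 a3 a4 a5 =
     (elim_even e k A B a0 a1 a2 a3 a4 a5)\<^sup>2 - (elim_odd e k A B a0 a1 a2 a3 a4)\<^sup>2 * cubic A B"

lemma map_poly_elim_norm:
  assumes "comm_ring_hom h"
  shows "map_poly h (elim_norm e k A B a0 a1 a2 a3 a4 a5) = elim_norm (h e) (h k) (h A) (h B) (h a0) (h a1) (h a2) (h a3) (h a4) (h a5)"
proof -
  interpret h: comm_ring_hom h by fact
  interpret m: map_poly_comm_ring_hom h ..
  show ?thesis
    by (simp only: elim_norm_def elim_even_def elim_odd_def even_part_def cubic_def cubic_deriv_def odd_part_def m.hom_minus m.hom_add m.hom_mult m.hom_power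
        h.map_poly_hom_smult h.map_poly_pCons_hom h.hom_zero h.hom_one m.hom_zero h.hom_mult h.hom_numeral)
qed

lemma coeff_mult_top:
  assumes "degree p \<le> m" "degree q \<le> n"
  shows "coeff (p * q) (m + n) = coeff p m * coeff (q :: 'a::idom poly) n"
proof -
  have "coeff p i * coeff q (m + n - i) = (if i = m then coeff p m * coeff q n else 0)" if "i \<le> m + n" for i
  proof -
    consider "i < m" | "i = m" | "i > m" by linarith
    then show ?thesis
    proof cases
      case 1
      then have "coeff q (m + n - i) = 0" using assms that by (intro coeff_eq_0) linarith
      then show ?thesis using 1 by simp
    next
      case 3
      then have "coeff p i = 0" using assms by (intro coeff_eq_0) linarith
      then show ?thesis using 3 by simp
    qed simp
  qed
  then have "coeff (p * q) (m + n) = (\<Sum>i\<le>m + n. if i = m then coeff p m * coeff q n else 0)"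
    unfolding coeff_mult by (intro sum.cong) auto
  then show ?thesis by simp
qed

lemma elim_norm_coeffs:
  "degree (elim_norm e k A B a0 a1 a2 a3 a4 a5) \<le> 9"
  "coeff (elim_norm e k A B a0 a1 a2 a3 a4 a5) 9 = - a1\<^sup>2"
proof -
  define a where "a = elim_even e k A B a0 a1 a2 a3 a4 a5"
  define b where "b = elim_odd e k A B a0 a1 a2 a3 a4"
  have a: "degree a \<le> 4"
    unfolding a_def elim_even_def cubic_def cubic_deriv_def odd_part_def even_part_def
    by (intro degree_diff_le degree_add_le order.trans[OF degree_mult_le] order.trans[OF degree_smult_le]) simp_all
  have b: "degree b \<le> 3" "coeff b 3 = a1"
    unfolding b_def elim_odd_def cubic_def cubic_deriv_def odd_part_def
    by (intro degree_diff_le degree_add_le order.trans[OF degree_mult_le] order.trans[OF degree_smult_le]; simp)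
      (simp add: numeral_eq_Suc)
  have c: "degree (cubic A B) \<le> 3" "coeff (cubic A B) 3 = 1" by (simp_all add: cubic_def numeral_eq_Suc)
  have aa: "degree (a * a) \<le> 8" using degree_mult_le[of a a] a by simp
  have bb: "degree (b * b) \<le> 6" using degree_mult_le[of b b] b by simp
  have bbc: "degree (b * b * cubic A B) \<le> 9" using degree_mult_le[of "b * b" "cubic A B"] bb c by simp
  have N: "elim_norm e k A B a0 a1 a2 a3 a4 a5 = a * a - b * b * cubic A B" by (simp add: elim_norm_def a_def b_def power2_eq_square)
  show "degree (elim_norm e k A B a0 a1 a2 a3 a4 a5) \<le> 9" unfolding N using aa bbc by (intro degree_diff_le) auto
  have "coeff (a * a) 9 = 0" using aa by (intro coeff_eq_0) simp
  moreover have "coeff (b * b * cubic A B) (6 + 3) = a1 * a1"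
    using coeff_mult_top[OF bb c(1)] coeff_mult_top[OF b(1) b(1)] b c by simp
  ultimately show "coeff (elim_norm e k A B a0 a1 a2 a3 a4 a5) 9 = - a1\<^sup>2"
    unfolding N by (simp add: power2_eq_square)
qed

lemma elim_even_odd_eval:
  assumes "y^2 = x^3 + A * x + (B :: 'r::idom)"
  shows "poly (elim_even e k A B a0 a1 a2 a3 a4 a5) x + poly (elim_odd e k A B a0 a1 a2 a3 a4) x * y =
    - (y + e) * tangency A a0 a1 a2 a3 a4 x y + (2 * (3 * x^2 + A) + k) * quadric a0 a1 a2 a3 a4 a5 x y"
proof -
  have B: "B = y * y - x * x * x - A * x" using assms by (simp add: power2_eq_square power3_eq_cube algebra_simps)
  show ?thesis unfolding B
    by (simp add: elim_even_def elim_odd_def cubic_def cubic_deriv_def odd_part_def even_part_def tangency_def quadric_def power2_eq_square algebra_simps)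
qed

text \<open>The norm is the product over the two points of the cubic above \<open>x\<close>.\<close>
lemma poly_elim_norm:
  assumes "y^2 = x^3 + A * x + (B :: 'r::idom)"
  shows "poly (elim_norm e k A B a0 a1 a2 a3 a4 a5) x =
    (poly (elim_even e k A B a0 a1 a2 a3 a4 a5) x + poly (elim_odd e k A B a0 a1 a2 a3 a4) x * y) *
    (poly (elim_even e k A B a0 a1 a2 a3 a4 a5) x + poly (elim_odd e k A B a0 a1 a2 a3 a4) x * (- y))"
proof -
  have "poly (cubic A B) x = y * y" using assms by (simp add: cubic_def power2_eq_square power3_eq_cube algebra_simps)
  then show ?thesis by (simp add: elim_norm_def power2_eq_square algebra_simps)
qed

text \<open>
  The parameters \<open>e\<close> and \<open>k\<close> keep the combination of the two tangency equations from vanishing accidentally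
  when the equations themselves do not.
\<close>
definition eliminant where
  "eliminant e k A B a0 a1 a2 a3 a4 a5 = resultant_sub 6 9 (G_form A B a0 a1 a2 a3 a4 a5) (elim_norm e k A B a0 a1 a2 a3 a4 a5)"

lemma eliminant_tangent:
  fixes A :: "'l::field"
  assumes "tangent A B a0 a1 a2 a3 a4 a5 x y"
  shows "eliminant e k A B a0 a1 a2 a3 a4 a5 = 0"
  unfolding eliminant_def
proof (rule resultant_sub_common_root[OF G_form_coeffs(1) elim_norm_coeffs(1)])
  show "poly (G_form A B a0 a1 a2 a3 a4 a5) x = 0" by (rule tangent_double_root(1)[OF assms])
  have t: "y^2 = x^3 + A * x + B" "quadric a0 a1 a2 a3 a4 a5 x y = 0" "tangency A a0 a1 a2 a3 a4 x y = 0"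
    using assms unfolding tangent_iff by blast+
  show "poly (elim_norm e k A B a0 a1 a2 a3 a4 a5) x = 0"
    unfolding poly_elim_norm[OF t(1)] elim_even_odd_eval[OF t(1)] t(2,3) by simp
qed simp

text \<open>
  Where \<open>f2 = 0\<close> and \<open>f3 \<noteq> 0\<close> there is a tangency, so the irreducible \<open>f2\<close> divides \<open>f3\<close> times
  the eliminant, and it does not divide \<open>f3\<close>.
\<close>
lemma f2_dvd_eliminant:
  assumes six: "(6 :: 'l::{alg_closed_field, field_gcd}) \<noteq> 0"
  shows "(f2_poly :: 'l poly8) dvd eliminant (const8 e) (const8 k) var_A var_B var_a0 var_a1 var_a2 var_a3 var_a4 var_a5"
    (is "?f dvd ?g")
proof -
  have prime: "prime_elem ?f" by (rule irreducible_imp_prime_elem[OF irreducible_f2_alg_closed[OF six]])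
  note deg = prime_factor_f2_degree[OF six prime dvd_refl]
  have "?f dvd generic_f3 * ?g"
  proof (rule hypersurface_nullstellensatz[OF prime deg])
    fix A B a0 a1 a2 a3 a4 a5
    note H = ev8_hom(1)[OF comm_ring_hom_id, of A B a0 a1 a2 a3 a4 a5]
    interpret e: comm_ring_hom "at8 A B a0 a1 a2 a3 a4 a5 :: 'l poly8 \<Rightarrow> 'l" by (rule H)
    assume z: "at8 A B a0 a1 a2 a3 a4 a5 ?f = 0"
    have "at8 A B a0 a1 a2 a3 a4 a5 ?g = eliminant e k A B a0 a1 a2 a3 a4 a5"
      unfolding eliminant_def resultant_sub_hom[OF H, symmetric] map_poly_G_form[OF H] map_poly_elim_norm[OF H] ev8_vars[OF comm_ring_hom_id] ..
    then show "at8 A B a0 a1 a2 a3 a4 a5 (generic_f3 * ?g) = 0"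
      unfolding e.hom_mult ev8_generic_f3[OF comm_ring_hom_id]
      using f2_zero_imp_tangent[OF six z] eliminant_tangent[of A B a0 a1 a2 a3 a4 a5 _ _ e k] by auto
  qed
  moreover have "\<not> ?f dvd generic_f3"
    using generic_f3_dvd_of_factor[OF _ deg] generic_f3_not_dvd_f2[OF six] by blast
  ultimately show ?thesis using prime_elem_dvd_multD[OF prime] by blast
qed

text \<open>
  Only finitely many points of the cubic lie over roots of \<open>G\<close>. At each of them \<open>F \<noteq> 0\<close> or \<open>D \<noteq> 0\<close>, so
  all but finitely many \<open>e\<close>, and then all but finitely many \<open>k\<close>, make the combination nonzero at all of them. The
  eliminant is then nonzero, and so is its divisor \<open>f2\<close>.
\<close>
lemma f2_nonzero_of_no_tangent:
  fixes A :: "'l::{alg_closed_field, field_gcd}"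
  assumes six: "(6 :: 'l) \<noteq> 0"
    and nt: "\<And>x y. \<not> tangent A B a0 a1 a2 a3 a4 a5 x y" and inf: "a1 \<noteq> 0 \<or> a3 \<noteq> 0"
  shows "at8 A B a0 a1 a2 a3 a4 a5 f2_poly \<noteq> 0"
proof -
  let ?G = "G_form A B a0 a1 a2 a3 a4 a5"
  have G0: "?G \<noteq> 0"
  proof
    assume "?G = 0"
    then have "coeff ?G 6 = 0" "coeff ?G 5 = 0" by simp_all
    then show False using inf unfolding G_form_coeffs by auto
  qed
  define S where "S = {(x, y). poly ?G x = 0 \<and> y^2 = x^3 + A * x + B}"
  have "finite S"
  proof (rule finite_subset)
    show "S \<subseteq> (SIGMA x:{x. poly ?G x = 0}. {y. poly [:- (x^3 + A * x + B), 0, 1:] y = 0})"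
      by (auto simp: S_def power2_eq_square)
    show "finite (SIGMA x:{x. poly ?G x = 0}. {y. poly [:- (x^3 + A * x + B), 0, 1:] y = 0})"
      by (intro finite_SigmaI poly_roots_finite G0) simp
  qed
  have fresh: "\<exists>e. e \<notin> T" if "finite T" for T :: "'l set"
    using that alg_closed_infinite ex_new_if_finite by blast
  \<comment> \<open>first \<open>e\<close> is chosen with \<open>y + e \<noteq> 0\<close>, which settles the points where \<open>F = 0\<close>;
    then \<open>k\<close> avoids the single bad value at each point where \<open>F \<noteq> 0\<close>\<close>
  obtain e where e: "e \<notin> (\<lambda>(x, y). - y) ` S" using fresh[of "(\<lambda>(x, y). - y) ` S"] \<open>finite S\<close> by blast
  define Q where "Q x y = - (y + e) * tangency A a0 a1 a2 a3 a4 x y + 2 * (3 * x^2 + A) * quadric a0 a1 a2 a3 a4 a5 x y" for x y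
  obtain k where k: "k \<notin> (\<lambda>(x, y). - Q x y / quadric a0 a1 a2 a3 a4 a5 x y) ` S"
    using fresh[of "(\<lambda>(x, y). - Q x y / quadric a0 a1 a2 a3 a4 a5 x y) ` S"] \<open>finite S\<close> by blast
  have psi: "poly (elim_even e k A B a0 a1 a2 a3 a4 a5) x + poly (elim_odd e k A B a0 a1 a2 a3 a4) x * y \<noteq> 0"
    if S: "(x, y) \<in> S" for x y
  proof
    have c: "y^2 = x^3 + A * x + B" using S by (simp add: S_def)
    assume "poly (elim_even e k A B a0 a1 a2 a3 a4 a5) x + poly (elim_odd e k A B a0 a1 a2 a3 a4) x * y = 0"
    then have z: "Q x y + k * quadric a0 a1 a2 a3 a4 a5 x y = 0"
      unfolding elim_even_odd_eval[OF c] Q_def by (simp add: algebra_simps)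
    show False
    proof (cases "quadric a0 a1 a2 a3 a4 a5 x y = 0")
      case True
      then have "tangency A a0 a1 a2 a3 a4 x y \<noteq> 0" using nt[of x y] c by (simp add: tangent_iff)
      moreover have "(y + e) * tangency A a0 a1 a2 a3 a4 x y = 0"
        using z unfolding Q_def True
        by (simp only: mult_zero_right add_0_right mult_minus_left neg_equal_0_iff_equal)
      ultimately have "e = - y" by (simp only: mult_eq_0_iff eq_neg_iff_add_eq_0 add.commute simp_thms)
      then show False using e S by force
    next
      case False
      then have "k = - Q x y / quadric a0 a1 a2 a3 a4 a5 x y" using z by (simp add: field_simps eq_neg_iff_add_eq_0)
      then show False using k S by force
    qed
  qed
  have "eliminant e k A B a0 a1 a2 a3 a4 a5 \<noteq> 0"
  proof
    assume "eliminant e k A B a0 a1 a2 a3 a4 a5 = 0"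
    then consider "a3\<^sup>2 = 0" "- a1\<^sup>2 = 0" | x where "poly ?G x = 0" "poly (elim_norm e k A B a0 a1 a2 a3 a4 a5) x = 0"
      unfolding eliminant_def
      by (subst (asm) resultant_sub_eq_0_iff[OF G_form_coeffs(1) elim_norm_coeffs(1)]) (auto simp: G_form_coeffs elim_norm_coeffs)
    then show False
    proof cases
      case 1
      then show False using inf by auto
    next
      case 2
      obtain y where y: "y^2 = x^3 + A * x + B" using nth_root_exists[of 2 "x^3 + A * x + B"] by auto
      then have "(x, y) \<in> S" "(x, - y) \<in> S" using 2 by (auto simp: S_def)
      then show False using 2(2) psi[of x y] psi[of x "- y"] unfolding poly_elim_norm[OF y] mult_eq_0_iff by blast
    qed
  qed
  moreover obtain q where q: "eliminant (const8 e) (const8 k) var_A var_B var_a0 var_a1 var_a2 var_a3 var_a4 var_a5 = f2_poly * q"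
    using f2_dvd_eliminant[OF six] by (rule dvdE)
  moreover note H = ev8_hom(1)[OF comm_ring_hom_id, of A B a0 a1 a2 a3 a4 a5]
  interpret E: comm_ring_hom "at8 A B a0 a1 a2 a3 a4 a5 :: 'l poly8 \<Rightarrow> 'l" by (rule H)
  have "at8 A B a0 a1 a2 a3 a4 a5 (eliminant (const8 e) (const8 k) var_A var_B var_a0 var_a1 var_a2 var_a3 var_a4 var_a5) = eliminant e k A B a0 a1 a2 a3 a4 a5"
    unfolding eliminant_def resultant_sub_hom[OF H, symmetric] map_poly_G_form[OF H] map_poly_elim_norm[OF H] ev8_vars[OF comm_ring_hom_id] ..
  ultimately have "at8 A B a0 a1 a2 a3 a4 a5 f2_poly * at8 A B a0 a1 a2 a3 a4 a5 q \<noteq> 0" by (simp add: E.hom_mult)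
  then show ?thesis by simp
qed

lemma f2_zero_iff_tangent:
  fixes A :: "'l::{alg_closed_field, field_gcd}"
  assumes six: "(6 :: 'l) \<noteq> 0" and f1: "4 * A^3 + 27 * B^2 \<noteq> 0"
  shows "at8 A B a0 a1 a2 a3 a4 a5 f2_poly = 0 \<longleftrightarrow>
    (a1 = 0 \<and> a3 = 0) \<or> (\<exists>x y. tangent A B a0 a1 a2 a3 a4 a5 x y)"
proof
  assume "at8 A B a0 a1 a2 a3 a4 a5 f2_poly = 0"
  then show "(a1 = 0 \<and> a3 = 0) \<or> (\<exists>x y. tangent A B a0 a1 a2 a3 a4 a5 x y)"
    using f2_nonzero_of_no_tangent[OF six] by blast
next
  assume "(a1 = 0 \<and> a3 = 0) \<or> (\<exists>x y. tangent A B a0 a1 a2 a3 a4 a5 x y)"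
  then show "at8 A B a0 a1 a2 a3 a4 a5 f2_poly = 0"
  proof
    assume "\<exists>x y. tangent A B a0 a1 a2 a3 a4 a5 x y"
    then obtain x y where t: "tangent A B a0 a1 a2 a3 a4 a5 x y" by blast
    have "y^2 = x^3 + A * x + B" using t by (simp add: tangent_def)
    then show ?thesis by (intro tangent_imp_f2_zero[OF six t] smooth_of_f1[OF six f1])
  qed (simp add: f2_zero_at_infinity[OF six])
qed

section \<open>Descent from the algebraic closure\<close>

text \<open>
  Greatest common divisors in a field are trivial; declaring them provides those of the iterated polynomial rings over
  an algebraic closure.
\<close>
instance alg_closure :: (field) field_gcd ..

text \<open>
  What is needed to pull irreducibility back along a ring homomorphism; the property is inherited by
  polynomial rings.
\<close>
definition unit_reflecting_mono :: "('a::idom \<Rightarrow> 'b::idom) \<Rightarrow> bool" where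
  "unit_reflecting_mono h \<longleftrightarrow> comm_ring_hom h \<and> (\<forall>a. h a = 0 \<longrightarrow> a = 0) \<and> (\<forall>a. h a dvd 1 \<longrightarrow> a dvd 1)"

lemma unit_reflecting_mono_map_poly:
  assumes "unit_reflecting_mono h" shows "unit_reflecting_mono (map_poly h)"
proof -
  interpret h: comm_ring_hom h using assms by (simp add: unit_reflecting_mono_def)
  have inj: "h a = 0 \<Longrightarrow> a = 0" for a using assms by (simp add: unit_reflecting_mono_def)
  show ?thesis
    unfolding unit_reflecting_mono_def
  proof (intro conjI allI impI)
    show "comm_ring_hom (map_poly h)" by (rule map_poly_comm_ring_hom) (rule h.comm_ring_hom_axioms)
    show "p = 0" if "map_poly h p = 0" for p
    proof (rule poly_eqI)
      fix n
      have "h (coeff p n) = 0" using arg_cong[OF that, of "\<lambda>q. coeff q n"] by simp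
      then show "coeff p n = coeff 0 n" using inj by simp
    qed
    show "p dvd 1" if u: "map_poly h p dvd 1" for p
    proof -
      have d: "degree (map_poly h p) = degree p" by (rule degree_map_poly_inj[OF h.comm_ring_hom_axioms inj])
      obtain c where c: "map_poly h p = [:c:]" "c dvd 1" using u unfolding is_unit_poly_iff by blast
      then have "degree p = 0" using d by simp
      then obtain b where b: "p = [:b:]" by (rule degree_eq_zeroE)
      have "h b = c" using arg_cong[OF c(1), of "\<lambda>q. coeff q 0"] by (simp add: b h.map_poly_pCons_hom)
      then have "b dvd 1" using c(2) assms by (simp add: unit_reflecting_mono_def)
      then show ?thesis unfolding b is_unit_poly_iff by blast
    qed
  qed
qed

lemma unit_reflecting_mono_to_ac: "unit_reflecting_mono (to_ac :: 'k::field \<Rightarrow> _)"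
  unfolding unit_reflecting_mono_def
proof (intro conjI allI impI comm_ring_hom_to_ac)
  fix a :: 'k assume "to_ac a dvd 1"
  then have "a \<noteq> 0" by (metis dvd_0_left_iff to_ac_0 zero_neq_one)
  then have "1 = a * inverse a" by simp
  then show "a dvd 1" by (rule dvdI)
qed simp

definition base_change8 :: "'k::field poly8 \<Rightarrow> 'k alg_closure poly8" where
  "base_change8 = map_poly (map_poly (map_poly (map_poly (map_poly (map_poly (map_poly (map_poly to_ac)))))))"

lemma unit_reflecting_mono_base_change8: "unit_reflecting_mono base_change8"
  unfolding base_change8_def by (intro unit_reflecting_mono_map_poly unit_reflecting_mono_to_ac)

lemma base_change8_vars:
  "base_change8 (var_A :: 'k::field poly8) = var_A" "base_change8 (var_B :: 'k::field poly8) = var_B" "base_change8 (var_a0 :: 'k::field poly8) = var_a0" "base_change8 (var_a1 :: 'k::field poly8) = var_a1" "base_change8 (var_a2 :: 'k::field poly8) = var_a2" "base_change8 (var_a3 :: 'k::field poly8) = var_a3" "base_change8 (var_a4 :: 'k::field poly8) = var_a4" "base_change8 (var_a5 :: 'k::field poly8) = var_a5"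
proof -
  note h0 = comm_ring_hom_to_ac[where 'a = 'k]
  note h1 = map_poly_comm_ring_hom[OF h0]
  note h2 = map_poly_comm_ring_hom[OF h1]
  note h3 = map_poly_comm_ring_hom[OF h2]
  note h4 = map_poly_comm_ring_hom[OF h3]
  note h5 = map_poly_comm_ring_hom[OF h4]
  note h6 = map_poly_comm_ring_hom[OF h5]
  note h7 = map_poly_comm_ring_hom[OF h6]
  note m = map_poly_linear_const[OF h0] map_poly_linear_const[OF h1] map_poly_linear_const[OF h2] map_poly_linear_const[OF h3]
    map_poly_linear_const[OF h4] map_poly_linear_const[OF h5] map_poly_linear_const[OF h6] map_poly_linear_const[OF h7]
  show "base_change8 (var_A :: 'k poly8) = var_A" "base_change8 (var_B :: 'k poly8) = var_B" "base_change8 (var_a0 :: 'k poly8) = var_a0" "base_change8 (var_a1 :: 'k poly8) = var_a1" "base_change8 (var_a2 :: 'k poly8) = var_a2" "base_change8 (var_a3 :: 'k poly8) = var_a3" "base_change8 (var_a4 :: 'k poly8) = var_a4" "base_change8 (var_a5 :: 'k poly8) = var_a5"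
    unfolding base_change8_def var_A_def var_B_def var_a0_def var_a1_def var_a2_def var_a3_def var_a4_def var_a5_def
    by (simp_all only: m)
qed

text \<open>The discriminant and \<open>f3\<close> are compatible with base change and \<open>f3\<close> can be cancelled.\<close>
lemma base_change8_f2:
  assumes six: "(6 :: 'k::field) \<noteq> 0"
  shows "base_change8 (f2_poly :: 'k poly8) = f2_poly"
proof -
  have H: "comm_ring_hom (base_change8 :: 'k poly8 \<Rightarrow> _)" using unit_reflecting_mono_base_change8[where 'a = 'k] by (simp add: unit_reflecting_mono_def)
  interpret b: comm_ring_hom "base_change8 :: 'k poly8 \<Rightarrow> _" by (rule H)
  have six': "(6 :: 'k alg_closure) \<noteq> 0" by (rule six_nonzero_hom[OF comm_ring_hom_to_ac six])
  have "base_change8 (disc6 (generic_G :: 'k poly8 poly)) = disc6 generic_G"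
    unfolding disc6_hom[OF H, symmetric] map_poly_G_form[OF H] base_change8_vars ..
  then have eq: "1296 * generic_f3\<^sup>2 * base_change8 (f2_poly :: 'k poly8) = 1296 * generic_f3\<^sup>2 * f2_poly"
    unfolding disc6_eq_f2[OF six] disc6_eq_f2[OF six'] b.hom_uminus b.hom_mult b.hom_power b.hom_numeral hom_f3_form[OF H] base_change8_vars
    by (simp only: neg_equal_iff_equal mult_ac)
  have "1296 * (generic_f3 :: 'k alg_closure poly8)\<^sup>2 \<noteq> 0"
  proof -
    obtain w where "1296 * w = (1 :: 'k alg_closure poly8)" using unit_1296[OF six'] by blast
    then have "(1296 :: 'k alg_closure poly8) \<noteq> 0" by (metis mult_zero_left zero_neq_one)
    then show ?thesis using generic_f3_nonzero[where 'k = "'k alg_closure"] by (simp only: mult_eq_0_iff power_eq_0_iff) simp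
  qed
  from iffD1[OF mult_left_cancel[OF this] eq] show ?thesis .
qed

text \<open>A factorisation over \<open>K\<close> is one over the algebraic closure, where one factor is a unit.\<close>
lemma irreducible_f2:
  assumes six: "(6 :: 'k::field) \<noteq> 0"
  shows "irreducible (f2_poly :: 'k poly8)"
proof -
  have six': "(6 :: 'k alg_closure) \<noteq> 0" by (rule six_nonzero_hom[OF comm_ring_hom_to_ac six])
  note irr = irreducible_f2_alg_closed[OF six']
  have H: "comm_ring_hom (base_change8 :: 'k poly8 \<Rightarrow> _)" and reflect: "base_change8 a dvd 1 \<Longrightarrow> a dvd 1" for a :: "'k poly8"
    using unit_reflecting_mono_base_change8[where 'a = 'k] by (simp_all add: unit_reflecting_mono_def)
  interpret b: comm_ring_hom "base_change8 :: 'k poly8 \<Rightarrow> _" by (rule H)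
  show ?thesis
  proof (rule Factorial_Ring.irreducibleI)
    show "(f2_poly :: 'k poly8) \<noteq> 0"
    proof
      assume "(f2_poly :: 'k poly8) = 0"
      then have "base_change8 (f2_poly :: 'k poly8) = 0" by simp
      then show False using irr unfolding base_change8_f2[OF six] by (simp add: Factorial_Ring.irreducible_def)
    qed
    show "\<not> (f2_poly :: 'k poly8) dvd 1"
    proof
      assume "(f2_poly :: 'k poly8) dvd 1"
      then obtain q where q: "1 = (f2_poly :: 'k poly8) * q" by (rule dvdE)
      have "1 = base_change8 (f2_poly :: 'k poly8) * base_change8 q" unfolding b.hom_mult[symmetric] q[symmetric] by (rule b.hom_one[symmetric])
      then have "is_unit (f2_poly :: 'k alg_closure poly8)" unfolding base_change8_f2[OF six] by (rule dvdI)
      then show False using irr by (simp add: Factorial_Ring.irreducible_def)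
    qed
    show "p dvd 1 \<or> q dvd 1" if pq: "(f2_poly :: 'k poly8) = p * q" for p q
    proof -
      have "(f2_poly :: 'k alg_closure poly8) = base_change8 p * base_change8 q"
        unfolding base_change8_f2[OF six, symmetric] pq by (rule b.hom_mult)
      then have "base_change8 p dvd 1 \<or> base_change8 q dvd 1" by (rule Factorial_Ring.irreducibleD[OF irr])
      then show ?thesis using reflect by blast
    qed
  qed
qed

lemma at8_base_change:
  "to_ac (at8 A B a0 a1 a2 a3 a4 a5 p) =
    at8 (to_ac A) (to_ac B) (to_ac a0) (to_ac a1) (to_ac a2) (to_ac a3) (to_ac a4) (to_ac a5) (base_change8 p)"
proof -
  note h0 = comm_ring_hom_to_ac[where 'a = 'a]
  note h1 = map_poly_comm_ring_hom[OF h0]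
  note h2 = map_poly_comm_ring_hom[OF h1]
  note h3 = map_poly_comm_ring_hom[OF h2]
  note h4 = map_poly_comm_ring_hom[OF h3]
  note h5 = map_poly_comm_ring_hom[OF h4]
  note h6 = map_poly_comm_ring_hom[OF h5]
  note h7 = map_poly_comm_ring_hom[OF h6]
  note e0 = comm_ring_hom_id[where 'a = "'a alg_closure"]
  note e1 = comm_ring_hom_ev[OF e0, of "to_ac A"]
  note e2 = comm_ring_hom_ev[OF e1, of "to_ac B"]
  note e3 = comm_ring_hom_ev[OF e2, of "to_ac a0"]
  note e4 = comm_ring_hom_ev[OF e3, of "to_ac a1"]
  note e5 = comm_ring_hom_ev[OF e4, of "to_ac a2"]
  note e6 = comm_ring_hom_ev[OF e5, of "to_ac a3"]
  note e7 = comm_ring_hom_ev[OF e6, of "to_ac a4"]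
  have s: "ev e x (map_poly h p) = ev (\<lambda>q. e (h q)) x p" if "comm_ring_hom e" "comm_ring_hom h"
    for e :: "'y::comm_ring_1 \<Rightarrow> 'z::comm_ring_1" and h :: "'x::comm_ring_1 \<Rightarrow> 'y" and x p
  proof -
    have "map_poly e (map_poly h p) = map_poly (\<lambda>q. e (h q)) p"
      using comm_ring_hom_zero[OF that(1)] comm_ring_hom_zero[OF that(2)]
      by (intro poly_eqI) (simp add: coeff_map_poly)
    then show ?thesis by (simp add: ev_def)
  qed
  show ?thesis
    unfolding hom_ev8[OF comm_ring_hom_to_ac comm_ring_hom_id]
    unfolding ev8_def base_change8_def s[OF e7 h7] s[OF e6 h6] s[OF e5 h5] s[OF e4 h4] s[OF e3 h3] s[OF e2 h2] s[OF e1 h1] s[OF e0 h0] ..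
qed

section \<open>The Jacobian criterion\<close>

text \<open>
  If all minors vanish, the rows are proportional and the matrix is a product of a column and a row; a nonzero
  minor gives two independent columns.
\<close>
lemma rank_two_rows_iff:
  fixes M :: "'f::field mat"
  assumes M: "M \<in> carrier_mat 2 n"
  shows "vec_space.rank 2 M = 2 \<longleftrightarrow>
    (\<exists>i<n. \<exists>j<n. M $$ (0, i) * M $$ (1, j) \<noteq> M $$ (0, j) * M $$ (1, i))"
proof
  assume "vec_space.rank 2 M = 2"
  show "\<exists>i<n. \<exists>j<n. M $$ (0, i) * M $$ (1, j) \<noteq> M $$ (0, j) * M $$ (1, i)"
  proof (rule ccontr)
    assume "\<not> ?thesis"
    then have minors: "M $$ (0, i) * M $$ (1, j) = M $$ (0, j) * M $$ (1, i)" if "i < n" "j < n" for i j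
      using that by blast
    have "\<exists>f g. \<forall>r<2. \<forall>c<n. M $$ (r, c) = f r * g c"
    proof (cases "\<exists>j<n. M $$ (0, j) \<noteq> 0")
      case True
      then obtain j where j: "j < n" "M $$ (0, j) \<noteq> 0" by blast
      have "M $$ (1, c) = M $$ (1, j) / M $$ (0, j) * M $$ (0, c)" if "c < n" for c
        using minors[OF j(1) that] j(2) by (simp add: field_simps)
      then show ?thesis
        by (intro exI[of _ "\<lambda>r. if r = 0 then 1 else M $$ (1, j) / M $$ (0, j)"] exI[of _ "\<lambda>c. M $$ (0, c)"])
          (auto simp: less_2_cases_iff)
    next
      case False
      then show ?thesis
        by (intro exI[of _ "\<lambda>r. if r = 0 then 0 else 1"] exI[of _ "\<lambda>c. M $$ (1, c)"]) (auto simp: less_2_cases_iff)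
    qed
    then obtain f g where fg: "\<And>r c. r < 2 \<Longrightarrow> c < n \<Longrightarrow> M $$ (r, c) = f r * g c" by blast
    have "vec_space.rank 2 M \<le> 1"
      by (rule vec_space.rank_le_1_product_entries[OF M, where f = f and g = g]) (use M fg in auto)
    with \<open>vec_space.rank 2 M = 2\<close> show False by simp
  qed
next
  assume "\<exists>i<n. \<exists>j<n. M $$ (0, i) * M $$ (1, j) \<noteq> M $$ (0, j) * M $$ (1, i)"
  then obtain i j where ij: "i < n" "j < n" and minor: "M $$ (0, i) * M $$ (1, j) \<noteq> M $$ (0, j) * M $$ (1, i)" by blast
  interpret vec_space "TYPE('f)" 2 .
  define B where "B = mat (Suc (Suc 0)) (Suc (Suc 0)) (\<lambda>(r, c). M $$ (r, if c = 0 then i else j))"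
  have B: "B \<in> carrier_mat 2 2" by (simp add: B_def numeral_2_eq_2)
  have cols: "cols B = [col M i, col M j]"
  proof (rule nth_equalityI)
    fix c assume "c < length (cols B)"
    then have "c = 0 \<or> c = 1" using B by auto
    then show "cols B ! c = [col M i, col M j] ! c"
      using M ij by (elim disjE; intro eq_vecI) (auto simp: B_def)
  qed (use B in simp)
  have "det B = M $$ (0, i) * M $$ (1, j) - M $$ (0, j) * M $$ (1, i)"
    unfolding B_def by (simp add: det_mat_Suc det_dim_zero)
  then have "det B \<noteq> 0" using minor by simp
  then have rB: "rank B = 2" by (rule low_rank_det_zero[OF B])
  have ne: "col M i \<noteq> col M j"
  proof
    assume eq: "col M i = col M j"
    have "M $$ (r, i) = M $$ (r, j)" if "r < 2" for r
      using arg_cong[OF eq, of "\<lambda>v. vec_index v r"] M ij that by simp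
    then show False using minor by simp
  qed
  have li: "lin_indpt {col M i, col M j}"
    using full_rank_lin_indpt[OF B rB] ne unfolding cols by simp
  have sub: "{col M i, col M j} \<subseteq> set (cols M)" using M ij by (auto simp: cols_def)
  have "2 = card {col M i, col M j}" using ne by simp
  also have "\<dots> \<le> rank M"
    by (rule rank_ge_card_indpt[OF M sub li])
  finally have "2 \<le> rank M" .
  moreover have "rank M \<le> 2"
  proof -
    obtain S where S: "maximal S (\<lambda>T. T \<subseteq> set (cols M) \<and> lin_indpt T)"
      using maximal_exists_superset[of "set (cols M)" "\<lambda>T. T \<subseteq> set (cols M) \<and> lin_indpt T" "{col M i, col M j}"] sub li
      by auto
    have "rank M = card S" by (rule rank_card_indpt[OF M S])
    moreover have "card S \<le> dim"
    proof -
      have S': "S \<subseteq> set (cols M)" "lin_indpt S" using S unfolding maximal_def by blast+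
      have "set (cols M) \<subseteq> carrier_vec 2" using cols_dim[of M] M by simp
      with S'(1) have "S \<subseteq> carrier_vec 2" by (rule order_trans)
      then show ?thesis using li_le_dim(2)[OF fin_dim _ S'(2)] by simp
    qed
    ultimately show ?thesis by (simp add: dim_is_n)
  qed
  ultimately show "vec_space.rank 2 M = 2" by simp
qed

lemma base_change_P: "base_change (P_poly A (B :: 'k::field)) = P_poly (to_ac A) (to_ac B)"
  and base_change_Q: "base_change (Q_poly a0 a1 a2 a3 a4 a5) =
    Q_poly (to_ac a0) (to_ac a1) (to_ac a2) (to_ac a3) (to_ac a4) (to_ac (a5 :: 'k))"
proof -
  note h0 = comm_ring_hom_to_ac[where 'a = 'k]
  note h1 = map_poly_comm_ring_hom[OF h0]
  note h2 = map_poly_comm_ring_hom[OF h1]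
  note h3 = map_poly_comm_ring_hom[OF h2]
  note h4 = map_poly_comm_ring_hom[OF h3]
  interpret b: comm_ring_hom "base_change :: 'k poly4 \<Rightarrow> _" unfolding base_change_def by (rule h4)
  note m = map_poly_linear_const[OF h0] map_poly_linear_const[OF h1] map_poly_linear_const[OF h2] map_poly_linear_const[OF h3]
  have c: "base_change (const4 c) = const4 (to_ac c)" for c :: 'k
    unfolding base_change_def const4_def by (simp only: m)
  have v: "base_change (X4 :: 'k poly4) = X4" "base_change (Y4 :: 'k poly4) = Y4"
    "base_change (Z4 :: 'k poly4) = Z4" "base_change (W4 :: 'k poly4) = W4"
    unfolding base_change_def X4_def Y4_def Z4_def W4_def by (simp_all only: m)
  show "base_change (P_poly A B) = P_poly (to_ac A) (to_ac B)"
    unfolding P_poly_def cubic_form_def b.hom_minus b.hom_add b.hom_mult b.hom_power c v ..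
  show "base_change (Q_poly a0 a1 a2 a3 a4 a5) =
    Q_poly (to_ac a0) (to_ac a1) (to_ac a2) (to_ac a3) (to_ac a4) (to_ac a5)"
    unfolding Q_poly_def quadratic_form_def b.hom_minus b.hom_add b.hom_mult b.hom_power c v ..
qed

lemma minus_one_pCons: "(- 1 :: 'a::comm_ring_1 poly) = [:- 1:]"
  by (metis minus_pCons minus_zero one_pCons)

lemma P_poly_coeffs: "P_poly A B =
  [: [: [:[:0, 0, 0, -1:]:], [:0, 0, 1:], [:[:0, - A:]:], [:[:- B:]:] :] :]"
  by (simp add: P_poly_def cubic_form_def const4_def X4_def Y4_def Z4_def power2_eq_square power3_eq_cube minus_one_pCons)

lemma Q_poly_coeffs: "Q_poly a0 a1 a2 a3 a4 a5 =
  [: [: [:[:0, 0, - a0:], [:0, - a1:], [:- a3:]:], [:[:0, - a2:], [:- a4:]:], [:[:- a5:]:] :], 0, 1 :]"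
  by (simp add: Q_poly_def quadratic_form_def const4_def X4_def Y4_def Z4_def W4_def power2_eq_square)

lemma eval4_P_Q:
  fixes A :: "'f::field"
  shows "eval4 (P_poly A B) x y z w = cubic_form A B x y z"
    and "eval4 (Q_poly a0 a1 a2 a3 a4 a5) x y z w = w^2 - quadratic_form a0 a1 a2 a3 a4 a5 x y z"
  unfolding P_poly_coeffs Q_poly_coeffs
  by (simp_all add: eval4_def cubic_form_def quadratic_form_def power2_eq_square power3_eq_cube algebra_simps)

lemma pderiv_P:
  fixes A :: "'f::field"
  shows "pderiv_x (P_poly A B) = [: [: [:[:0, 0, -3:]:], 0, [:[:- A:]:] :] :]"
    and "pderiv_y (P_poly A B) = [: [: 0, [:0, 2:] :] :]"
    and "pderiv_z (P_poly A B) = [: [: [:0, 0, 1:], [:[:0, -2 * A:]:], [:[:-3 * B:]:] :] :]"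
    and "pderiv_w (P_poly A B) = 0"
  unfolding P_poly_coeffs pderiv_x_def pderiv_y_def pderiv_z_def pderiv_w_def
  by (simp_all add: Polynomial.map_poly_pCons pderiv_pCons numeral_poly map_poly_1)

lemma pderiv_Q:
  fixes a0 :: "'f::field"
  shows "pderiv_x (Q_poly a0 a1 a2 a3 a4 a5) = [: [: [:[:0, -2 * a0:], [:- a1:]:], [:[:- a2:]:] :] :]"
    and "pderiv_y (Q_poly a0 a1 a2 a3 a4 a5) = [: [: [:[:0, - a1:], [:- 2 * a3:]:], [:[:- a4:]:] :] :]"
    and "pderiv_z (Q_poly a0 a1 a2 a3 a4 a5) = [: [: [:[:0, - a2:], [:- a4:]:], [:[:- 2 * a5:]:] :] :]"
    and "pderiv_w (Q_poly a0 a1 a2 a3 a4 a5) = [: 0, 2 :]"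
  unfolding Q_poly_coeffs pderiv_x_def pderiv_y_def pderiv_z_def pderiv_w_def
  by (simp_all add: Polynomial.map_poly_pCons pderiv_pCons numeral_poly map_poly_1)

lemma eval4_gradients:
  fixes A :: "'f::field"
  shows "eval4 (pderiv_x (P_poly A B)) x y z w = - (3 * x^2 + A * z^2)"
    and "eval4 (pderiv_y (P_poly A B)) x y z w = 2 * y * z"
    and "eval4 (pderiv_z (P_poly A B)) x y z w = y^2 - 2 * A * x * z - 3 * B * z^2"
    and "eval4 (pderiv_w (P_poly A B)) x y z w = 0"
    and "eval4 (pderiv_x (Q_poly a0 a1 a2 a3 a4 a5)) x y z w = - (2 * a0 * x + a1 * y + a2 * z)"
    and "eval4 (pderiv_y (Q_poly a0 a1 a2 a3 a4 a5)) x y z w = - (a1 * x + 2 * a3 * y + a4 * z)"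
    and "eval4 (pderiv_z (Q_poly a0 a1 a2 a3 a4 a5)) x y z w = - (a2 * x + a4 * y + 2 * a5 * z)"
    and "eval4 (pderiv_w (Q_poly a0 a1 a2 a3 a4 a5)) x y z w = 2 * w"
  unfolding pderiv_P pderiv_Q
  by (simp_all add: eval4_def power2_eq_square algebra_simps)

lemma ex_less_4: "(\<exists>i<4. P i) \<longleftrightarrow> P 0 \<or> P 1 \<or> P 2 \<or> P (3 :: nat)"
  by (auto simp: numeral_eq_Suc less_Suc_eq)

text \<open>The last column of the Jacobian matrix is \<open>(0, 2 w)\<close>, which accounts for the minors that involve it.\<close>
lemma jacobian_rank_iff:
  fixes A B :: "'l::field"
  assumes two: "(2 :: 'l) \<noteq> 0"
    and "p1 = - (3 * x^2 + A * z^2)" "p2 = 2 * y * z" "p3 = y^2 - 2 * A * x * z - 3 * B * z^2"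
    and "q1 = 2 * a0 * x + a1 * y + a2 * z" "q2 = a1 * x + 2 * a3 * y + a4 * z" "q3 = a2 * x + a4 * y + 2 * a5 * z"
  shows "vec_space.rank 2 (jacobian (P_poly A B) (Q_poly a0 a1 a2 a3 a4 a5) x y z w) \<noteq> 2 \<longleftrightarrow>
    p1 * q2 = p2 * q1 \<and> p1 * q3 = p3 * q1 \<and> p2 * q3 = p3 * q2 \<and> (w = 0 \<or> p1 = 0 \<and> p2 = 0 \<and> p3 = 0)"
proof -
  let ?M = "jacobian (P_poly A B) (Q_poly a0 a1 a2 a3 a4 a5) x y z w"
  have M: "?M \<in> carrier_mat 2 4" by (simp add: jacobian_def mat_of_rows_list_def numeral_2_eq_2)
  have e: "?M $$ (0, 0) = p1" "?M $$ (0, 1) = p2" "?M $$ (0, 2) = p3" "?M $$ (0, 3) = 0"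
    "?M $$ (1, 0) = - q1" "?M $$ (1, 1) = - q2" "?M $$ (1, 2) = - q3" "?M $$ (1, 3) = 2 * w"
    by (simp_all add: jacobian_def mat_of_rows_list_def eval4_gradients numeral_2_eq_2 numeral_3_eq_3 assms(2-))
  show ?thesis
    unfolding rank_two_rows_iff[OF M] ex_less_4 e using two by auto
qed

text \<open>
  In an affine chart Euler's relation expresses the third partial derivative by the other two, so that one minor
  controls the others.
\<close>
lemma euler_relations:
  fixes x :: "'l::field"
  assumes "p1 * x + p2 * y + p3 = 0" "q1 * x + q2 * y + q3 = 0" "p1 * q2 = p2 * q1"
  shows "p1 * q3 = p3 * q1" "p2 * q3 = p3 * q2"
proof -
  have p3: "p3 = - (p1 * x + p2 * y)" and q3: "q3 = - (q1 * x + q2 * y)"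
    using assms(1,2) unfolding eq_neg_iff_add_eq_0 by (simp_all only: add.commute)
  have "p1 * q3 - p3 * q1 = - y * (p1 * q2 - p2 * q1)" unfolding p3 q3 by (simp add: algebra_simps)
  then show "p1 * q3 = p3 * q1" using assms(3) by simp
  have "p2 * q3 - p3 * q2 = x * (p1 * q2 - p2 * q1)" unfolding p3 q3 by (simp add: algebra_simps)
  then show "p2 * q3 = p3 * q2" using assms(3) by simp
qed

text \<open>
  For \<open>f1 \<noteq> 0\<close> the gradient of the cubic never vanishes on it, so a point with dependent gradients has
  \<open>w = 0\<close>: it is a branch point of the double cover where the quadric is tangent to the cubic.
  Conversely, all points above a singular point of the cubic, and all tangency points with \<open>w = 0\<close>, are singular.
\<close>
lemma singular_point_iff:
  fixes A :: "'l::alg_closed_field"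
  assumes six: "(6 :: 'l) \<noteq> 0"
  shows "(\<exists>x y z w. (x, y, z, w) \<noteq> (0, 0, 0, 0) \<and> eval4 (P_poly A B) x y z w = 0 \<and>
      eval4 (Q_poly a0 a1 a2 a3 a4 a5) x y z w = 0 \<and>
      vec_space.rank 2 (jacobian (P_poly A B) (Q_poly a0 a1 a2 a3 a4 a5) x y z w) \<noteq> 2) \<longleftrightarrow>
    4 * A^3 + 27 * B^2 = 0 \<or> (a1 = 0 \<and> a3 = 0) \<or> (\<exists>x y. tangent A B a0 a1 a2 a3 a4 a5 x y)"
    (is "(\<exists>x y z w. ?bad x y z w) \<longleftrightarrow> ?sing \<or> ?inf \<or> (\<exists>x y. ?tan x y)")
proof -
  note two = six_factors(1)[OF six] and three = six_factors(2)[OF six]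
  note rank = jacobian_rank_iff[OF two refl refl refl refl refl refl]
  have "?sing \<or> ?inf \<or> (\<exists>x y. ?tan x y)" if "\<exists>x y z w. ?bad x y z w"
  proof -
    from that obtain x y z w where nz: "(x, y, z, w) \<noteq> (0, 0, 0, 0)"
      and P: "cubic_form A B x y z = 0" and Q: "w^2 = quadratic_form a0 a1 a2 a3 a4 a5 x y z"
      and minors: "- (3 * x^2 + A * z^2) * (a1 * x + 2 * a3 * y + a4 * z) = 2 * y * z * (2 * a0 * x + a1 * y + a2 * z)"
        "- (3 * x^2 + A * z^2) * (a2 * x + a4 * y + 2 * a5 * z) = (y^2 - 2 * A * x * z - 3 * B * z^2) * (2 * a0 * x + a1 * y + a2 * z)"
        "2 * y * z * (a2 * x + a4 * y + 2 * a5 * z) = (y^2 - 2 * A * x * z - 3 * B * z^2) * (a1 * x + 2 * a3 * y + a4 * z)"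
      and w: "w = 0 \<or> - (3 * x^2 + A * z^2) = 0 \<and> 2 * y * z = 0 \<and> y^2 - 2 * A * x * z = 3 * B * z^2"
      unfolding rank eval4_P_Q right_minus_eq by (elim exE conjE) (rule that)
    \<comment> \<open>the only point of the cubic at infinity is \<open>(0 : 1 : 0)\<close>, a smooth point of it\<close>
    show "?sing \<or> ?inf \<or> (\<exists>x y. ?tan x y)"
    proof (cases "z = 0")
      case True
      then have x: "x = 0" using P by (simp add: cubic_form_def)
      have "y \<noteq> 0" using nz True x Q by (auto simp: quadratic_form_def)
      then have "w = 0" using w True x by auto
      then have "a3 = 0" using Q True x \<open>y \<noteq> 0\<close> by (simp add: quadratic_form_def)
      moreover have "a1 = 0" using minors(2) True x \<open>y \<noteq> 0\<close> by simp
      ultimately show ?thesis by simp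
    next
      case z: False
      define u v where "u = x / z" and "v = y / z"
      have x: "x = u * z" and y: "y = v * z" using z by (simp_all add: u_def v_def)
      have "z^3 * (v^2 - (u^3 + A * u + B)) = 0"
        using P unfolding x y by (simp add: cubic_form_def power2_eq_square power3_eq_cube algebra_simps)
      then have c: "v^2 = u^3 + A * u + B" using z by simp
      show ?thesis
      proof (cases ?sing)
        case f1: False
        have sm: "3 * u^2 + A \<noteq> 0 \<or> 2 * v \<noteq> 0" by (rule smooth_of_f1[OF six f1 c])
        have "w = 0"
        proof (rule ccontr)
          assume "w \<noteq> 0"
          then have p: "- (3 * x^2 + A * z^2) = 0" "2 * y * z = 0" using w by blast+
          have "z^2 * (3 * u^2 + A) = - (- (3 * x^2 + A * z^2))"
            unfolding x by (simp add: power2_eq_square algebra_simps)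
          moreover have "z^2 * (2 * v) = 2 * y * z"
            unfolding y by (simp add: power2_eq_square algebra_simps)
          ultimately have "z^2 * (3 * u^2 + A) = 0" "z^2 * (2 * v) = 0" unfolding p by simp_all
          then show False using z sm by simp
        qed
        then have "z^2 * quadric a0 a1 a2 a3 a4 a5 u v = 0"
          using Q unfolding x y by (simp add: quadratic_form_def quadric_def power2_eq_square algebra_simps)
        moreover have "z^3 * tangency A a0 a1 a2 a3 a4 u v = 0"
        proof -
          have "z^3 * tangency A a0 a1 a2 a3 a4 u v = 2 * y * z * (2 * a0 * x + a1 * y + a2 * z)
              - (- (3 * x^2 + A * z^2) * (a1 * x + 2 * a3 * y + a4 * z))"
            unfolding x y by (simp add: tangency_def power2_eq_square power3_eq_cube algebra_simps)
          then show ?thesis unfolding minors(1) by simp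
        qed
        ultimately have "tangent A B a0 a1 a2 a3 a4 a5 u v" unfolding tangent_iff using c z by simp
        then show ?thesis by blast
      qed simp
    qed
  qed
  moreover have "\<exists>x y z w. ?bad x y z w" if "?sing \<or> ?inf \<or> (\<exists>x y. ?tan x y)"
  proof -
    from that consider ?sing | ?inf | x y where "?tan x y" by blast
    then show ?thesis
    proof cases
      case 1
      \<comment> \<open>the singular point of the cubic is \<open>(x, 0)\<close> with \<open>x\<close> the multiple root of the right-hand side\<close>
      obtain x where x: "x^3 + A * x + B = 0" "3 * x^2 + A = 0" "2 * A * x + 3 * B = 0"
      proof (cases "A = 0")
        case True
        have "27 = (3 :: 'l)^3" by simp
        then have "(27 :: 'l) \<noteq> 0" using three by (metis power_eq_0_iff)
        then have "B = 0" using 1 True by simp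
        then show ?thesis using True by (intro that[of 0]) simp_all
      next
        case False
        define x where "x = - (3 * B) / (2 * A)"
        have Ax: "2 * A * x = - (3 * B)" using False two by (simp add: x_def)
        have "4 * A^2 * (3 * x^2 + A) = 3 * (2 * A * x)^2 + 4 * A^3" by (simp add: power2_eq_square power3_eq_cube algebra_simps)
        also have "\<dots> = 0" unfolding Ax using 1 by (simp add: power2_eq_square algebra_simps)
        finally have c': "3 * x^2 + A = 0"
        proof -
          assume "4 * A^2 * (3 * x^2 + A) = 0"
          moreover have "4 = (2 :: 'l)^2" by simp
          then have "(4 :: 'l) \<noteq> 0" using two by (metis power_eq_0_iff)
          ultimately show ?thesis using False by simp
        qed
        have "3 * (x^3 + A * x + B) = x * (3 * x^2 + A) + (2 * A * x + 3 * B)" by (simp add: power2_eq_square power3_eq_cube algebra_simps)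
        also have "\<dots> = 0" unfolding c' Ax by simp
        finally have "x^3 + A * x + B = 0" using three unfolding mult_eq_0_iff by blast
        then show ?thesis using c' Ax by (intro that[of x]) simp_all
      qed
      \<comment> \<open>every point above the singular point will do\<close>
      obtain w where w: "w^2 = quadratic_form a0 a1 a2 a3 a4 a5 x 0 1" using nth_root_exists[of 2] by auto
      have p3: "0^2 - 2 * A * x * 1 - 3 * B * 1^2 = 0"
      proof -
        have "0^2 - 2 * A * x * 1 - 3 * B * 1^2 = - (2 * A * x + 3 * B)" by simp
        then show ?thesis unfolding x(3) by simp
      qed
      have p1: "- (3 * x^2 + A * 1^2) = 0" using x(2) by simp
      have "?bad x 0 1 w"
        unfolding rank eval4_P_Q p1 p3 using x(1) w by (simp add: cubic_form_def)
      then show ?thesis by blast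
    next
      case 2
      then have "?bad 0 1 0 0" unfolding rank eval4_P_Q by (simp add: cubic_form_def quadratic_form_def)
      then show ?thesis by blast
    next
      case 3
      then have c: "y^2 = x^3 + A * x + B" and F: "quadric a0 a1 a2 a3 a4 a5 x y = 0" and D: "tangency A a0 a1 a2 a3 a4 x y = 0"
        unfolding tangent_iff by blast+
      define p1 p2 p3 q1 q2 q3 where "p1 = - (3 * x^2 + A * 1^2)" and "p2 = 2 * y * 1" and "p3 = y^2 - 2 * A * x * 1 - 3 * B * 1^2"
        and "q1 = 2 * a0 * x + a1 * y + a2 * 1" and "q2 = a1 * x + 2 * a3 * y + a4 * 1" and "q3 = a2 * x + a4 * y + 2 * a5 * 1"
      note defs = p1_def p2_def p3_def q1_def q2_def q3_def
      have "p1 * q2 = p2 * q1 - tangency A a0 a1 a2 a3 a4 x y" by (simp add: defs tangency_def algebra_simps)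
      then have m: "p1 * q2 = p2 * q1" unfolding D by simp
      have "p1 * x + p2 * y + p3 = 3 * (y^2 - (x^3 + A * x + B))"
        by (simp add: defs power2_eq_square power3_eq_cube algebra_simps)
      then have ep: "p1 * x + p2 * y + p3 = 0" unfolding c by simp
      have "q1 * x + q2 * y + q3 = 2 * quadric a0 a1 a2 a3 a4 a5 x y"
        by (simp add: defs quadric_def power2_eq_square algebra_simps)
      then have eq: "q1 * x + q2 * y + q3 = 0" unfolding F by simp
      have Fq: "quadratic_form a0 a1 a2 a3 a4 a5 x y 1 = 0" using F by (simp add: quadric_def quadratic_form_def algebra_simps)
      have "?bad x y 1 0"
        unfolding rank eval4_P_Q defs[symmetric] Fq using m euler_relations[OF ep eq m] c
        by (simp add: cubic_form_def)
      then show ?thesis by blast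
    qed
  qed
  ultimately show ?thesis by blast
qed

section \<open>The theorem\<close>

lemma six_nonzero_of_CHAR:
  assumes "CHAR('k::field) \<noteq> 2" "CHAR('k) \<noteq> 3" shows "(6 :: 'k) \<noteq> 0"
proof
  assume "(6 :: 'k) = 0"
  then have "of_nat (2 * 3) = (0 :: 'k)" by simp
  then have "of_nat 2 = (0 :: 'k) \<or> of_nat 3 = (0 :: 'k)" unfolding of_nat_mult mult_eq_0_iff .
  then have "CHAR('k) dvd 2 \<or> CHAR('k) dvd 3" unfolding of_nat_eq_0_iff_char_dvd .
  \<comment> \<open>the characteristic is then one of 1, 2 and 3\<close>
  then have "CHAR('k) \<noteq> 0" "CHAR('k) \<le> 3"
    by (metis dvd_0_left_iff zero_neq_numeral) (use \<open>CHAR('k) dvd 2 \<or> CHAR('k) dvd 3\<close> in \<open>auto dest!: dvd_imp_le\<close>)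
  moreover have "CHAR('k) \<noteq> 1" by simp
  ultimately show False using assms by linarith
qed

lemma nonsingular_alt:
  "nonsingular P Q \<longleftrightarrow> \<not> (\<exists>x y z w. (x, y, z, w) \<noteq> (0, 0, 0, 0) \<and>
     eval4 (base_change P) x y z w = 0 \<and> eval4 (base_change Q) x y z w = 0 \<and>
     vec_space.rank 2 (jacobian (base_change P) (base_change Q) x y z w) \<noteq> 2)"
  unfolding nonsingular_def by blast

lemma nonsingular_iff:
  fixes A :: "'k::field"
  assumes six: "(6 :: 'k) \<noteq> 0"
  shows "nonsingular (P_poly A B) (Q_poly a0 a1 a2 a3 a4 a5) \<longleftrightarrow>
    eval8 f1_poly A B a0 a1 a2 a3 a4 a5 \<noteq> 0 \<and> eval8 f2_poly A B a0 a1 a2 a3 a4 a5 \<noteq> 0"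
proof -
  have six': "(6 :: 'k alg_closure) \<noteq> 0" by (rule six_nonzero_hom[OF comm_ring_hom_to_ac six])
  interpret e: comm_ring_hom "at8 A B a0 a1 a2 a3 a4 a5 :: 'k poly8 \<Rightarrow> 'k" by (rule ev8_hom(1)[OF comm_ring_hom_id])
  have f1: "eval8 f1_poly A B a0 a1 a2 a3 a4 a5 = 4 * A^3 + 27 * B^2"
    unfolding eval8_eq f1_poly_def e.hom_add e.hom_mult e.hom_power e.hom_numeral ev8_vars[OF comm_ring_hom_id] ..
  have f1': "4 * A^3 + 27 * B^2 = 0 \<longleftrightarrow> 4 * to_ac A ^ 3 + 27 * to_ac B ^ 2 = 0"
  proof -
    have "4 * to_ac A ^ 3 + 27 * to_ac B ^ 2 = to_ac (4 * A^3 + 27 * B^2)" by simp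
    then show ?thesis by (simp only: to_ac_eq_0_iff)
  qed
  have f2: "eval8 f2_poly A B a0 a1 a2 a3 a4 a5 = 0 \<longleftrightarrow>
     at8 (to_ac A) (to_ac B) (to_ac a0) (to_ac a1) (to_ac a2) (to_ac a3) (to_ac a4) (to_ac a5) (f2_poly :: 'k alg_closure poly8) = 0"
    unfolding eval8_eq base_change8_f2[OF six, symmetric] at8_base_change[symmetric] by simp
  show ?thesis
    unfolding nonsingular_alt base_change_P base_change_Q singular_point_iff[OF six'] f2 f1 f1'
    using f2_zero_iff_tangent[OF six'] by metis
qed

theorem theorem1:
  assumes "CHAR('k::field) \<noteq> 2" and "CHAR('k) \<noteq> 3"
  shows
    "(f3_poly :: 'k poly8)^2 dvd Delta_poly \<and>
     (\<forall>A B a0 a1 a2 a3 a4 a5 :: 'k.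
        nonsingular (P_poly A B) (Q_poly a0 a1 a2 a3 a4 a5) \<longleftrightarrow>
          eval8 f1_poly A B a0 a1 a2 a3 a4 a5 \<noteq> 0 \<and>
          eval8 f2_poly A B a0 a1 a2 a3 a4 a5 \<noteq> 0) \<and>
     Factorial_Ring.irreducible (f2_poly :: 'k poly8)"
proof -
  have six: "(6 :: 'k) \<noteq> 0" by (rule six_nonzero_of_CHAR[OF assms])
  show ?thesis
    using f3_sq_dvd_Delta[OF six] nonsingular_iff[OF six] irreducible_f2[OF six] by blast
qed

end
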